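(* Let $n\ge 1$. For every $\epsilon>0$ there exist constants $c=c(n,\epsilon)\ge 1$ and $\lambda=\lambda(n,\epsilon)\ge1$ with the following property. If $p$ is a prime and $\zeta_1,\ldots,\zeta_n\in\mu_p$ satisfy $1+\zeta_1+\cdots+\zeta_n\neq 0$, then \[ \#\left\{t\in\mathbb{F}_p : |1+\zeta_1^t+\cdots+\zeta_n^t| < c^{-1}p^{-\lambda}\right\}\le c\,p^{\epsilon}. \]
   Context: $\mu_p$ denotes the set of complex roots of unity whose order divides $p$; for $\zeta\in\mu_p$ and $t\in\mathbb{F}_p$ the power $\zeta^t$ is well defined. *)

theory Defs
  imports "HOL-Analysis.Analysis" "HOL-Computational_Algebra.Primes"
begin

definition roots_unity :: "nat \<Rightarrow> complex set" where
  "roots_unity p = {z. z ^ p = 1}"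

(* The elements of F_p are represented by the residues t in {0..<p}; the next lemma
   shows that the power z ^ t depends only on the residue class of t. *)
lemma roots_unity_power_mod:
  assumes "z \<in> roots_unity p"
  shows "z ^ (t mod p) = z ^ t"
proof -
  have "z ^ t = z ^ (p * (t div p) + t mod p)"
    by simp
  also have "\<dots> = (z ^ p) ^ (t div p) * z ^ (t mod p)"
    by (simp only: power_add power_mult)
  also have "\<dots> = z ^ (t mod p)"
    using assms by (simp add: roots_unity_def)
  finally show ?thesis by simp
qed

end

theory Submission
  imports Defs "HOL-Computational_Algebra.Polynomial"
begin

text \<open>
  Suppose that the bound fails. Then there are primes \<open>p\<close> tending to infinity and sets of \<open>t\<close> on which
  the sum is smaller than any fixed power of \<open>p\<close>. Sorting the fractional parts of \<open>a\<^sub>i t / p\<close>, where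
  \<open>\<zeta>\<^sub>i = exp (2 \<pi> \<i> a\<^sub>i / p)\<close>, into boxes of side \<open>p powr (- e)\<close> and subtracting a base point gives
  numbers \<open>y\<^sub>i\<close> of size at most \<open>p powr (- e)\<close> with \<open>p y\<^sub>i\<close> integral and \<open>\<Sum>i. c\<^sub>i exp (2 \<pi> \<i> y\<^sub>i)\<close> tiny,
  still for an unbounded number of \<open>t\<close>.

  Functions of \<open>(p, t)\<close> of polynomial growth in \<open>p\<close>, modulo those smaller than every power of \<open>p\<close> and
  modulo an ultrafilter, form a spherically complete ultrametric field; let \<open>K\<close> be the subfield of
  functions of \<open>p\<close> alone. There the sum is zero, the exponentials are given by their power series, and the
  differences \<open>y\<^sub>i - y\<^sub>j\<close> are transcendental over \<open>K\<close> because the number of \<open>t\<close> is unbounded. Such a linear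
  relation is impossible, by an argument in the style of Ax: Noether normalisation expresses the \<open>y\<^sub>i\<close>
  through analytically independent \<open>u\<^sub>l\<close> for which \<open>p u\<^sub>l\<close> is again integral, so that there are
  derivations \<open>D\<^sub>l\<close> dual to the \<open>u\<^sub>l\<close> with \<open>D\<^sub>l E\<^sub>i = w E\<^sub>i D\<^sub>l y\<^sub>i\<close>. By Siegel's lemma the \<open>y\<^sub>i\<close> are even algebraic
  over \<open>K(u)\<close>: an auxiliary polynomial takes a value that is integral up to a power of \<open>p\<close> and too small
  not to vanish. Differentiating a shortest relation between the \<open>E\<^sub>i\<close> over the algebraic closure of
  \<open>K(u)\<close> produces an algebraic function with the differential equation of \<open>exp (w (y\<^sub>i - y\<^sub>j))\<close>,
  which does not exist.
\<close>

section \<open>Derivations of fields\<close>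

text \<open>Noether normalisation alone makes each \<open>y\<close> algebraic over convergent power
  series in the coordinates \<open>u\<close>, and a derivation that kills \<open>K\<close> and
  \<open>u\<close> need not kill such a series. The descent to \<open>K(u)\<close> is where
  arithmetic enters: \<open>p u\<close> and \<open>p y\<close> are integral, so a polynomial in them
  with integral coefficients vanishes once its value is small. This is why changes of coordinates
  are restricted to natural number coefficients. That these suffice is due to residue characteristic
  zero, which also makes the factorials units and lets the exponential series converge on the open
  unit ball. The exponent \<epsilon> enters only through the boxes: with side
  \<open>p powr (- \<epsilon> / m)\<close> there are about \<open>p powr \<epsilon>\<close> of them,
  so more than \<open>N * p powr \<epsilon>\<close> values of \<open>t\<close> leave unboundedly
  many in one box as \<open>N\<close> grows. The ultrafilter is chosen such that each of its members
  contains arbitrarily many \<open>t\<close> over a single prime; a polynomial relation over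
  \<open>K\<close> would then have too many separated near-zeros for its degree.\<close>

definition subring :: "'a::idom set \<Rightarrow> bool" where
  "subring R \<longleftrightarrow> 1 \<in> R \<and> (\<forall>x\<in>R. \<forall>y\<in>R. x - y \<in> R \<and> x * y \<in> R)"

lemma subringI:
  assumes "1 \<in> R" "\<And>x y. x \<in> R \<Longrightarrow> y \<in> R \<Longrightarrow> x - y \<in> R" "\<And>x y. x \<in> R \<Longrightarrow> y \<in> R \<Longrightarrow> x * y \<in> R"
  shows "subring R"
  using assms by (auto simp: subring_def)

lemma
  assumes "subring R"
  shows subring_1: "1 \<in> R" and subring_0: "0 \<in> R"
    and subring_diff: "x \<in> R \<Longrightarrow> y \<in> R \<Longrightarrow> x - y \<in> R"
    and subring_mult: "x \<in> R \<Longrightarrow> y \<in> R \<Longrightarrow> x * y \<in> R"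
    and subring_minus: "x \<in> R \<Longrightarrow> - x \<in> R"
    and subring_add: "x \<in> R \<Longrightarrow> y \<in> R \<Longrightarrow> x + y \<in> R"
proof -
  show 1: "1 \<in> R" and d: "x \<in> R \<Longrightarrow> y \<in> R \<Longrightarrow> x - y \<in> R"
    and "x \<in> R \<Longrightarrow> y \<in> R \<Longrightarrow> x * y \<in> R" for x y
    using assms by (auto simp: subring_def)
  show 0: "0 \<in> R" using d[OF 1 1] by simp
  show m: "x \<in> R \<Longrightarrow> - x \<in> R" for x using d[OF 0, of x] by simp
  show "x \<in> R \<Longrightarrow> y \<in> R \<Longrightarrow> x + y \<in> R" using d[OF _ m, of x y] by simp
qed

lemma subring_of_nat: "subring R \<Longrightarrow> of_nat n \<in> R"
  by (induction n) (auto intro: subring_0 subring_add subring_1)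

lemma subring_power: "subring R \<Longrightarrow> x \<in> R \<Longrightarrow> x ^ n \<in> R"
  by (induction n) (auto intro: subring_1 subring_mult)

lemma subring_sum: "subring R \<Longrightarrow> (\<And>i. i \<in> I \<Longrightarrow> f i \<in> R) \<Longrightarrow> sum f I \<in> R"
  by (induction I rule: infinite_finite_induct) (auto intro: subring_0 subring_add)

lemma subring_prod: "subring R \<Longrightarrow> (\<And>i. i \<in> I \<Longrightarrow> f i \<in> R) \<Longrightarrow> prod f I \<in> R"
  by (induction I rule: infinite_finite_induct) (auto intro: subring_1 subring_mult)

definition polys_over :: "'a::idom set \<Rightarrow> 'a poly set" where
  "polys_over R = {f. \<forall>i. coeff f i \<in> R}"

lemma subring_polys_over: "subring R \<Longrightarrow> subring (polys_over R)"
  by (rule subringI)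
     (auto simp: polys_over_def coeff_mult coeff_1 intro: subring_1 subring_0 subring_diff subring_mult subring_sum)

lemma monom_polys_over: "subring R \<Longrightarrow> c \<in> R \<Longrightarrow> monom c n \<in> polys_over R"
  by (auto simp: polys_over_def subring_0)

lemma const_polys_over: "subring R \<Longrightarrow> c \<in> R \<Longrightarrow> [:c:] \<in> polys_over R"
  using monom_polys_over[of R c 0] by (simp add: monom_0)

lemma smult_polys_over: "subring R \<Longrightarrow> c \<in> R \<Longrightarrow> f \<in> polys_over R \<Longrightarrow> smult c f \<in> polys_over R"
  by (auto simp: polys_over_def subring_mult)

lemma pderiv_polys_over: "subring R \<Longrightarrow> f \<in> polys_over R \<Longrightarrow> pderiv f \<in> polys_over R"
  by (auto simp: polys_over_def coeff_pderiv intro!: subring_mult subring_add subring_1 subring_of_nat)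

text \<open>Only the arguments are confined to \<open>R\<close>; values of \<open>d\<close> may
  leave it, so that a derivation can be extended step by step inside one ambient field.\<close>

definition derivation_on :: "'a::idom set \<Rightarrow> ('a \<Rightarrow> 'a) \<Rightarrow> bool" where
  "derivation_on R d \<longleftrightarrow> (\<forall>x\<in>R. \<forall>y\<in>R. d (x + y) = d x + d y \<and> d (x * y) = d x * y + x * d y)"

abbreviation derivation :: "('a::idom \<Rightarrow> 'a) \<Rightarrow> bool" where
  "derivation \<equiv> derivation_on UNIV"

lemma derivation_on_0: "derivation_on R d \<Longrightarrow> subring R \<Longrightarrow> d 0 = 0"
proof -
  assume "derivation_on R d" "subring R"
  then have "d (0 + 0) = d 0 + d 0" unfolding derivation_on_def using subring_0 by blast
  then show ?thesis by (metis add_cancel_right_right add_0)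
qed

lemma derivation_on_1: "derivation_on R d \<Longrightarrow> subring R \<Longrightarrow> d 1 = 0"
proof -
  assume "derivation_on R d" "subring R"
  then have "d (1 * 1) = d 1 * 1 + 1 * d 1" unfolding derivation_on_def using subring_1 by blast
  then show ?thesis by (metis add_cancel_right_right mult_1 mult_1_right)
qed

lemma derivation_on_sum:
  assumes "derivation_on R d" "subring R" "\<And>i. i \<in> I \<Longrightarrow> f i \<in> R"
  shows "d (sum f I) = (\<Sum>i\<in>I. d (f i))"
  using assms(3)
proof (induction I rule: infinite_finite_induct)
  case (insert a F)
  then have "sum f F \<in> R" by (intro subring_sum[OF assms(2)]) auto
  then show ?case using insert assms(1) by (auto simp: derivation_on_def)
qed (auto simp: derivation_on_0[OF assms(1,2)])

lemma subring_UNIV: "subring UNIV" by (simp add: subring_def)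

lemma
  assumes "derivation d"
  shows derivation_add: "d (x + y) = d x + d y" and derivation_mult: "d (x * y) = d x * y + x * d y"
    and derivation_0: "d 0 = 0" and derivation_1: "d 1 = 0" and derivation_minus: "d (- x) = - d x"
    and derivation_diff: "d (x - y) = d x - d y" and derivation_sum: "d (sum f I) = (\<Sum>i\<in>I. d (f i))"
proof -
  show a: "d (x + y) = d x + d y" for x y using assms by (auto simp: derivation_on_def)
  show "d (x * y) = d x * y + x * d y" using assms by (auto simp: derivation_on_def)
  show 0: "d 0 = 0" using derivation_on_0[OF assms subring_UNIV] .
  show "d 1 = 0" using derivation_on_1[OF assms subring_UNIV] .
  show m: "d (- x) = - d x" for x using a[of x "-x"] 0 by (simp add: add_eq_0_iff)
  show "d (x - y) = d x - d y" using a[of x "-y"] m by simp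
  show "d (sum f I) = (\<Sum>i\<in>I. d (f i))" using derivation_on_sum[OF assms subring_UNIV] by auto
qed

lemma derivation_inverse:
  fixes d :: "'a::field \<Rightarrow> 'a"
  assumes "derivation d" "x \<noteq> 0"
  shows "d (inverse x) = - d x / x^2"
proof -
  have "d (x * inverse x) = 0" using assms by (simp add: derivation_1)
  then have "d x * inverse x + x * d (inverse x) = 0" using derivation_mult[OF assms(1)] by simp
  then have "x * d (inverse x) = - (d x / x)" by (simp add: add_eq_0_iff field_simps)
  then have "d (inverse x) = - (d x / x) / x" using assms(2) by (simp add: field_simps)
  then show ?thesis by (simp add: power2_eq_square)
qed

lemma derivation_power:
  assumes "derivation d"
  shows "d (x ^ n) = of_nat n * x ^ (n - 1) * d x"
proof (induction n)
  case (Suc n)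
  have "x * x ^ (n - 1) = x ^ n" if "n > 0" using that by (metis Suc_diff_1 power_Suc)
  then show ?case using Suc derivation_mult[OF assms]
    by (cases "n = 0") (auto simp: algebra_simps)
qed (simp add: derivation_1[OF assms])

text \<open>The value at \<open>poly f x\<close> of an extension of \<open>d\<close> that maps \<open>x\<close> to \<open>\<xi>\<close>.\<close>

definition pder :: "('a::idom \<Rightarrow> 'a) \<Rightarrow> 'a \<Rightarrow> 'a \<Rightarrow> 'a poly \<Rightarrow> 'a" where
  "pder d x \<xi> f = poly (map_poly d f) x + poly (pderiv f) x * \<xi>"

context
  fixes R :: "'a::idom set" and d
  assumes R: "subring R" and d: "derivation_on R d"
begin

lemma d0: "d 0 = 0" using derivation_on_0[OF d R] .

lemma map_poly_add_derivation:
  "f \<in> polys_over R \<Longrightarrow> g \<in> polys_over R \<Longrightarrow> map_poly d (f + g) = map_poly d f + map_poly d g"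
  using d by (intro poly_eqI) (auto simp: coeff_map_poly d0 polys_over_def derivation_on_def)

lemma map_poly_mult_derivation:
  assumes "f \<in> polys_over R" "g \<in> polys_over R"
  shows "map_poly d (f * g) = map_poly d f * g + f * map_poly d g"
proof (rule poly_eqI)
  fix n
  have "coeff (map_poly d (f * g)) n = d (\<Sum>i\<le>n. coeff f i * coeff g (n - i))"
    by (simp add: coeff_map_poly d0 coeff_mult)
  also have "\<dots> = (\<Sum>i\<le>n. d (coeff f i * coeff g (n - i)))"
    using assms by (intro derivation_on_sum[OF d R]) (auto simp: polys_over_def intro: subring_mult[OF R])
  also have "\<dots> = (\<Sum>i\<le>n. d (coeff f i) * coeff g (n - i) + coeff f i * d (coeff g (n - i)))"
    using assms d by (intro sum.cong) (auto simp: polys_over_def derivation_on_def)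
  finally show "coeff (map_poly d (f * g)) n = coeff (map_poly d f * g + f * map_poly d g) n"
    by (simp add: coeff_mult sum.distrib coeff_map_poly d0)
qed

lemma pder_add:
  "f \<in> polys_over R \<Longrightarrow> g \<in> polys_over R \<Longrightarrow> pder d x \<xi> (f + g) = pder d x \<xi> f + pder d x \<xi> g"
  by (simp add: pder_def map_poly_add_derivation pderiv_add algebra_simps)

lemma pder_mult:
  "f \<in> polys_over R \<Longrightarrow> g \<in> polys_over R \<Longrightarrow>
   pder d x \<xi> (f * g) = pder d x \<xi> f * poly g x + poly f x * pder d x \<xi> g"
  by (simp add: pder_def map_poly_mult_derivation pderiv_mult algebra_simps)

lemma pder_diff:
  assumes "f \<in> polys_over R" "g \<in> polys_over R"
  shows "pder d x \<xi> (f - g) = pder d x \<xi> f - pder d x \<xi> g"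
  using pder_add[of "f - g" g x \<xi>] subring_diff[OF subring_polys_over[OF R]] assms by simp

lemma pder_const: "pder d x \<xi> [:c:] = d c"
  by (simp add: pder_def map_poly_pCons d0)

end

text \<open>Pseudo-division by the minimal \<open>f\<close>: since \<open>R\<close> need not be a
  field, \<open>g\<close> is multiplied by the leading coefficient \<open>a\<close> of
  \<open>f\<close> before its leading term is removed, and \<open>a\<close> is cancelled at the end.
  Hence a value \<xi> compatible with \<open>f\<close> alone already gives a well-defined derivation
  on R[x].\<close>

lemma pder_eq_0:
  fixes R :: "'a::idom set"
  assumes R: "subring R" and d: "derivation_on R d"
    and f: "f \<in> polys_over R" "f \<noteq> 0" "poly f x = 0" "pder d x \<xi> f = 0"
    and min: "\<And>g. g \<in> polys_over R \<Longrightarrow> g \<noteq> 0 \<Longrightarrow> poly g x = 0 \<Longrightarrow> degree f \<le> degree g"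
    and g: "g \<in> polys_over R" "poly g x = 0"
  shows "pder d x \<xi> g = 0"
  using g
proof (induction "degree g" arbitrary: g rule: less_induct)
  case less
  note SP = subring_polys_over[OF R]
  show ?case
  proof (cases "g = 0")
    case True
    then show ?thesis using pder_const[OF R d, of x \<xi> 0] derivation_on_0[OF d R] by simp
  next
    case False
    define a b where "a = lead_coeff f" and "b = lead_coeff g"
    have ab: "a \<noteq> 0" "b \<noteq> 0" "a \<in> R" "b \<in> R"
      using f less.prems False by (auto simp: a_def b_def polys_over_def)
    have deg: "degree f \<le> degree g" using min less.prems False by blast
    define h where "h = monom b (degree g - degree f)"
    have h: "h \<in> polys_over R" using ab R by (simp add: h_def monom_polys_over)
    define g1 where "g1 = [:a:] * g - f * h"
    have g1R: "g1 \<in> polys_over R" unfolding g1_def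
      using SP f less.prems h ab const_polys_over[OF R] by (intro subring_diff subring_mult) auto
    have g1x: "poly g1 x = 0" using f less.prems by (simp add: g1_def)
    have "degree g1 < degree g \<or> g1 = 0"
    proof (cases "degree g = 0")
      case True
      then have "degree f = 0" using deg by simp
      with f(3) have "f = 0" by (auto elim: degree_eq_zeroE)
      then show ?thesis using f by simp
    next
      case dg: False
      have "degree ([:a:] * g) = degree g" using ab by simp
      moreover have "degree (f * h) = degree g" using ab f deg by (simp add: h_def degree_mult_eq degree_monom_eq monom_eq_0_iff)
      ultimately have "degree g1 \<le> degree g" unfolding g1_def by (intro degree_diff_le) auto
      moreover have "coeff g1 (degree g) = 0"
      proof -
        have "coeff (f * h) (degree f + degree h) = a * b"
          using coeff_mult_degree_sum[of f h] ab by (simp add: a_def h_def degree_monom_eq)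
        moreover have "degree f + degree h = degree g" using ab deg by (simp add: h_def degree_monom_eq)
        ultimately show ?thesis by (simp add: g1_def b_def)
      qed
      ultimately show ?thesis using dg by (metis leading_coeff_0_iff le_neq_implies_less)
    qed
    then have "pder d x \<xi> g1 = 0"
    proof
      assume "g1 = 0" then show ?thesis using pder_const[OF R d, of x \<xi> 0] derivation_on_0[OF d R] by simp
    qed (use less.hyps g1R g1x in blast)
    moreover have "pder d x \<xi> g1 = pder d x \<xi> ([:a:] * g) - pder d x \<xi> (f * h)"
      unfolding g1_def by (intro pder_diff[OF R d] subring_mult[OF SP]) (use f less.prems h ab const_polys_over[OF R] in auto)
    moreover have "pder d x \<xi> (f * h) = 0" using pder_mult[OF R d f(1) h] f by simp
    moreover have "pder d x \<xi> ([:a:] * g) = a * pder d x \<xi> g"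
      using pder_mult[OF R d const_polys_over[OF R ab(3)] less.prems(1)] less.prems by simp
    ultimately show ?thesis using ab by simp
  qed
qed

section \<open>Transcendental and algebraic elements\<close>

definition transc :: "'a::idom set \<Rightarrow> 'a \<Rightarrow> bool" where
  "transc R x \<longleftrightarrow> (\<forall>f\<in>polys_over R. poly f x = 0 \<longrightarrow> f = 0)"

lemma minimal_poly:
  assumes "\<not> transc R x"
  obtains f where "f \<in> polys_over R" "f \<noteq> 0" "poly f x = 0"
    "\<And>g. g \<in> polys_over R \<Longrightarrow> g \<noteq> 0 \<Longrightarrow> poly g x = 0 \<Longrightarrow> degree f \<le> degree g"
proof -
  from assms have ex: "\<exists>f. f \<in> polys_over R \<and> f \<noteq> 0 \<and> poly f x = 0" by (auto simp: transc_def)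
  define P where "P = (\<lambda>f. f \<in> polys_over R \<and> f \<noteq> 0 \<and> poly f x = 0)"
  have "P (arg_min degree P) \<and> (\<forall>y. P y \<longrightarrow> degree (arg_min degree P) \<le> degree y)"
    using arg_min_nat_lemma[of P _ degree] ex unfolding P_def by blast
  then show ?thesis using that[of "arg_min degree P"] unfolding P_def by blast
qed

text \<open>In characteristic zero \<open>pderiv f\<close> is nonzero of smaller degree, so
  minimality forbids that it vanishes at \<open>x\<close>.\<close>

lemma minimal_poly_separable:
  fixes x :: "'a::field_char_0"
  assumes R: "subring R" and f: "f \<in> polys_over R" "f \<noteq> 0" "poly f x = 0"
    and min: "\<And>g. g \<in> polys_over R \<Longrightarrow> g \<noteq> 0 \<Longrightarrow> poly g x = 0 \<Longrightarrow> degree f \<le> degree g"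
  shows "poly (pderiv f) x \<noteq> 0"
proof
  assume 0: "poly (pderiv f) x = 0"
  have df: "degree f > 0"
    using f(2,3) by (auto elim: degree_eq_zeroE intro!: gr0I)
  then have "pderiv f \<noteq> 0" by (simp add: pderiv_eq_0_iff)
  with min[OF pderiv_polys_over[OF R f(1)]] 0 df show False by (simp add: degree_pderiv)
qed

lemma derivation_poly:
  assumes d: "derivation d" shows "d (poly f x) = pder d x (d x) f"
proof (induction f)
  case 0 show ?case using pder_const[OF subring_UNIV d(1), of x "d x" 0] d by (simp add: derivation_0)
next
  case (pCons a f)
  have "pder d x (d x) (pCons a f) = pder d x (d x) ([:a:] + [:0,1:] * f)" by simp
  also have "\<dots> = d a + pder d x (d x) [:0,1:] * poly f x + x * pder d x (d x) f"
    using pder_add[OF subring_UNIV d(1), of "[:a:]" "[:0,1:] * f"] pder_const[OF subring_UNIV d(1)]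
      pder_mult[OF subring_UNIV d(1), of "[:0,1:]" f] by (simp add: polys_over_def)
  also have "pder d x (d x) [:0,1:] = d x"
    by (simp add: pder_def map_poly_pCons derivation_0[OF d(1)] derivation_1[OF d(1)] pderiv_pCons)
  finally show ?case using pCons by (simp add: derivation_add[OF d(1)] derivation_mult[OF d(1)])
qed

text \<open>Applying \<open>d\<close> to the minimal relation leaves only
  \<open>poly (pderiv f) x * d x = 0\<close>.\<close>

lemma derivation_algebraic_eq_0:
  fixes x :: "'a::field_char_0"
  assumes R: "subring R" and d: "derivation d" "\<And>r. r \<in> R \<Longrightarrow> d r = 0" and x: "\<not> transc R x"
  shows "d x = 0"
proof -
  obtain f where f: "f \<in> polys_over R" "f \<noteq> 0" "poly f x = 0"
    "\<And>g. g \<in> polys_over R \<Longrightarrow> g \<noteq> 0 \<Longrightarrow> poly g x = 0 \<Longrightarrow> degree f \<le> degree g"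
    using minimal_poly[OF x] by metis
  have "d (poly f x) = pder d x (d x) f" by (rule derivation_poly[OF d(1)])
  moreover have "map_poly d f = 0"
    using f(1) d by (intro poly_eqI) (simp add: coeff_map_poly derivation_0 polys_over_def)
  ultimately have "poly (pderiv f) x * d x = 0"
    using f(3) by (simp only: pder_def derivation_0[OF d(1)] poly_0 add_0)
  then show ?thesis using minimal_poly_separable[OF R f] mult_eq_0_iff by blast
qed

text \<open>A derivation on a subring, given by its graph, so that Zorn's lemma applies.\<close>

definition der_graph :: "('a::idom \<times> 'a) set \<Rightarrow> bool" where
  "der_graph G \<longleftrightarrow> (1, 0) \<in> G \<and> (\<forall>x a b. (x, a) \<in> G \<longrightarrow> (x, b) \<in> G \<longrightarrow> a = b) \<and>
    (\<forall>x a y b. (x, a) \<in> G \<longrightarrow> (y, b) \<in> G \<longrightarrow> (x - y, a - b) \<in> G \<and> (x * y, a * y + x * b) \<in> G)"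

lemma der_graphI:
  assumes "(1, 0) \<in> G" "\<And>x a b. (x, a) \<in> G \<Longrightarrow> (x, b) \<in> G \<Longrightarrow> a = b"
    "\<And>x a y b. (x, a) \<in> G \<Longrightarrow> (y, b) \<in> G \<Longrightarrow> (x - y, a - b) \<in> G"
    "\<And>x a y b. (x, a) \<in> G \<Longrightarrow> (y, b) \<in> G \<Longrightarrow> (x * y, a * y + x * b) \<in> G"
  shows "der_graph G"
  using assms unfolding der_graph_def by blast

lemma der_graph_fun:
  assumes "der_graph G"
  obtains R d where "subring R" "derivation_on R d" "G = {(x, d x) |x. x \<in> R}"
proof
  define R where "R = fst ` G"
  define d where "d = (\<lambda>x. THE a. (x, a) \<in> G)"
  note G = assms[unfolded der_graph_def]
  have d: "d x = a" if "(x, a) \<in> G" for x a unfolding d_def using that G by blast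
  show G': "G = {(x, d x) |x. x \<in> R}" using d by (force simp: R_def)
  then have dG: "(x, d x) \<in> G" if "x \<in> R" for x using that by auto
  show S: "subring R"
  proof (rule subringI)
    show "1 \<in> R" using G unfolding R_def by force
    show "x - y \<in> R" "x * y \<in> R" if "x \<in> R" "y \<in> R" for x y
    proof -
      have "(x - y, d x - d y) \<in> G" "(x * y, d x * y + x * d y) \<in> G"
        using G dG[OF that(1)] dG[OF that(2)] by blast+
      then show "x - y \<in> R" "x * y \<in> R" unfolding R_def by force+
    qed
  qed
  have min: "d (- y) = - d y" if "y \<in> R" for y
  proof -
    have 0: "d 0 = 0" using G dG[OF subring_0[OF S]] by (metis cancel_comm_monoid_add_class.diff_cancel d)
    have "(0 - y, d 0 - d y) \<in> G" using G dG[OF that] dG[OF subring_0[OF S]] by blast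
    then show ?thesis using d 0 by auto
  qed
  show "derivation_on R d" unfolding derivation_on_def
  proof (intro ballI conjI)
    fix x y assume xy: "x \<in> R" "y \<in> R"
    have "(x - (- y), d x - d (- y)) \<in> G" using G dG[OF xy(1)] dG[OF subring_minus[OF S xy(2)]] by blast
    then show "d (x + y) = d x + d y" using d min[OF xy(2)] by auto
    show "d (x * y) = d x * y + x * d y" using G dG[OF xy(1)] dG[OF xy(2)] d by blast
  qed
qed

text \<open>The assumption on \<xi> says that \<open>pder d x \<xi> g\<close> depends only on
  \<open>poly g x\<close>; closure under differences and products then follows from the rules for
  \<open>pder\<close>.\<close>

lemma der_graph_adjoin:
  fixes R :: "'a::field_char_0 set"
  assumes R: "subring R" and d: "derivation_on R d"
    and \<xi>: "\<And>g. g \<in> polys_over R \<Longrightarrow> poly g x = 0 \<Longrightarrow> pder d x \<xi> g = 0"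
  shows "der_graph {(poly g x, pder d x \<xi> g) |g. g \<in> polys_over R}" (is "der_graph ?H")
proof (rule der_graphI)
  note SP = subring_polys_over[OF R]
  have "pder d x \<xi> 1 = 0" using pder_const[OF R d, of x \<xi> 1] derivation_on_1[OF d R] by (simp add: one_pCons)
  moreover have "(poly 1 x, pder d x \<xi> 1) \<in> ?H" using subring_1[OF SP] by blast
  ultimately show "(1, 0) \<in> ?H" by (simp only: poly_1)
  show "a = b" if "(y, a) \<in> ?H" "(y, b) \<in> ?H" for y a b
  proof -
    from that obtain g h where g: "g \<in> polys_over R" "y = poly g x" "a = pder d x \<xi> g"
      and h: "h \<in> polys_over R" "y = poly h x" "b = pder d x \<xi> h" by auto
    have "poly (g - h) x = 0" using g(2) h(2) by simp
    then have "pder d x \<xi> (g - h) = 0" by (intro \<xi> subring_diff[OF SP] g h)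
    then show ?thesis using pder_diff[OF R d] g h by simp
  qed
  fix y a z b assume "(y, a) \<in> ?H" "(z, b) \<in> ?H"
  then obtain g h where g: "g \<in> polys_over R" "y = poly g x" "a = pder d x \<xi> g"
      and h: "h \<in> polys_over R" "z = poly h x" "b = pder d x \<xi> h" by auto
  have "g - h \<in> polys_over R" "g * h \<in> polys_over R" using SP g h by (auto intro: subring_diff subring_mult)
  moreover have "pder d x \<xi> (g - h) = a - b" "pder d x \<xi> (g * h) = a * z + y * b"
    using pder_diff[OF R d] pder_mult[OF R d] g h by auto
  moreover have "y - z = poly (g - h) x" "y * z = poly (g * h) x" using g h by simp_all
  ultimately show "(y - z, a - b) \<in> ?H" "(y * z, a * z + y * b) \<in> ?H"
    by (metis (mono_tags, lifting) mem_Collect_eq)+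
qed

text \<open>Zorn's lemma gives a maximal graph, and its domain is everything: an element
  transcendental over the domain may receive any derivative, and for an algebraic one the derivative
  is forced by the minimal polynomial. Inverses need no separate treatment, being algebraic over the
  domain.\<close>

lemma derivation_extends:
  fixes G :: "('a::field_char_0 \<times> 'a) set"
  assumes "der_graph G"
  shows "\<exists>D. derivation D \<and> (\<forall>x a. (x, a) \<in> G \<longrightarrow> D x = a)"
proof -
  define A where "A = {H. G \<subseteq> H \<and> der_graph H}"
  have "\<exists>U\<in>A. \<forall>X\<in>C. X \<subseteq> U" if C: "C \<in> chains A" for C
  proof (cases "C = {}")
    case True then show ?thesis using assms by (auto simp: A_def)
  next
    case False
    have CA: "H \<in> C \<Longrightarrow> G \<subseteq> H \<and> der_graph H" for H using C by (auto simp: chains_def A_def)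
    have lin: "H \<in> C \<Longrightarrow> H' \<in> C \<Longrightarrow> H \<subseteq> H' \<or> H' \<subseteq> H" for H H'
      using C by (auto simp: chains_def chain_subset_def)
    have two: "\<exists>H\<in>C. p \<in> H \<and> q \<in> H" if "p \<in> \<Union>C" "q \<in> \<Union>C" for p q using that lin by blast
    have "der_graph (\<Union>C)"
    proof (rule der_graphI)
      show "(1, 0) \<in> \<Union>C" using False CA by (auto simp: der_graph_def)
      show "a = b" if "(x, a) \<in> \<Union>C" "(x, b) \<in> \<Union>C" for x a b
        using two[OF that] CA unfolding der_graph_def by blast
      show "(x - y, a - b) \<in> \<Union>C" "(x * y, a * y + x * b) \<in> \<Union>C"
        if "(x, a) \<in> \<Union>C" "(y, b) \<in> \<Union>C" for x a y b
        using two[OF that] CA unfolding der_graph_def by blast+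
    qed
    then have "\<Union>C \<in> A" using False CA by (auto simp: A_def)
    then show ?thesis by blast
  qed
  then obtain M where M: "M \<in> A" "\<forall>X\<in>A. M \<subseteq> X \<longrightarrow> X = M" using Zorn_Lemma2[of A] by blast
  then have "der_graph M" by (simp add: A_def)
  then obtain R d where R: "subring R" "derivation_on R d" and MR: "M = {(x, d x) |x. x \<in> R}"
    by (rule der_graph_fun)
  have "x \<in> R" for x
  proof -
    have "\<exists>\<xi>. \<forall>g\<in>polys_over R. poly g x = 0 \<longrightarrow> pder d x \<xi> g = 0"
    proof (cases "transc R x")
      case True
      have "pder d x 0 0 = 0" using pder_const[OF R, of x 0 0] derivation_on_0[OF R(2,1)] by simp
      then show ?thesis using True by (auto simp: transc_def intro!: exI[of _ 0])
    next
      case False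
      obtain f where f: "f \<in> polys_over R" "f \<noteq> 0" "poly f x = 0"
        "\<And>g. g \<in> polys_over R \<Longrightarrow> g \<noteq> 0 \<Longrightarrow> poly g x = 0 \<Longrightarrow> degree f \<le> degree g"
        using minimal_poly[OF False] by metis
      \<comment> \<open>The only value for which \<open>pder d x \<xi> f\<close> vanishes; the
        denominator is nonzero by separability.\<close>
      define \<xi> where "\<xi> = - poly (map_poly d f) x / poly (pderiv f) x"
      have "poly (pderiv f) x \<noteq> 0" by (rule minimal_poly_separable[OF R(1) f])
      then have "pder d x \<xi> f = 0"
        unfolding pder_def \<xi>_def by (metis add.right_inverse minus_divide_left nonzero_mult_div_cancel_left times_divide_eq_right mult_minus_right)
      then show ?thesis using pder_eq_0[OF R f(1-3) _ f(4)] by blast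
    qed
    then obtain \<xi> where \<xi>: "\<And>g. g \<in> polys_over R \<Longrightarrow> poly g x = 0 \<Longrightarrow> pder d x \<xi> g = 0" by blast
    let ?H = "{(poly g x, pder d x \<xi> g) |g. g \<in> polys_over R}"
    have H: "der_graph ?H" by (rule der_graph_adjoin[OF R \<xi>])
    have MH: "M \<subseteq> ?H"
    proof -
      have "(r, d r) \<in> ?H" if "r \<in> R" for r
      proof -
        have "r = poly [:r:] x" "d r = pder d x \<xi> [:r:]" using pder_const[OF R, of x \<xi> r] by simp_all
        then show ?thesis using const_polys_over[OF R(1) that] by blast
      qed
      then show ?thesis using MR by blast
    qed
    have "G \<subseteq> ?H" using MH M(1) unfolding A_def by blast
    then have "?H \<in> A" using H unfolding A_def by blast
    then have "?H = M" using M(2) MH by blast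
    moreover have "[:0, 1:] \<in> polys_over R"
      using subring_0[OF R(1)] subring_1[OF R(1)] by (auto simp: polys_over_def coeff_pCons split: nat.splits)
    then have "(poly [:0,1:] x, pder d x \<xi> [:0,1:]) \<in> ?H" by blast
    ultimately show "x \<in> R" using MR by auto
  qed
  then have "R = UNIV" by auto
  moreover have "d x = a" if "(x, a) \<in> G" for x a using that M(1) MR by (auto simp: A_def)
  ultimately show ?thesis using R(2) by blast
qed

text \<open>Formal differentiation on R[x], with the elements of \<open>R\<close> as constants,
  extended to the whole field.\<close>

lemma derivation_of_transc:
  fixes x :: "'a::field_char_0"
  assumes R: "subring R" and x: "transc R x"
  obtains D where "derivation D" "\<And>r. r \<in> R \<Longrightarrow> D r = 0" "D x = 1"
proof -
  have d: "derivation_on R (\<lambda>_. 0)" by (simp add: derivation_on_def)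
  have "map_poly (\<lambda>_. 0) g = 0" for g :: "'a poly" by (intro poly_eqI) (simp add: coeff_map_poly)
  then have pd: "pder (\<lambda>_. 0) x 1 g = poly (pderiv g) x" for g
    unfolding pder_def by (metis add_0 mult_1_right poly_0)
  have "der_graph {(poly g x, pder (\<lambda>_. 0) x 1 g) |g. g \<in> polys_over R}"
    (is "der_graph ?H") using x by (intro der_graph_adjoin[OF R d]) (auto simp: transc_def pd)
  then obtain D where D: "derivation D" "\<And>y a. (y, a) \<in> ?H \<Longrightarrow> D y = a"
    using derivation_extends[of ?H] by blast
  have D': "D (poly g x) = poly (pderiv g) x" if "g \<in> polys_over R" for g
    using D(2)[of "poly g x" "poly (pderiv g) x"] that pd by auto
  show ?thesis
  proof (rule that[OF D(1)])
    show "D r = 0" if "r \<in> R" for r using D'[OF const_polys_over[OF R that]] by simp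
    have "[:0, 1:] \<in> polys_over R"
      using subring_0[OF R] subring_1[OF R] by (auto simp: polys_over_def coeff_pCons split: nat.splits)
    then show "D x = 1" using D' by (fastforce simp: pderiv_pCons)
  qed
qed

lemma subring_adjoin:
  assumes "subring R" shows "subring {poly f w |f. f \<in> polys_over R}"
proof (rule subringI)
  note SP = subring_polys_over[OF assms]
  show "1 \<in> {poly f w |f. f \<in> polys_over R}" using subring_1[OF SP] by (metis (mono_tags, lifting) mem_Collect_eq poly_1)
  fix x y assume "x \<in> {poly f w |f. f \<in> polys_over R}" "y \<in> {poly f w |f. f \<in> polys_over R}"
  then obtain f g where fg: "x = poly f w" "y = poly g w" "f \<in> polys_over R" "g \<in> polys_over R" by blast
  have "x - y = poly (f - g) w" "x * y = poly (f * g) w" using fg by simp_all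
  then show "x - y \<in> {poly f w |f. f \<in> polys_over R}" "x * y \<in> {poly f w |f. f \<in> polys_over R}"
    using subring_diff[OF SP fg(3,4)] subring_mult[OF SP fg(3,4)] by blast+
qed

text \<open>The differential equation says that \<open>h\<close> behaves like \<open>exp (c * w)\<close>. Differentiating the minimal
  polynomial of \<open>h\<close> over \<open>K[w]\<close> multiplies its coefficients by different multiples of \<open>c\<close>, so the
  degree-zero and leading coefficients would satisfy a differential equation without solutions in \<open>K(w)\<close>.\<close>

lemma exponential_not_algebraic:
  fixes w :: "'a::field_char_0"
  assumes K: "subring K" and w: "transc K w" and c: "c \<in> K" "c \<noteq> 0" and h: "h \<noteq> 0"
    and eq: "\<And>d. derivation d \<Longrightarrow> (\<And>a. a \<in> K \<Longrightarrow> d a = 0) \<Longrightarrow> d h = c * h * d w"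
  shows False
proof -
  define R where "R = {poly f w |f. f \<in> polys_over K}"
  have R: "subring R" unfolding R_def by (rule subring_adjoin[OF K])
  have KR: "a \<in> R" if "a \<in> K" for a
  proof -
    have "a = poly [:a:] w" by simp
    then show ?thesis unfolding R_def using const_polys_over[OF K that] by blast
  qed
  have "[:0, 1:] \<in> polys_over K"
    using subring_0[OF K] subring_1[OF K] by (auto simp: polys_over_def coeff_pCons split: nat.splits)
  moreover have "w = poly [:0, 1:] w" by simp
  ultimately have wR: "w \<in> R" unfolding R_def by blast
  \<comment> \<open>Otherwise some derivation trivial on \<open>K\<close> and \<open>w\<close> has
    \<open>d h = 1\<close>, against the differential equation.\<close>
  have "\<not> transc R h"
  proof
    assume "transc R h"
    then obtain d where "derivation d" "\<And>r. r \<in> R \<Longrightarrow> d r = 0" "d h = 1" using derivation_of_transc[OF R] by metis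
    then show False using eq[of d] KR wR by simp
  qed
  then obtain f where f: "f \<in> polys_over R" "f \<noteq> 0" "poly f h = 0"
    and min: "\<And>g. g \<in> polys_over R \<Longrightarrow> g \<noteq> 0 \<Longrightarrow> poly g h = 0 \<Longrightarrow> degree f \<le> degree g"
    using minimal_poly by metis
  obtain d where d: "derivation d" "\<And>a. a \<in> K \<Longrightarrow> d a = 0" "d w = 1" using derivation_of_transc[OF K w] by metis
  have dw: "d (poly B w) = poly (pderiv B) w" if "B \<in> polys_over K" for B
  proof -
    have "map_poly d B = 0"
      using that d by (intro poly_eqI) (simp add: coeff_map_poly derivation_0 polys_over_def)
    then show ?thesis using derivation_poly[OF d(1), of B w] d(3)
      by (simp only: pder_def poly_0 add_0 mult_1_right)
  qed
  have dR: "d r \<in> R" if rR: "r \<in> R" for r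
  proof -
    from rR obtain B where "B \<in> polys_over K" "r = poly B w" unfolding R_def by blast
    then show ?thesis unfolding R_def using dw pderiv_polys_over[OF K] by blast
  qed
  define n where "n = degree f"
  have n: "n > 0" unfolding n_def using f(2,3) by (auto elim: degree_eq_zeroE intro!: gr0I)
  note SP = subring_polys_over[OF R]
  \<comment> \<open>Derivative of the relation \<open>f\<close> along the \<open>d\<close> with
    \<open>d w = 1\<close>: besides the derivative of its coefficient, the term of degree
    \<open>i\<close> contributes \<open>c * i\<close> times that coefficient.\<close>
  define g where "g = map_poly d f + smult c ([:0, 1:] * pderiv f)"
  have mapd: "coeff (map_poly d f) i = d (coeff f i)" for i by (simp add: coeff_map_poly derivation_0[OF d(1)])
  have cg: "coeff g i = d (coeff f i) + c * of_nat i * coeff f i" for i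
    by (cases i) (auto simp: g_def mapd coeff_pderiv algebra_simps)
  have "coeff g i \<in> R" for i unfolding cg
    using f(1) KR[OF c(1)] by (intro subring_add[OF R] subring_mult[OF R] dR subring_of_nat[OF R]) (auto simp: polys_over_def)
  then have gR: "g \<in> polys_over R" by (simp add: polys_over_def)
  have "d (poly f h) = poly g h" unfolding derivation_poly[OF d(1)] g_def pder_def
    using eq[OF d(1,2)] d(3) by (simp add: algebra_simps)
  then have gh: "poly g h = 0" using f(3) derivation_0[OF d(1)] by simp
  \<comment> \<open>Both \<open>f\<close> and \<open>g\<close> annihilate \<open>h\<close>, and this
    combination loses the term of degree \<open>n\<close>; minimality makes it zero.\<close>
  define q where "q = smult (lead_coeff f) g - smult (coeff g n) f"
  have qR: "q \<in> polys_over R" unfolding q_def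
    using f(1) gR by (intro subring_diff[OF SP] smult_polys_over[OF R]) (auto simp: polys_over_def)
  have qh: "poly q h = 0" by (simp add: q_def gh f(3))
  have qd: "q = 0 \<or> degree q < n"
  proof -
    have "coeff q i = 0" if "i > n" for i
      using that by (simp add: q_def cg n_def coeff_eq_0 derivation_0[OF d(1)])
    then have "degree q \<le> n" by (intro degree_le) auto
    moreover have "coeff q n = 0" by (simp add: q_def n_def)
    ultimately show ?thesis by (metis leading_coeff_0_iff le_neq_implies_less)
  qed
  have "q = 0"
  proof (rule ccontr)
    assume "q \<noteq> 0"
    then have "n \<le> degree q" unfolding n_def by (intro min qR qh)
    then show False using qd \<open>q \<noteq> 0\<close> by simp
  qed
  then have "coeff q 0 = 0" by simp
  then have key: "coeff f n * d (coeff f 0) = (d (coeff f n) + c * of_nat n * coeff f n) * coeff f 0"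
    by (simp add: q_def cg n_def)
  have f0: "coeff f 0 \<noteq> 0"
  proof
    assume 0: "coeff f 0 = 0"
    then obtain f' where f': "f = pCons 0 f'" by (metis coeff_pCons_0 pCons_cases)
    then have "coeff f' i = coeff f (Suc i)" for i by simp
    then have "f' \<in> polys_over R" using f(1) by (simp add: polys_over_def)
    moreover have "f' \<noteq> 0" using f(2) f' by auto
    moreover have "poly f' h = 0" using f(3) h unfolding f' by simp
    ultimately have "degree f \<le> degree f'" by (rule min)
    then show False using f' \<open>f' \<noteq> 0\<close> by simp
  qed
  have "coeff f 0 \<in> R" "coeff f n \<in> R" using f(1) by (auto simp: polys_over_def)
  then obtain A B where AB: "A \<in> polys_over K" "coeff f 0 = poly A w" "B \<in> polys_over K" "coeff f n = poly B w"
    unfolding R_def by blast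
  have nz: "A \<noteq> 0" "B \<noteq> 0" using f0 AB f(2) n_def by auto
  define G where "G = B * pderiv A - A * pderiv B - smult (c * of_nat n) (A * B)"
  note SK = subring_polys_over[OF K]
  have "G \<in> polys_over K" unfolding G_def using AB c
    by (intro subring_diff[OF SK] subring_mult[OF SK] smult_polys_over[OF K] pderiv_polys_over[OF K] subring_mult[OF K] subring_of_nat[OF K])
  moreover have "poly G w = 0" using key dw[OF AB(1)] dw[OF AB(3)] AB by (simp add: G_def algebra_simps)
  ultimately have "G = 0" using w unfolding transc_def by blast
  \<comment> \<open>A derivative drops the degree, so the top coefficient of \<open>G\<close> comes
    from the product \<open>A * B\<close> alone and is nonzero.\<close>
  have low: "coeff (P * pderiv Q) (degree P + degree Q) = 0" for P Q :: "'a poly"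
  proof (cases "degree Q = 0")
    case True
    then have "pderiv Q = 0" by (simp add: pderiv_eq_0_iff)
    then show ?thesis by simp
  next
    case False
    have "degree (P * pderiv Q) \<le> degree P + degree (pderiv Q)" by (rule degree_mult_le)
    also have "\<dots> < degree P + degree Q" using False by (simp add: degree_pderiv)
    finally show ?thesis by (rule coeff_eq_0)
  qed
  have "coeff G (degree A + degree B) = - (c * of_nat n * (lead_coeff A * lead_coeff B))"
    using low[of B A] low[of A B] coeff_mult_degree_sum[of A B] by (simp add: G_def add.commute)
  then show False using \<open>G = 0\<close> c n nz by simp
qed

section \<open>Restricted power series over an ultrametric field\<close>

text \<open>\<open>nrm_of_nat\<close> is residue characteristic zero. The coefficient field
  \<open>K\<close> is not assumed complete; limits are taken in the ambient field. Completeness is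
  stated with a dyadic rate because all later series carry explicit rates, which the limit
  inherits.\<close>

locale valued =
  fixes nrm :: "'a::field_char_0 \<Rightarrow> real" and K :: "'a set"
  assumes nrm_0 [simp]: "nrm 0 = 0"
    and nrm_pos: "x \<noteq> 0 \<Longrightarrow> nrm x > 0"
    and nrm_mult: "nrm (x * y) = nrm x * nrm y"
    and nrm_add: "nrm (x + y) \<le> max (nrm x) (nrm y)"
    and nrm_of_nat: "n > 0 \<Longrightarrow> nrm (of_nat n) = 1"
    and K_ring: "subring K"
    and K_inverse: "x \<in> K \<Longrightarrow> inverse x \<in> K"
    and complete: "\<And>x C. (\<And>i. nrm (x (Suc i) - x i) \<le> C / 2 ^ i) \<Longrightarrow> \<exists>l. \<forall>i. nrm (l - x i) \<le> C / 2 ^ i"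
begin

lemma nrm_ge_0 [simp]: "nrm x \<ge> 0"
  using nrm_pos[of x] by (cases "x = 0") auto

lemma nrm_eq_0_iff [simp]: "nrm x = 0 \<longleftrightarrow> x = 0"
  using nrm_pos[of x] by (cases "x = 0") auto

lemma nrm_1 [simp]: "nrm 1 = 1" using nrm_of_nat[of 1] by simp

lemma nrm_minus [simp]: "nrm (- x) = nrm x"
proof -
  have "nrm (-1) * nrm (-1) = 1" by (simp flip: nrm_mult)
  then have "nrm (-1) = 1" by (metis abs_of_nonneg nrm_ge_0 power2_eq_square real_sqrt_abs2 real_sqrt_one)
  then show ?thesis using nrm_mult[of "-1" x] by simp
qed

lemma nrm_diff: "nrm (x - y) \<le> max (nrm x) (nrm y)" using nrm_add[of x "-y"] by simp

lemma nrm_diff_comm: "nrm (x - y) = nrm (y - x)" using nrm_minus[of "x - y"] by simp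

lemma nrm_add_le: "nrm x \<le> c \<Longrightarrow> nrm y \<le> c \<Longrightarrow> nrm (x + y) \<le> c" using nrm_add[of x y] by simp
lemma nrm_diff_le: "nrm x \<le> c \<Longrightarrow> nrm y \<le> c \<Longrightarrow> nrm (x - y) \<le> c" using nrm_diff[of x y] by simp

lemma nrm_sum_le: "c \<ge> 0 \<Longrightarrow> (\<And>i. i \<in> I \<Longrightarrow> nrm (f i) \<le> c) \<Longrightarrow> nrm (sum f I) \<le> c"
  by (induction I rule: infinite_finite_induct) (auto intro: nrm_add_le)

lemma nrm_power: "nrm (x ^ n) = nrm x ^ n" by (induction n) (auto simp: nrm_mult)

lemma nrm_prod: "nrm (prod f I) = (\<Prod>i\<in>I. nrm (f i))"
  by (induction I rule: infinite_finite_induct) (auto simp: nrm_mult)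

lemma nrm_inverse: "nrm (inverse x) = inverse (nrm x)"
proof (cases "x = 0")
  case False
  then have "nrm x * nrm (inverse x) = 1" by (simp flip: nrm_mult)
  then show ?thesis using False by (simp add: field_simps)
qed auto

lemma nrm_of_nat_le: "nrm (of_nat n) \<le> 1" using nrm_of_nat[of n] by (cases "n = 0") auto

lemma nrm_eq_of_diff_less: "nrm (x - y) < nrm x \<Longrightarrow> nrm y = nrm x"
  using nrm_add[of "x - y" y] nrm_diff[of x "x - y"] by auto

lemma nrm_small_eq_0:
  assumes "\<And>i. nrm x \<le> C / 2 ^ i" shows "x = 0"
proof -
  have "(\<lambda>i. C * (1/2) ^ i) \<longlonglongrightarrow> C * 0" by (intro tendsto_mult_left LIMSEQ_realpow_zero) auto
  then have "(\<lambda>i. C / 2 ^ i) \<longlonglongrightarrow> 0" by (simp add: power_one_over field_simps)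
  then have "nrm x \<le> 0" by (rule LIMSEQ_le_const) (use assms in auto)
  then show ?thesis using nrm_pos[of x] by force
qed

text \<open>Values of polynomials over \<open>K\<close> in the generators \<open>G\<close> with Gauss norm of radius \<open>r\<close> at most \<open>C\<close>.\<close>

inductive V :: "'a set \<Rightarrow> real \<Rightarrow> real \<Rightarrow> 'a \<Rightarrow> bool" for G r where
  const: "a \<in> K \<Longrightarrow> nrm a \<le> C \<Longrightarrow> V G r C a"
| gen: "V G r C x \<Longrightarrow> g \<in> G \<Longrightarrow> r * C \<le> C' \<Longrightarrow> V G r C' (g * x)"
| add: "V G r C x \<Longrightarrow> V G r C y \<Longrightarrow> V G r C (x + y)"

lemma V_mono:
  assumes "V G r C x" "C \<le> C'" shows "V G r C' x"
  using assms
proof (induction arbitrary: C' rule: V.induct)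
  case (gen C x g C1)
  have "r * C \<le> C'" using gen by linarith
  then show ?case by (rule V.gen[OF gen(1,2)])
qed (auto intro: V.intros)

lemma V_nonneg: "V G r C x \<Longrightarrow> r \<ge> 0 \<Longrightarrow> C \<ge> 0"
proof (induction rule: V.induct)
  case (const a C) then show ?case using nrm_ge_0[of a] by linarith
next
  case (gen C x g C') then show ?case using mult_nonneg_nonneg[of r C] by linarith
qed auto

lemma V_0: "C \<ge> 0 \<Longrightarrow> V G r C 0" by (rule V.const) (auto intro: subring_0[OF K_ring])
lemma V_1: "C \<ge> 1 \<Longrightarrow> V G r C 1" by (rule V.const) (auto intro: subring_1[OF K_ring])

lemma V_scale:
  assumes "V G r C x" "a \<in> K" "nrm a * C \<le> C'" shows "V G r C' (a * x)"
  using assms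
proof (induction arbitrary: C' rule: V.induct)
  case (const b C)
  have "nrm (a * b) \<le> C'" using mult_left_mono[OF const(2) nrm_ge_0[of a]] const by (simp add: nrm_mult)
  then show ?case using const by (intro V.const subring_mult[OF K_ring])
next
  case (gen C x g C'')
  have "V G r (nrm a * C) (a * x)" using gen by auto
  moreover have "r * (nrm a * C) \<le> C'"
    using mult_left_mono[OF gen(3) nrm_ge_0[of a]] gen.prems by (simp add: algebra_simps)
  ultimately have "V G r C' (g * (a * x))" using V.gen gen(2) by blast
  then show ?case by (simp add: algebra_simps)
next
  case (add C x y) then show ?case by (auto simp: distrib_left intro: V.add)
qed

lemma V_minus: "V G r C x \<Longrightarrow> V G r C (- x)"
  using V_scale[of G r C x "-1" C] subring_minus[OF K_ring subring_1[OF K_ring]] by simp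

lemma V_diff: "V G r C x \<Longrightarrow> V G r C y \<Longrightarrow> V G r C (x - y)"
  using V.add[OF _ V_minus, of G r C x y] by simp

lemma V_sum: "C \<ge> 0 \<Longrightarrow> (\<And>i. i \<in> I \<Longrightarrow> V G r C (f i)) \<Longrightarrow> V G r C (sum f I)"
  by (induction I rule: infinite_finite_induct) (auto intro: V_0 V.add)

lemma V_mult:
  assumes "V G r C x" "V G r C' y" "C * C' \<le> C''" "r \<ge> 0"
  shows "V G r C'' (x * y)"
  using assms
proof (induction arbitrary: C'' rule: V.induct)
  case (const a C)
  have "nrm a * C' \<le> C''"
    using mult_right_mono[OF const(2) V_nonneg[OF const(3,5)]] const(4) by linarith
  then show ?case using const by (intro V_scale)
next
  case (gen C x g C1)
  have "V G r (C * C') (x * y)" using gen by auto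
  moreover have "r * (C * C') \<le> C''"
    using mult_right_mono[OF gen(3) V_nonneg[OF gen(5,7)]] gen(6) by (simp add: mult.assoc)
  ultimately have "V G r C'' (g * (x * y))" using V.gen gen(2) by blast
  then show ?case by (simp add: algebra_simps)
next
  case (add C x y) then show ?case by (auto simp: distrib_right intro: V.add)
qed

lemma V_gens: "g \<in> G \<Longrightarrow> V G r r g"
  using V.gen[OF V_1[of 1], of g G r r] by simp

lemma V_power: "V G r C x \<Longrightarrow> r \<ge> 0 \<Longrightarrow> V G r (C ^ n) (x ^ n)"
  by (induction n) (auto intro: V_1 V_mult)

lemma V_subst:
  assumes "V G r C x" "\<And>g. g \<in> G \<Longrightarrow> V G' r' r g" "r' \<ge> 0"
  shows "V G' r' C x"
  using assms(1)
proof (induction rule: V.induct)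
  case (gen C x g C')
  then show ?case using assms(2,3) by (intro V_mult[of G' r' r g C x]) auto
qed (auto intro: V.intros)

lemma V_nrm:
  assumes "V G r C x" "\<And>g. g \<in> G \<Longrightarrow> nrm g \<le> r" "r \<ge> 0"
  shows "nrm x \<le> C"
  using assms(1)
proof (induction rule: V.induct)
  case (gen C x g C')
  have "nrm g * nrm x \<le> r * C" using gen assms by (intro mult_mono) auto
  then show ?case using gen by (simp add: nrm_mult)
qed (auto intro: nrm_add_le)

text \<open>A Cauchy estimate: differentiating removes one generator of weight \<open>r\<close>, so
  the Gauss bound \<open>C\<close> is divided by \<open>r\<close>.\<close>

lemma V_derivation:
  assumes "V G r C x" and d: "derivation d" "\<And>a. a \<in> K \<Longrightarrow> d a = 0" "\<And>g. g \<in> G \<Longrightarrow> nrm (d g) \<le> 1"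
    and G: "\<And>g. g \<in> G \<Longrightarrow> nrm g \<le> r" and r: "r > 0"
  shows "nrm (d x) \<le> C / r"
  using assms(1)
proof (induction rule: V.induct)
  case (const a C)
  then have "C \<ge> 0" using nrm_ge_0[of a] by linarith
  then show ?case using d(2)[of a] r const by auto
next
  case (gen C x g C')
  have C: "C \<ge> 0" using V_nonneg gen r by fastforce
  have "nrm (d g * x) \<le> 1 * C" unfolding nrm_mult
    using V_nrm[OF gen(1) G] r C d(3)[OF gen(2)] by (intro mult_mono) auto
  moreover have "nrm (g * d x) \<le> r * (C / r)" unfolding nrm_mult
    using gen G r by (intro mult_mono) auto
  ultimately have "nrm (d (g * x)) \<le> C"
    using r by (simp add: derivation_mult[OF d(1)]) (intro nrm_add_le; simp)
  also have "C \<le> C' / r" using gen r by (simp add: field_simps)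
  finally show ?case .
next
  case (add C x y) then show ?case by (auto simp: derivation_add[OF d(1)] intro: nrm_add_le)
qed

text \<open>The completion of these values with respect to the Gauss norm.\<close>

definition Vlim :: "'a set \<Rightarrow> real \<Rightarrow> real \<Rightarrow> (nat \<Rightarrow> 'a) \<Rightarrow> 'a \<Rightarrow> bool" where
  "Vlim G r C X x \<longleftrightarrow> (\<forall>L. V G r C (X L) \<and> V G r (C / 2 ^ L) (X (Suc L) - X L) \<and> nrm (x - X L) \<le> C / 2 ^ L)"

text \<open>Only a value is spoken of, and the series behind it is not claimed to be unique;
  uniqueness is what \<open>indep\<close> adds later.\<close>

definition Vb :: "'a set \<Rightarrow> real \<Rightarrow> real \<Rightarrow> 'a \<Rightarrow> bool" where
  "Vb G r C x \<longleftrightarrow> (\<exists>X. Vlim G r C X x)"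

lemma VlimD:
  assumes "Vlim G r C X x"
  shows "V G r C (X L)" "V G r (C / 2 ^ L) (X (Suc L) - X L)" "nrm (x - X L) \<le> C / 2 ^ L"
  using assms by (auto simp: Vlim_def)

lemma Vlim_nonneg: "Vlim G r C X x \<Longrightarrow> C \<ge> 0"
  using order_trans[OF nrm_ge_0 VlimD(3)[of G r C X x 0]] by simp

lemma Vlim_V: "V G r C x \<Longrightarrow> r \<ge> 0 \<Longrightarrow> Vlim G r C (\<lambda>_. x) x"
  using V_nonneg by (auto simp: Vlim_def intro!: V_0)

lemma Vb_V: "V G r C x \<Longrightarrow> r \<ge> 0 \<Longrightarrow> Vb G r C x"
  using Vlim_V[of G r C x] by (auto simp: Vb_def)

lemma Vb_nonneg: "Vb G r C x \<Longrightarrow> C \<ge> 0" using Vlim_nonneg by (auto simp: Vb_def)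

lemma Vlim_mono:
  assumes "Vlim G r C X x" "C \<le> C'" shows "Vlim G r C' X x"
proof -
  have *: "C / 2 ^ L \<le> C' / 2 ^ L" for L using assms(2) by (simp add: divide_right_mono)
  show ?thesis unfolding Vlim_def
    using VlimD(1,2)[OF assms(1)] V_mono[OF _ assms(2)] V_mono[OF _ *] order_trans[OF VlimD(3)[OF assms(1)] *] by blast
qed

lemma Vb_mono: "Vb G r C x \<Longrightarrow> C \<le> C' \<Longrightarrow> Vb G r C' x"
  unfolding Vb_def using Vlim_mono by blast

lemma Vlim_diff: "Vlim G r C X x \<Longrightarrow> Vlim G r C Y y \<Longrightarrow> Vlim G r C (\<lambda>L. X L - Y L) (x - y)"
proof -
  assume a: "Vlim G r C X x" "Vlim G r C Y y"
  have "V G r (C / 2 ^ L) ((X (Suc L) - X L) - (Y (Suc L) - Y L))" for L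
    using VlimD(2)[OF a(1)] VlimD(2)[OF a(2)] by (rule V_diff)
  moreover have "nrm ((x - X L) - (y - Y L)) \<le> C / 2 ^ L" for L
    using VlimD(3)[OF a(1)] VlimD(3)[OF a(2)] by (rule nrm_diff_le)
  ultimately show ?thesis unfolding Vlim_def
    using VlimD(1)[OF a(1)] VlimD(1)[OF a(2)] by (auto intro: V_diff simp: algebra_simps)
qed

lemma Vb_diff: "Vb G r C x \<Longrightarrow> Vb G r C y \<Longrightarrow> Vb G r C (x - y)"
  using Vlim_diff unfolding Vb_def by blast

lemma Vb_0: "C \<ge> 0 \<Longrightarrow> r \<ge> 0 \<Longrightarrow> Vb G r C 0" by (intro Vb_V V_0)

lemma Vb_minus: "Vb G r C x \<Longrightarrow> r \<ge> 0 \<Longrightarrow> Vb G r C (- x)"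
  using Vb_diff[OF Vb_0[OF Vb_nonneg[of G r C x]], of r G x] by simp

lemma Vb_add: "Vb G r C x \<Longrightarrow> Vb G r C y \<Longrightarrow> r \<ge> 0 \<Longrightarrow> Vb G r C (x + y)"
  using Vb_diff[OF _ Vb_minus, of G r C x y] by simp

lemma Vb_sum: "C \<ge> 0 \<Longrightarrow> r \<ge> 0 \<Longrightarrow> (\<And>i. i \<in> I \<Longrightarrow> Vb G r C (f i)) \<Longrightarrow> Vb G r C (sum f I)"
  by (induction I rule: infinite_finite_induct) (auto intro: Vb_0 Vb_add)

lemma Vlim_mult:
  assumes x: "Vlim G r C X x" and y: "Vlim G r C' Y y" and G: "\<And>g. g \<in> G \<Longrightarrow> nrm g \<le> r" and r: "r \<ge> 0"
  shows "Vlim G r (C * C') (\<lambda>L. X L * Y L) (x * y)"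
  unfolding Vlim_def
proof (intro allI conjI)
  fix L
  show "V G r (C * C') (X L * Y L)" using VlimD(1)[OF x] VlimD(1)[OF y] r by (auto intro: V_mult)
  have "V G r (C * C' / 2 ^ L) (X (Suc L) * (Y (Suc L) - Y L) + (X (Suc L) - X L) * Y L)"
    using V_mult[OF VlimD(1)[OF x, of "Suc L"] VlimD(2)[OF y, of L] _ r]
      V_mult[OF VlimD(2)[OF x, of L] VlimD(1)[OF y, of L] _ r] by (intro V.add) auto
  then show "V G r (C * C' / 2 ^ L) (X (Suc L) * Y (Suc L) - X L * Y L)" by (simp add: algebra_simps)
  have Xn: "nrm (X L) \<le> C" and Yn: "nrm (Y L) \<le> C'" for L
    using V_nrm[OF VlimD(1)[OF x] G r] V_nrm[OF VlimD(1)[OF y] G r] by auto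
  have "nrm x \<le> C" using nrm_add_le[OF order_trans[OF VlimD(3)[OF x, of 0]] Xn[of 0]] by simp
  then have "nrm (x * (y - Y L)) \<le> C * (C' / 2 ^ L)"
    unfolding nrm_mult using VlimD(3)[OF y] Vlim_nonneg[OF x] by (intro mult_mono) auto
  moreover have "nrm ((x - X L) * Y L) \<le> (C / 2 ^ L) * C'"
    unfolding nrm_mult using VlimD(3)[OF x] Yn Vlim_nonneg[OF x] by (intro mult_mono) auto
  ultimately have "nrm (x * (y - Y L) + (x - X L) * Y L) \<le> C * C' / 2 ^ L"
    by (intro nrm_add_le) auto
  then show "nrm (x * y - X L * Y L) \<le> C * C' / 2 ^ L" by (simp add: algebra_simps)
qed

lemma Vb_mult:
  assumes "Vb G r C x" "Vb G r C' y" "C * C' \<le> C''" "\<And>g. g \<in> G \<Longrightarrow> nrm g \<le> r" "r \<ge> 0"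
  shows "Vb G r C'' (x * y)"
proof -
  obtain X Y where "Vlim G r C X x" "Vlim G r C' Y y" using assms(1,2) by (auto simp: Vb_def)
  from Vlim_mult[OF this assms(4,5)] have "Vb G r (C * C') (x * y)" by (auto simp: Vb_def)
  then show ?thesis using assms(3) by (rule Vb_mono)
qed

lemma Vb_subst:
  assumes "Vb G r C x" "\<And>g. g \<in> G \<Longrightarrow> V G' r' r g" "r' \<ge> 0"
  shows "Vb G' r' C x"
proof -
  obtain X where X: "Vlim G r C X x" using assms by (auto simp: Vb_def)
  have "Vlim G' r' C X x" unfolding Vlim_def using X V_subst[OF _ assms(2,3)] by (auto simp: Vlim_def)
  then show ?thesis by (auto simp: Vb_def)
qed

lemma Vb_nrm:
  assumes "Vb G r C x" "\<And>g. g \<in> G \<Longrightarrow> nrm g \<le> r" "r \<ge> 0" shows "nrm x \<le> C"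
proof -
  obtain X where X: "Vlim G r C X x" using assms by (auto simp: Vb_def)
  have "nrm (x - X 0 + X 0) \<le> C"
    using VlimD(3)[OF X, of 0] V_nrm[OF VlimD(1)[OF X, of 0] assms(2,3)] by (intro nrm_add_le) auto
  then show ?thesis by simp
qed

lemma half_le: "C \<ge> 0 \<Longrightarrow> C / 2 ^ i / 2 ^ L \<le> C / 2 ^ L" for C :: real
  using mult_left_mono[of 1 "2 ^ i :: real" C] by (intro divide_right_mono) (auto simp: field_simps)

lemma Vb_closed:
  assumes x: "\<And>i. Vb G r (C / 2 ^ i) (x i)" and s: "\<And>L. nrm (s - (\<Sum>i<L. x i)) \<le> C / 2 ^ L"
    and r: "r \<ge> 0"
  shows "Vb G r C s"
proof -
  have "\<forall>i. \<exists>X. Vlim G r (C / 2 ^ i) X (x i)" using x by (auto simp: Vb_def)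
  then obtain X where X: "\<And>i. Vlim G r (C / 2 ^ i) (X i) (x i)" by metis
  have C: "C \<ge> 0" using Vb_nonneg[OF x[of 0]] by simp
  have half: "C / 2 ^ i \<le> C" for i using C mult_left_mono[of 1 "2 ^ i" C] by (simp add: field_simps)
  \<comment> \<open>Diagonal sum: the \<open>L\<close>-th approximants of the terms up to index
    \<open>L\<close>; the remaining terms are already within \<open>C / 2 ^ L\<close>.\<close>
  define Y where "Y = (\<lambda>L. \<Sum>i<Suc L. X i L)"
  have "V G r C (X i L)" for i L by (rule V_mono[OF VlimD(1)[OF X] half])
  then have "V G r C (Y L)" for L unfolding Y_def using C by (intro V_sum)
  moreover have "V G r (C / 2 ^ L) (Y (Suc L) - Y L)" for L
  proof -
    have "Y (Suc L) - Y L = (\<Sum>i<Suc L. X i (Suc L) - X i L) + X (Suc L) (Suc L)"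
      by (simp add: Y_def sum_subtractf)
    moreover have "V G r (C / 2 ^ L) (X i (Suc L) - X i L)" for i
      using VlimD(2)[OF X[of i], of L] half_le[OF C] by (rule V_mono)
    moreover have "V G r (C / 2 ^ L) (X (Suc L) (Suc L))"
      using VlimD(1)[OF X[of "Suc L"], of "Suc L"] C by (rule_tac V_mono) (auto simp: field_simps)
    ultimately show ?thesis using C by (auto intro!: V.add V_sum)
  qed
  moreover have "nrm (s - Y L) \<le> C / 2 ^ L" for L
  proof -
    have "nrm (x i - X i L) \<le> C / 2 ^ L" for i
      using VlimD(3)[OF X[of i], of L] half_le[OF C] by (rule order_trans)
    then have "nrm (\<Sum>i<Suc L. x i - X i L) \<le> C / 2 ^ L" using C by (intro nrm_sum_le) auto
    moreover have "nrm (s - (\<Sum>i<Suc L. x i)) \<le> C / 2 ^ L"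
      using s[of "Suc L"] by (rule order_trans) (use C in \<open>auto simp: field_simps\<close>)
    ultimately have le: "nrm ((s - (\<Sum>i<Suc L. x i)) + (\<Sum>i<Suc L. x i - X i L)) \<le> C / 2 ^ L"
      by (intro nrm_add_le)
    have eq: "(s - (\<Sum>i<Suc L. x i)) + (\<Sum>i<Suc L. x i - X i L) = s - Y L"
      unfolding Y_def sum_subtractf by simp
    show ?thesis using le unfolding eq .
  qed
  ultimately have "Vlim G r C Y s" by (simp add: Vlim_def)
  then show ?thesis by (auto simp: Vb_def)
qed

lemma Vb_series:
  assumes x: "\<And>i. Vb G r (C / 2 ^ i) (x i)" and r: "r \<ge> 0" and G: "\<And>g. g \<in> G \<Longrightarrow> nrm g \<le> r"
  obtains s where "\<And>L. nrm (s - (\<Sum>i<L. x i)) \<le> C / 2 ^ L" "Vb G r C s"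
proof -
  have "nrm ((\<Sum>j<Suc i. x j) - (\<Sum>j<i. x j)) \<le> C / 2 ^ i" for i using Vb_nrm[OF x G r] by simp
  then obtain s where s: "\<forall>L. nrm (s - (\<Sum>i<L. x i)) \<le> C / 2 ^ L" using complete[of "\<lambda>L. \<Sum>i<L. x i" C] by blast
  then show ?thesis using that Vb_closed[OF x _ r] by blast
qed

end

section \<open>Coefficient arrays of polynomials in several variables\<close>

definition Mon :: "nat \<Rightarrow> (nat \<Rightarrow> nat) set" where "Mon k = {\<mu>. \<forall>i\<ge>k. \<mu> i = 0}"
definition mdeg :: "nat \<Rightarrow> (nat \<Rightarrow> nat) \<Rightarrow> nat" where "mdeg k \<mu> = (\<Sum>i<k. \<mu> i)"
definition mon :: "nat \<Rightarrow> (nat \<Rightarrow> 'a::comm_ring_1) \<Rightarrow> (nat \<Rightarrow> nat) \<Rightarrow> 'a" where "mon k u \<mu> = (\<Prod>i<k. u i ^ \<mu> i)"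

text \<open>Evaluation of a formal polynomial given by its coefficients. Unlike \<open>V\<close>,
  which only speaks of values, it keeps the representation, and independence has to be expressed
  through representations.\<close>

definition fev :: "nat \<Rightarrow> (nat \<Rightarrow> 'a::comm_ring_1) \<Rightarrow> ((nat \<Rightarrow> nat) \<Rightarrow> 'a) \<Rightarrow> 'a" where
  "fev k u a = (\<Sum>\<mu>\<in>{\<mu>. a \<mu> \<noteq> 0}. a \<mu> * mon k u \<mu>)"

lemma fev_superset: "finite S \<Longrightarrow> {\<mu>. a \<mu> \<noteq> 0} \<subseteq> S \<Longrightarrow> fev k u a = (\<Sum>\<mu>\<in>S. a \<mu> * mon k u \<mu>)"
  unfolding fev_def by (intro sum.mono_neutral_left) auto

lemma fev_diff:
  assumes "finite {\<mu>. a \<mu> \<noteq> 0}" "finite {\<mu>. b \<mu> \<noteq> 0}"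
  shows "fev k u (\<lambda>\<mu>. a \<mu> - b \<mu>) = fev k u a - fev k u b"
proof -
  let ?S = "{\<mu>. a \<mu> \<noteq> 0} \<union> {\<mu>. b \<mu> \<noteq> 0}"
  have "fev k u (\<lambda>\<mu>. a \<mu> - b \<mu>) = (\<Sum>\<mu>\<in>?S. (a \<mu> - b \<mu>) * mon k u \<mu>)"
    using assms by (intro fev_superset) auto
  also have "\<dots> = (\<Sum>\<mu>\<in>?S. a \<mu> * mon k u \<mu>) - (\<Sum>\<mu>\<in>?S. b \<mu> * mon k u \<mu>)"
    by (simp add: left_diff_distrib sum_subtractf)
  also have "\<dots> = fev k u a - fev k u b" using assms by (subst (1 2) fev_superset[of ?S]) auto
  finally show ?thesis .
qed

lemma fev_sum:
  assumes "finite I" "\<And>i. i \<in> I \<Longrightarrow> finite {\<mu>. a i \<mu> \<noteq> 0}"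
  shows "fev k u (\<lambda>\<mu>. \<Sum>i\<in>I. a i \<mu>) = (\<Sum>i\<in>I. fev k u (a i))"
proof -
  let ?S = "\<Union>i\<in>I. {\<mu>. a i \<mu> \<noteq> 0}"
  have "{\<mu>. (\<Sum>i\<in>I. a i \<mu>) \<noteq> 0} \<subseteq> ?S" using sum.not_neutral_contains_not_neutral by fastforce
  then have "fev k u (\<lambda>\<mu>. \<Sum>i\<in>I. a i \<mu>) = (\<Sum>\<mu>\<in>?S. (\<Sum>i\<in>I. a i \<mu>) * mon k u \<mu>)"
    using assms by (intro fev_superset) auto
  also have "\<dots> = (\<Sum>i\<in>I. \<Sum>\<mu>\<in>?S. a i \<mu> * mon k u \<mu>)"
    by (simp add: sum_distrib_right) (rule sum.swap)
  also have "\<dots> = (\<Sum>i\<in>I. fev k u (a i))"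
    using assms by (intro sum.cong refl fev_superset[symmetric]) auto
  finally show ?thesis .
qed

text \<open>Multiplication of the formal polynomial by the \<open>n\<close>-th power of the
  \<open>l\<close>-th variable.\<close>

definition shift :: "nat \<Rightarrow> nat \<Rightarrow> ((nat \<Rightarrow> nat) \<Rightarrow> 'b::zero) \<Rightarrow> (nat \<Rightarrow> nat) \<Rightarrow> 'b" where
  "shift l n a = (\<lambda>\<mu>. if \<mu> l \<ge> n then a (\<mu>(l := \<mu> l - n)) else 0)"

lemma shift_support: "{\<mu>. shift l n a \<mu> \<noteq> 0} = (\<lambda>\<mu>. \<mu>(l := \<mu> l + n)) ` {\<mu>. a \<mu> \<noteq> 0}"
proof (intro equalityI subsetI)
  fix \<mu> assume "\<mu> \<in> {\<mu>. shift l n a \<mu> \<noteq> 0}"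
  then have "\<mu> l \<ge> n" "a (\<mu>(l := \<mu> l - n)) \<noteq> 0" by (auto simp: shift_def split: if_splits)
  then show "\<mu> \<in> (\<lambda>\<mu>. \<mu>(l := \<mu> l + n)) ` {\<mu>. a \<mu> \<noteq> 0}"
    by (intro image_eqI[of _ _ "\<mu>(l := \<mu> l - n)"]) auto
qed (auto simp: shift_def)

lemma inj_shift: "inj (\<lambda>\<mu>::nat \<Rightarrow> nat. \<mu>(l := \<mu> l + n))"
  by (rule injI) (metis (mono_tags, opaque_lifting) add_right_cancel fun_upd_same fun_upd_triv fun_upd_upd)

lemma mon_upd:
  assumes "l < k" shows "mon k u (\<mu>(l := \<mu> l + n)) = u l ^ n * mon k u \<mu>"
proof -
  have "mon k u (\<mu>(l := \<mu> l + n)) = u l ^ (\<mu> l + n) * (\<Prod>i\<in>{..<k}-{l}. u i ^ \<mu> i)"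
    unfolding mon_def using assms by (subst prod.remove[of _ l]) auto
  moreover have "mon k u \<mu> = u l ^ \<mu> l * (\<Prod>i\<in>{..<k}-{l}. u i ^ \<mu> i)"
    unfolding mon_def using assms by (subst prod.remove[of _ l]) auto
  ultimately show ?thesis by (simp add: power_add algebra_simps)
qed

lemma mdeg_upd:
  assumes "l < k" shows "mdeg k (\<mu>(l := \<mu> l + n)) = mdeg k \<mu> + n"
proof -
  have "mdeg k (\<mu>(l := \<mu> l + n)) = (\<mu> l + n) + (\<Sum>i\<in>{..<k}-{l}. \<mu> i)"
    unfolding mdeg_def using assms by (subst sum.remove[of _ l]) auto
  moreover have "mdeg k \<mu> = \<mu> l + (\<Sum>i\<in>{..<k}-{l}. \<mu> i)"
    unfolding mdeg_def using assms by (subst sum.remove[of _ l]) auto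
  ultimately show ?thesis by simp
qed

lemma fev_shift:
  assumes "l < k" shows "fev k u (shift l n a) = u l ^ n * fev k u a"
proof -
  have "fev k u (shift l n a) = (\<Sum>\<mu>\<in>{\<mu>. a \<mu> \<noteq> 0}. a \<mu> * mon k u (\<mu>(l := \<mu> l + n)))"
    unfolding fev_def shift_support
    by (subst sum.reindex[OF inj_on_subset[OF inj_shift subset_UNIV]]) (auto simp: shift_def)
  also have "\<dots> = u l ^ n * fev k u a"
    unfolding fev_def sum_distrib_left by (intro sum.cong refl) (simp add: mon_upd[OF assms] mult_ac)
  finally show ?thesis .
qed

context valued
begin

text \<open>The formal counterpart of \<open>V\<close>: polynomials in \<open>k\<close> variables
  over \<open>K\<close> whose Gauss norm for radius \<open>r\<close> is at most
  \<open>C\<close>.\<close>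

definition farr :: "nat \<Rightarrow> real \<Rightarrow> real \<Rightarrow> ((nat \<Rightarrow> nat) \<Rightarrow> 'a) \<Rightarrow> bool" where
  "farr k r C a \<longleftrightarrow> finite {\<mu>. a \<mu> \<noteq> 0} \<and> {\<mu>. a \<mu> \<noteq> 0} \<subseteq> Mon k \<and>
     (\<forall>\<mu>. a \<mu> \<in> K \<and> nrm (a \<mu>) * r ^ mdeg k \<mu> \<le> C)"

lemma farrD:
  assumes "farr k r C a"
  shows "finite {\<mu>. a \<mu> \<noteq> 0}" "a \<mu> \<noteq> 0 \<Longrightarrow> \<mu> \<in> Mon k" "a \<mu> \<in> K" "nrm (a \<mu>) * r ^ mdeg k \<mu> \<le> C"
  using assms by (auto simp: farr_def)

lemma farr_mono: "farr k r C a \<Longrightarrow> C \<le> C' \<Longrightarrow> farr k r C' a"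
  by (auto simp: farr_def intro: order_trans)

lemma farr_0: "C \<ge> 0 \<Longrightarrow> farr k r C (\<lambda>_. 0)" by (auto simp: farr_def subring_0[OF K_ring])

lemma farr_diff:
  assumes a: "farr k r C a" and b: "farr k r C b" and r: "r \<ge> 0"
  shows "farr k r C (\<lambda>\<mu>. a \<mu> - b \<mu>)"
  unfolding farr_def
proof (intro conjI allI)
  have "{\<mu>. a \<mu> - b \<mu> \<noteq> 0} \<subseteq> {\<mu>. a \<mu> \<noteq> 0} \<union> {\<mu>. b \<mu> \<noteq> 0}" by auto
  then show "finite {\<mu>. a \<mu> - b \<mu> \<noteq> 0}" using farrD(1)[OF a] farrD(1)[OF b] finite_subset by blast
  show "{\<mu>. a \<mu> - b \<mu> \<noteq> 0} \<subseteq> Mon k" using farrD(2)[OF a] farrD(2)[OF b] by force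
  fix \<mu>
  show "a \<mu> - b \<mu> \<in> K" using farrD(3)[OF a] farrD(3)[OF b] by (intro subring_diff[OF K_ring])
  have "nrm (a \<mu> - b \<mu>) * r ^ mdeg k \<mu> \<le> max (nrm (a \<mu>)) (nrm (b \<mu>)) * r ^ mdeg k \<mu>"
    using nrm_diff r by (intro mult_right_mono) auto
  also have "\<dots> \<le> C" using farrD(4)[OF a, of \<mu>] farrD(4)[OF b, of \<mu>] by (auto simp: max_def)
  finally show "nrm (a \<mu> - b \<mu>) * r ^ mdeg k \<mu> \<le> C" .
qed

lemma farr_add:
  assumes a: "farr k r C a" and b: "farr k r C b" and r: "r \<ge> 0"
  shows "farr k r C (\<lambda>\<mu>. a \<mu> + b \<mu>)"
proof -
  have "C \<ge> 0" using farrD(4)[OF a] r mult_nonneg_nonneg[OF nrm_ge_0 zero_le_power[OF r]] order_trans by blast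
  from farr_diff[OF a farr_diff[OF farr_0[OF this] b r] r] show ?thesis by simp
qed

lemma farr_sum:
  "r \<ge> 0 \<Longrightarrow> C \<ge> 0 \<Longrightarrow> (\<And>i. i \<in> I \<Longrightarrow> farr k r C (a i)) \<Longrightarrow> farr k r C (\<lambda>\<mu>. \<Sum>i\<in>I. a i \<mu>)"
proof (induction I rule: infinite_finite_induct)
  case (insert i I)
  then have "farr k r C (\<lambda>\<mu>. a i \<mu> + (\<Sum>j\<in>I. a j \<mu>))" by (intro farr_add) auto
  then show ?case using insert by simp
qed (auto intro: farr_0)

lemma farr_shift:
  assumes a: "farr k r C a" and l: "l < k" and r: "r \<ge> 0" and C: "r ^ n * C \<le> C'"
  shows "farr k r C' (shift l n a)"
  unfolding farr_def
proof (intro conjI allI)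
  show "finite {\<mu>. shift l n a \<mu> \<noteq> 0}" using farrD(1)[OF a] by (simp add: shift_support)
  show "{\<mu>. shift l n a \<mu> \<noteq> 0} \<subseteq> Mon k"
    using farrD(2)[OF a] l by (auto simp: shift_support Mon_def)
  fix \<mu>
  show "shift l n a \<mu> \<in> K" using farrD(3)[OF a] by (auto simp: shift_def subring_0[OF K_ring])
  have C0: "C \<ge> 0" using farrD(4)[OF a] r mult_nonneg_nonneg[OF nrm_ge_0 zero_le_power[OF r]] order_trans by blast
  show "nrm (shift l n a \<mu>) * r ^ mdeg k \<mu> \<le> C'"
  proof (cases "\<mu> l \<ge> n")
    case True
    define \<nu> where "\<nu> = \<mu>(l := \<mu> l - n)"
    have "\<mu> = \<nu>(l := \<nu> l + n)" using True by (simp add: \<nu>_def)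
    then have d: "mdeg k \<mu> = mdeg k \<nu> + n" using mdeg_upd[OF l, of \<nu> n] by simp
    have "nrm (shift l n a \<mu>) * r ^ mdeg k \<mu> = r ^ n * (nrm (a \<nu>) * r ^ mdeg k \<nu>)"
      using True by (simp add: shift_def \<nu>_def[symmetric] d power_add algebra_simps)
    also have "\<dots> \<le> r ^ n * C" using farrD(4)[OF a] r by (intro mult_left_mono) auto
    finally show ?thesis using C by simp
  next
    case False
    then have "nrm (shift l n a \<mu>) * r ^ mdeg k \<mu> = 0" by (simp add: shift_def)
    also have "0 \<le> r ^ n * C" using C0 r by simp
    finally show ?thesis using C by linarith
  qed
qed

lemma V_prod:
  "r \<ge> 0 \<Longrightarrow> (\<And>i. i \<in> I \<Longrightarrow> V G r (c i) (x i)) \<Longrightarrow> V G r (prod c I) (prod x I)"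
  by (induction I rule: infinite_finite_induct) (auto intro: V_1 V_mult)

lemma V_mon:
  assumes "r \<ge> 0" "\<And>i. i < k \<Longrightarrow> V G r r (u i)" shows "V G r (r ^ mdeg k \<mu>) (mon k u \<mu>)"
  unfolding mon_def mdeg_def power_sum using assms by (intro V_prod V_power) auto

lemma V_fev:
  assumes a: "farr k r C a" and r: "r \<ge> 0"
  shows "V (u ` {..<k}) r C (fev k u a)"
  unfolding fev_def
proof (rule V_sum)
  show "C \<ge> 0" using farrD(4)[OF a] r mult_nonneg_nonneg[OF nrm_ge_0 zero_le_power[OF r]] order_trans by blast
  show "V (u ` {..<k}) r C (a \<mu> * mon k u \<mu>)" for \<mu>
    using farrD(3,4)[OF a] r by (intro V_scale[OF V_mon]) (auto intro: V_gens)
qed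

text \<open>The set \<open>I\<close> of occurring variables is tracked because
  \<open>indep_transc\<close> needs coefficients that avoid one chosen variable.\<close>

lemma V_imp_farr:
  assumes "V (u ` I) r C x" and I: "I \<subseteq> {..<k}" and r: "r \<ge> 0"
  shows "\<exists>a. farr k r C a \<and> fev k u a = x \<and> (\<forall>\<mu>. a \<mu> \<noteq> 0 \<longrightarrow> (\<forall>i. i \<notin> I \<longrightarrow> \<mu> i = 0))"
  using assms(1)
proof (induction rule: V.induct)
  case (const c C)
  define a where "a = (\<lambda>\<mu>::nat \<Rightarrow> nat. if \<mu> = (\<lambda>_. 0) then c else 0)"
  have "{\<mu>. a \<mu> \<noteq> 0} \<subseteq> {\<lambda>_. 0}" by (auto simp: a_def)
  then have "fev k u a = (\<Sum>\<mu>\<in>{\<lambda>_. 0}. a \<mu> * mon k u \<mu>)" by (intro fev_superset) auto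
  then have "fev k u a = c" by (simp add: a_def mon_def)
  moreover have "C \<ge> 0" using const nrm_ge_0[of c] by linarith
  then have "farr k r C a"
    unfolding farr_def using const
    by (auto simp: a_def Mon_def mdeg_def subring_0[OF K_ring]
        intro!: finite_subset[OF \<open>{\<mu>. a \<mu> \<noteq> 0} \<subseteq> {\<lambda>_. 0}\<close>[unfolded a_def]])
  ultimately show ?case by (intro exI[of _ a]) (auto simp: a_def)
next
  case (gen C x g C')
  then obtain a l where a: "farr k r C a" "fev k u a = x" "\<And>\<mu> i. a \<mu> \<noteq> 0 \<Longrightarrow> i \<notin> I \<Longrightarrow> \<mu> i = 0"
    and l: "l \<in> I" "g = u l" by auto
  have lk: "l < k" using l I by auto
  have "farr k r C' (shift l 1 a)" using gen by (intro farr_shift[OF a(1) lk r]) auto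
  moreover have "fev k u (shift l 1 a) = g * x" using fev_shift[OF lk, of u 1 a] a l by simp
  moreover have "\<mu> i = 0" if "shift l 1 a \<mu> \<noteq> 0" "i \<notin> I" for \<mu> i
  proof -
    have "\<mu> \<in> (\<lambda>\<mu>. \<mu>(l := \<mu> l + 1)) ` {\<mu>. a \<mu> \<noteq> 0}" using that(1) shift_support[of l 1 a] by auto
    then show ?thesis using a(3) l that(2) by auto
  qed
  ultimately show ?case by blast
next
  case (add C x y)
  then obtain a b where a: "farr k r C a" "fev k u a = x" "\<And>\<mu> i. a \<mu> \<noteq> 0 \<Longrightarrow> i \<notin> I \<Longrightarrow> \<mu> i = 0"
    and b: "farr k r C b" "fev k u b = y" "\<And>\<mu> i. b \<mu> \<noteq> 0 \<Longrightarrow> i \<notin> I \<Longrightarrow> \<mu> i = 0" by blast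
  have "C \<ge> 0" using farrD(4)[OF a(1)] r mult_nonneg_nonneg[OF nrm_ge_0 zero_le_power[OF r]] order_trans by blast
  note m = farr_diff[OF farr_0[OF this] b(1) r]
  have "fev k u (\<lambda>\<mu>. a \<mu> - (0 - b \<mu>)) = x + y"
    using fev_diff[OF farrD(1)[OF a(1)] farrD(1)[OF m]] fev_diff[of "\<lambda>_. 0" b k u] farrD(1)[OF b(1)] a b
    by (simp add: fev_def)
  moreover have "farr k r C (\<lambda>\<mu>. a \<mu> - (0 - b \<mu>))" by (rule farr_diff[OF a(1) m r])
  moreover have "\<mu> i = 0" if "a \<mu> - (0 - b \<mu>) \<noteq> 0" "i \<notin> I" for \<mu> i
    using that a(3)[of \<mu> i] b(3)[of \<mu> i] by (cases "a \<mu> = 0") auto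
  ultimately show ?case by blast
qed

text \<open>Analytic independence: no nonzero restricted power series vanishes at \<open>u\<close>.
  A power series is represented by a sequence \<open>A\<close> of polynomials that is Cauchy in
  Gauss norm at a dyadic rate; if its values tend to 0 at that rate, so must its coefficients, with
  the same constant.\<close>

definition indep :: "nat \<Rightarrow> (nat \<Rightarrow> 'a) \<Rightarrow> real \<Rightarrow> bool" where
  "indep k u r \<longleftrightarrow> (\<forall>A C. (\<forall>L. farr k r C (A L)) \<longrightarrow> (\<forall>L. farr k r (C / 2 ^ L) (\<lambda>\<mu>. A (Suc L) \<mu> - A L \<mu>)) \<longrightarrow>
     (\<forall>L. nrm (fev k u (A L)) \<le> C / 2 ^ L) \<longrightarrow> (\<forall>L. farr k r (C / 2 ^ L) (A L)))"

lemma indep_algebraic: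
  assumes "indep k u r" "farr k r C a" "fev k u a = 0" "r > 0"
  shows "a \<mu> = 0"
proof -
  have "C \<ge> 0" using farrD(4)[OF assms(2)] assms(4) mult_nonneg_nonneg[OF nrm_ge_0 zero_le_power] order_trans less_imp_le by metis
  then have f: "farr k r (C / 2 ^ L) a" for L
    using assms farr_0 unfolding indep_def by (auto dest!: spec[of _ "\<lambda>_. a"] spec[of _ C])
  have "nrm (a \<mu>) \<le> (C / r ^ mdeg k \<mu>) / 2 ^ L" for L
    using farrD(4)[OF f[of L], of \<mu>] assms(4) by (simp add: field_simps)
  then show ?thesis by (rule nrm_small_eq_0)
qed

lemma farr_seq_diff:
  assumes d: "\<And>L. farr k r (C / 2 ^ L) (\<lambda>\<mu>. A (Suc L) \<mu> - A L \<mu>)" and "i \<le> j" and r: "r \<ge> 0"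
  shows "farr k r (C / 2 ^ i) (\<lambda>\<mu>. A j \<mu> - A i \<mu>)"
  using assms(2)
proof (induction j rule: dec_induct)
  have C: "C \<ge> 0" using farrD(4)[OF d[of 0]] r mult_nonneg_nonneg[OF nrm_ge_0 zero_le_power[OF r]] order_trans
    by (metis div_by_1 power_0)
  {
    case base
    show ?case using C by (auto intro: farr_0)
  next
    case (step j)
    have "C / 2 ^ j \<le> C / 2 ^ i" using C step.hyps by (intro divide_left_mono) auto
    from farr_add[OF farr_mono[OF d this] step.IH r] show ?case by simp
  }
qed

end

section \<open>Weierstrass division and Noether normalisation\<close>

context valued
begin

text \<open>The coefficient of \<open>y ^ j\<close> is bounded by \<open>C / r ^ j\<close>, so each
  summand has size at most \<open>C\<close> when \<open>y\<close> has size \<open>r\<close>. The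
  predicate \<open>P\<close> is a parameter because division is carried out for polynomials
  (\<open>V\<close>) and then for power series (\<open>Vb\<close>).\<close>

definition modl :: "(real \<Rightarrow> 'a \<Rightarrow> bool) \<Rightarrow> 'a \<Rightarrow> real \<Rightarrow> nat \<Rightarrow> real \<Rightarrow> 'a \<Rightarrow> bool" where
  "modl P y r s C x \<longleftrightarrow> (\<exists>c. (\<forall>j<s. P (C / r ^ j) (c j)) \<and> x = (\<Sum>j<s. c j * y ^ j))"

lemma modl_add:
  assumes P: "\<And>C x y. P C x \<Longrightarrow> P C y \<Longrightarrow> P C (x + y)" and x: "modl P y r s C x" "modl P y r s C x'"
  shows "modl P y r s C (x + x')"
proof -
  obtain c c' where "\<forall>j<s. P (C / r ^ j) (c j)" "x = (\<Sum>j<s. c j * y ^ j)"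
    "\<forall>j<s. P (C / r ^ j) (c' j)" "x' = (\<Sum>j<s. c' j * y ^ j)" using x unfolding modl_def by metis
  then show ?thesis unfolding modl_def using P
    by (intro exI[of _ "\<lambda>j. c j + c' j"]) (auto simp: sum.distrib distrib_right)
qed

lemma modl_scale:
  assumes P: "\<And>C x. P C x \<Longrightarrow> P (b * C) (a * x)" and x: "modl P y r s C x"
  shows "modl P y r s (b * C) (a * x)"
proof -
  obtain c where c: "\<forall>j<s. P (C / r ^ j) (c j)" "x = (\<Sum>j<s. c j * y ^ j)" using x unfolding modl_def by metis
  have "P (b * C / r ^ j) (a * c j)" if "j < s" for j using P[of "C / r ^ j" "c j"] c(1) that by simp
  then show ?thesis unfolding modl_def c(2)
    by (intro exI[of _ "\<lambda>j. a * c j"]) (simp add: sum_distrib_left mult.assoc)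
qed

lemma modl_mono:
  assumes P: "\<And>C C' x. P C x \<Longrightarrow> C \<le> C' \<Longrightarrow> P' C' x" and x: "modl P y r s C x" and C: "C \<le> C'" and r: "r > 0"
  shows "modl P' y r s C' x"
proof -
  have "C / r ^ j \<le> C' / r ^ j" for j using C r by (simp add: divide_right_mono)
  then show ?thesis using x P unfolding modl_def by blast
qed

lemma modl_single:
  assumes "j < s" "P (C / r ^ j) c" "\<And>j. P (C / r ^ j) 0"
  shows "modl P y r s C (c * y ^ j)"
  unfolding modl_def using assms
  by (intro exI[of _ "\<lambda>i. if i = j then c else 0"]) (auto simp: if_distrib[of "\<lambda>x. x * _"] cong: if_cong)

lemma V_modl_0: "C \<ge> 0 \<Longrightarrow> r > 0 \<Longrightarrow> modl (V G r) y r s C 0"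
  unfolding modl_def by (intro exI[of _ "\<lambda>_. 0"]) (auto intro: V_0)

lemma V_modl_add: "modl (V G r) y r s C x \<Longrightarrow> modl (V G r) y r s C x' \<Longrightarrow> modl (V G r) y r s C (x + x')"
  by (rule modl_add) (auto intro: V.add)

lemma V_modl_sum:
  "C \<ge> 0 \<Longrightarrow> r > 0 \<Longrightarrow> (\<And>i. i \<in> I \<Longrightarrow> modl (V G r) y r s C (f i)) \<Longrightarrow> modl (V G r) y r s C (sum f I)"
  by (induction I rule: infinite_finite_induct) (auto intro: V_modl_0 V_modl_add)

lemma V_modl_single:
  assumes "j < s" "V G r (C / r ^ j) c" "r > 0" shows "modl (V G r) y r s C (c * y ^ j)"
proof (rule modl_single[of _ _ "V G r"])
  have "C / r ^ j \<ge> 0" using V_nonneg[OF assms(2)] assms(3) by simp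
  then have "C / r ^ j * r ^ j \<ge> 0" using assms(3) by (intro mult_nonneg_nonneg) auto
  then have "C \<ge> 0" using assms(3) by simp
  then show "V G r (C / r ^ j) 0" for j using assms(3) by (intro V_0) auto
qed (use assms in auto)

text \<open>\<open>x\<close> is homogeneous of degree \<open>n\<close> with coefficient \<open>\<kappa>\<close> at \<open>y ^ n\<close>.\<close>

definition lead :: "'a set \<Rightarrow> 'a \<Rightarrow> real \<Rightarrow> nat \<Rightarrow> 'a \<Rightarrow> 'a \<Rightarrow> bool" where
  "lead G y r n \<kappa> x \<longleftrightarrow> \<kappa> \<in> K \<and> nrm \<kappa> \<le> 1 \<and> (\<exists>c. (\<forall>j\<le>n. V G r (r ^ n / r ^ j) (c j)) \<and> c n = \<kappa> \<and> x = (\<Sum>j\<le>n. c j * y ^ j))"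

lemma lead_mult:
  assumes x: "lead G y r n \<kappa> x" and x': "lead G y r n' \<kappa>' x'" and r: "r > 0"
  shows "lead G y r (n + n') (\<kappa> * \<kappa>') (x * x')"
proof -
  obtain c where c: "\<kappa> \<in> K" "nrm \<kappa> \<le> 1" "\<And>j. j \<le> n \<Longrightarrow> V G r (r ^ n / r ^ j) (c j)" "c n = \<kappa>" "x = (\<Sum>j\<le>n. c j * y ^ j)"
    using x by (auto simp: lead_def)
  obtain c' where c': "\<kappa>' \<in> K" "nrm \<kappa>' \<le> 1" "\<And>j. j \<le> n' \<Longrightarrow> V G r (r ^ n' / r ^ j) (c' j)" "c' n' = \<kappa>'" "x' = (\<Sum>j\<le>n'. c' j * y ^ j)"
    using x' by (auto simp: lead_def)
  \<comment> \<open>The representations in powers of \<open>y\<close> become univariate polynomials,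
    so that the coefficients of the product are given by \<open>coeff_mult\<close>.\<close>
  define f where "f = (\<Sum>j\<le>n. monom (c j) j)"
  define f' where "f' = (\<Sum>j\<le>n'. monom (c' j) j)"
  have cf: "coeff f j = (if j \<le> n then c j else 0)" "coeff f' j = (if j \<le> n' then c' j else 0)" for j
    by (auto simp: f_def f'_def coeff_sum)
  have deg: "degree f \<le> n" "degree f' \<le> n'" using cf by (auto intro!: degree_le)
  have px: "poly f y = x" "poly f' y = x'" by (auto simp: f_def f'_def c c' poly_sum poly_monom)
  have "degree (f * f') \<le> n + n'" using degree_mult_le[of f f'] deg by linarith
  have "poly (f * f') y = (\<Sum>j\<le>n + n'. coeff (f * f') j * y ^ j)"
    unfolding poly_altdef using \<open>degree (f * f') \<le> n + n'\<close>
    by (intro sum.mono_neutral_left) (auto simp: coeff_eq_0)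
  then have "x * x' = (\<Sum>j\<le>n + n'. coeff (f * f') j * y ^ j)" using px by simp
  moreover have "V G r (r ^ (n + n') / r ^ j) (coeff (f * f') j)" for j
    unfolding coeff_mult
  proof (rule V_sum)
    show "r ^ (n + n') / r ^ j \<ge> 0" using r by simp
    fix i assume "i \<in> {..j}"
    then have "r ^ n / r ^ i * (r ^ n' / r ^ (j - i)) = r ^ (n + n') / r ^ j"
      using r by (simp add: power_add[symmetric])
    then show "V G r (r ^ (n + n') / r ^ j) (coeff f i * coeff f' (j - i))"
      using cf c(3)[of i] c'(3)[of "j - i"] r
      by (cases "i \<le> n \<and> j - i \<le> n'") (auto intro!: V_0 V_mult[of G r "r ^ n / r ^ i" _ "r ^ n' / r ^ (j - i)"])
  qed
  moreover have "coeff (f * f') (n + n') = \<kappa> * \<kappa>'"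
  proof -
    have "coeff (f * f') (n + n') = (\<Sum>i\<le>n + n'. if i = n then \<kappa> * \<kappa>' else 0)"
      unfolding coeff_mult by (intro sum.cong) (auto simp: cf c(4) c'(4))
    then show ?thesis by simp
  qed
  moreover have "nrm (\<kappa> * \<kappa>') \<le> 1" using c c' by (simp add: nrm_mult mult_le_one)
  ultimately show ?thesis unfolding lead_def using c(1) c'(1)
    by (auto intro!: subring_mult[OF K_ring] exI[of _ "coeff (f * f')"])
qed

lemma lead_1: "r > 0 \<Longrightarrow> lead G y r 0 1 1"
  unfolding lead_def by (auto intro!: exI[of _ "\<lambda>_. 1"] V_1 subring_1[OF K_ring])

lemma lead_power: "lead G y r n \<kappa> x \<Longrightarrow> r > 0 \<Longrightarrow> lead G y r (n * e) (\<kappa> ^ e) (x ^ e)"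
  by (induction e) (auto simp: lead_1 intro: lead_mult)

lemma lead_prod:
  assumes "r > 0" "finite I" "\<And>i. i \<in> I \<Longrightarrow> lead G y r (n i) (\<kappa> i) (x i)"
  shows "lead G y r (sum n I) (prod \<kappa> I) (prod x I)"
  using assms(2,3)
proof (induction I rule: finite_induct)
  case empty
  show ?case using lead_1[OF assms(1)] by simp
next
  case (insert i I)
  then have "lead G y r (n i + sum n I) (\<kappa> i * prod \<kappa> I) (x i * prod x I)"
    using assms(1) by (intro lead_mult) auto
  then show ?case using insert by simp
qed

lemma lead_linear:
  assumes u: "V G r r u" and a: "a \<in> K" "nrm a \<le> 1" and r: "r > 0"
  shows "lead G y r 1 a (u + a * y)"
proof -
  have "V G r 1 a" using a by (rule V.const)
  then have "\<forall>j\<le>1. V G r (r ^ 1 / r ^ j) (if j = 0 then u else a)" using u r by (auto simp: le_Suc_eq)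
  then show ?thesis unfolding lead_def using a
    by (intro conjI exI[of _ "\<lambda>j. if j = 0 then u else a"]) (auto simp: atMost_Suc)
qed

lemma lead_modl:
  assumes "lead G y r n \<kappa> x" "r > 0"
  obtains t where "modl (V G r) y r n (r ^ n) t" "x = \<kappa> * y ^ n + t"
proof -
  obtain c where c: "\<And>j. j \<le> n \<Longrightarrow> V G r (r ^ n / r ^ j) (c j)" "c n = \<kappa>" "x = (\<Sum>j\<le>n. c j * y ^ j)"
    using assms by (auto simp: lead_def)
  have "x = \<kappa> * y ^ n + (\<Sum>j<n. c j * y ^ j)" using c by (simp add: lessThan_Suc_atMost[symmetric])
  moreover have "modl (V G r) y r n (r ^ n) (\<Sum>j<n. c j * y ^ j)"
    unfolding modl_def using c(1) by (intro exI[of _ c]) auto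
  ultimately show ?thesis using that by blast
qed

text \<open>Weierstrass division by a relation that is regular in \<open>y\<close>.\<close>

context
  fixes Z G y r s q t0 w0
  assumes r: "r > 0" and s: "s > 0" and q01: "0 \<le> q" "q < 1"
    and Z: "\<And>z. z \<in> Z \<Longrightarrow> nrm z \<le> r" and G: "\<And>g. g \<in> G \<Longrightarrow> nrm g \<le> r"
    and GZ: "\<And>g. g \<in> G \<Longrightarrow> V Z r r g" and yZ: "y \<in> Z"
    and ZG: "\<And>z. z \<in> Z \<Longrightarrow> V (insert y G) r r z"
    and rel: "y ^ s = t0 + w0" "modl (V G r) y r s (r ^ s) t0" "Vb Z r (q * r ^ s) w0"
begin

text \<open>Induction on the construction of \<open>x\<close>. Multiplying by an element of
  \<open>G\<close> keeps the degree in \<open>y\<close>; multiplying by \<open>y\<close> can produce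
  one term with \<open>y ^ s\<close>, which the relation replaces by \<open>t0 + w0\<close>. Only
  \<open>w0\<close> leaves the space of remainders, and it is smaller by the factor
  \<open>q\<close>.\<close>

lemma reduce_V:
  assumes "V (insert y G) r C x"
  shows "\<exists>t w. modl (V G r) y r s C t \<and> Vb Z r (q * C) w \<and> x = t + w"
  using assms
proof (induction rule: V.induct)
  case (const a C)
  have C: "C \<ge> 0" using const nrm_ge_0[of a] by linarith
  have "modl (V G r) y r s C (a * y ^ 0)" using const s r by (intro V_modl_single) (auto intro: V.const)
  then show ?case using C q01 r by (intro exI[of _ a] exI[of _ 0]) (auto intro: Vb_0)
next
  case (add C x x')
  then obtain t w t' w' where "modl (V G r) y r s C t" "Vb Z r (q * C) w" "x = t + w"
    "modl (V G r) y r s C t'" "Vb Z r (q * C) w'" "x' = t' + w'" by blast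
  then show ?case using r
    by (intro exI[of _ "t + t'"] exI[of _ "w + w'"]) (auto intro: V_modl_add Vb_add)
next
  case (gen C x g C')
  then obtain t w where t: "modl (V G r) y r s C t" and w: "Vb Z r (q * C) w" and x: "x = t + w" by blast
  obtain c where c: "\<And>j. j < s \<Longrightarrow> V G r (C / r ^ j) (c j)" "t = (\<Sum>j<s. c j * y ^ j)"
    using t unfolding modl_def by blast
  have C: "C \<ge> 0" using V_nonneg[OF gen(1)] r by simp
  have thC: "q * (r * C) \<le> q * C'" using gen(3) q01 by (intro mult_left_mono) auto
  have C': "C' \<ge> 0" using gen(3) C r mult_nonneg_nonneg[of r C] by linarith
  consider "g \<in> G" | "g = y" using gen by auto
  then show ?case
  proof cases
    case 1
    have "modl (V G r) y r s C' (g * t)" unfolding c(2) sum_distrib_left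
    proof (intro V_modl_sum C' r)
      fix j assume "j \<in> {..<s}"
      then have "V G r (C' / r ^ j) (g * c j)" using c(1)[of j] r gen(3) 1
        by (intro V.gen[of _ _ "C / r ^ j"]) (auto simp: field_simps)
      then show "modl (V G r) y r s C' (g * (c j * y ^ j))"
        using V_modl_single[of j s G r C' "g * c j" y] r \<open>j \<in> _\<close> by (simp add: mult.assoc)
    qed
    moreover have "Vb Z r (q * C') (g * w)"
      using thC r by (intro Vb_mult[OF Vb_V[OF GZ[OF 1]] w]) (auto simp: Z algebra_simps)
    ultimately show ?thesis using x by (intro exI[of _ "g * t"] exI[of _ "g * w"]) (auto simp: algebra_simps)
  next
    case 2
    obtain n where n: "s = Suc n" using s by (cases s) auto
    obtain d where d: "\<And>j. j < s \<Longrightarrow> V G r (r ^ s / r ^ j) (d j)" "t0 = (\<Sum>j<s. d j * y ^ j)"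
      using rel(2) unfolding modl_def by blast
    have yt: "y * t = (\<Sum>j<n. c j * y ^ Suc j) + c n * t0 + c n * w0"
    proof -
      have "y * t = (\<Sum>j<n. c j * y ^ Suc j) + c n * y ^ s"
        unfolding c(2) n by (simp add: sum_distrib_left algebra_simps)
      then show ?thesis using rel(1) by (simp add: algebra_simps)
    qed
    have "modl (V G r) y r s C' (c j * y ^ Suc j)" if "j < n" for j
    proof (rule V_modl_single)
      have "C / r ^ j \<le> C' / r ^ Suc j" using gen(3) r by (simp add: field_simps)
      then show "V G r (C' / r ^ Suc j) (c j)" using c(1)[of j] that n by (auto intro: V_mono)
    qed (use that n r in auto)
    then have 1: "modl (V G r) y r s C' (\<Sum>j<n. c j * y ^ Suc j)"
      using C' r by (intro V_modl_sum) auto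
    have "modl (V G r) y r s C' (c n * t0)" unfolding d(2) sum_distrib_left
    proof (intro V_modl_sum C' r)
      fix j assume j: "j \<in> {..<s}"
      have "C / r ^ n * (r ^ s / r ^ j) \<le> C' / r ^ j" using gen(3) r n by (auto simp: field_simps)
      then have "V G r (C' / r ^ j) (c n * d j)" using j n r by (intro V_mult[OF c(1) d(1)]) auto
      then show "modl (V G r) y r s C' (c n * (d j * y ^ j))"
        using V_modl_single[of j s G r C' "c n * d j" y] r j by (simp add: mult.assoc)
    qed
    then have "modl (V G r) y r s C' ((\<Sum>j<n. c j * y ^ Suc j) + c n * t0)" using 1 by (intro V_modl_add)
    moreover have "Vb Z r (q * C') (c n * w0 + y * w)"
    proof (intro Vb_add)
      have "V Z r (C / r ^ n) (c n)" using c(1)[of n] n r by (intro V_subst[OF _ GZ]) auto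
      moreover have "C / r ^ n * (q * r ^ s) \<le> q * C'" using thC r n by (simp add: field_simps)
      ultimately show "Vb Z r (q * C') (c n * w0)" using r by (intro Vb_mult[OF Vb_V rel(3)]) (auto simp: Z)
      show "Vb Z r (q * C') (y * w)"
        using thC r by (intro Vb_mult[OF Vb_V[OF V_gens[OF yZ]] w]) (auto simp: Z algebra_simps)
    qed (use r in auto)
    moreover have "g * x = (\<Sum>j<n. c j * y ^ Suc j) + c n * t0 + (c n * w0 + y * w)"
      using 2 x yt by (simp add: algebra_simps)
    ultimately show ?thesis by blast
  qed
qed

text \<open>A series of remainders is summed coefficient by coefficient; completeness is applied
  once for each of the finitely many powers of \<open>y\<close>.\<close>

lemma sum_modl:
  assumes t: "\<And>i. modl (Vb G r) y r s (C / 2 ^ i) (t i)"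
  shows "\<exists>x B. modl (Vb G r) y r s C x \<and> (\<forall>L. nrm (x - (\<Sum>i<L. t i)) \<le> B / 2 ^ L)"
proof -
  have "\<forall>i. \<exists>c. (\<forall>j<s. Vb G r (C / 2 ^ i / r ^ j) (c j)) \<and> t i = (\<Sum>j<s. c j * y ^ j)"
    using t unfolding modl_def by blast
  then obtain c where c: "\<And>i j. j < s \<Longrightarrow> Vb G r (C / 2 ^ i / r ^ j) (c i j)" "\<And>i. t i = (\<Sum>j<s. c i j * y ^ j)"
    by metis
  have "\<exists>e. (\<forall>L. nrm (e - (\<Sum>i<L. c i j)) \<le> C / r ^ j / 2 ^ L) \<and> Vb G r (C / r ^ j) e" if "j < s" for j
  proof -
    have "Vb G r (C / r ^ j / 2 ^ i) (c i j)" for i using c(1)[OF that, of i] by (simp add: field_simps)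
    from Vb_series[OF this _ G] r show ?thesis by (metis less_imp_le)
  qed
  then obtain e where e: "\<And>j L. j < s \<Longrightarrow> nrm (e j - (\<Sum>i<L. c i j)) \<le> C / r ^ j / 2 ^ L"
     "\<And>j. j < s \<Longrightarrow> Vb G r (C / r ^ j) (e j)" by metis
  define x where "x = (\<Sum>j<s. e j * y ^ j)"
  have C: "C \<ge> 0" using Vb_nonneg[OF e(2)[OF s]] r by (simp add: zero_le_divide_iff)
  have "nrm (x - (\<Sum>i<L. t i)) \<le> C / 2 ^ L" for L
  proof -
    have "(\<Sum>i<L. t i) = (\<Sum>j<s. (\<Sum>i<L. c i j) * y ^ j)"
      unfolding c(2) sum_distrib_right by (rule sum.swap)
    then have "x - (\<Sum>i<L. t i) = (\<Sum>j<s. (e j - (\<Sum>i<L. c i j)) * y ^ j)"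
      unfolding x_def by (simp add: sum_subtractf left_diff_distrib)
    moreover have "nrm ((e j - (\<Sum>i<L. c i j)) * y ^ j) \<le> C / 2 ^ L" if "j < s" for j
    proof -
      have "nrm ((e j - (\<Sum>i<L. c i j)) * y ^ j) \<le> (C / r ^ j / 2 ^ L) * r ^ j"
        unfolding nrm_mult nrm_power using e(1)[OF that] Z[OF yZ] r C by (intro mult_mono power_mono) auto
      then show ?thesis using r by simp
    qed
    ultimately show ?thesis using C by (auto intro!: nrm_sum_le)
  qed
  moreover have "modl (Vb G r) y r s C x" unfolding modl_def x_def using e by blast
  ultimately show ?thesis by blast
qed

lemma Vb_modl_of_V: "modl (V G r) y r s C x \<Longrightarrow> modl (Vb G r) y r s C x"
  using r by (rule_tac modl_mono[where P = "V G r" and C = C]) (auto intro: Vb_mono[OF Vb_V])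

lemma Vb_modl_add: "modl (Vb G r) y r s C x \<Longrightarrow> modl (Vb G r) y r s C x' \<Longrightarrow> modl (Vb G r) y r s C (x + x')"
  using r by (intro modl_add) (auto intro: Vb_add)

lemma Vb_modl_mono: "modl (Vb G r) y r s C x \<Longrightarrow> C \<le> C' \<Longrightarrow> modl (Vb G r) y r s C' x"
  using r by (rule_tac modl_mono[where P = "Vb G r" and C = C]) (auto intro: Vb_mono)

lemma reduce_Vb:
  assumes "Vb Z r C x"
  shows "\<exists>t w. modl (Vb G r) y r s C t \<and> Vb Z r (q * C) w \<and> x = t + w"
proof -
  obtain X where X: "Vlim Z r C X x" using assms by (auto simp: Vb_def)
  have C: "C \<ge> 0" by (rule Vlim_nonneg[OF X])
  \<comment> \<open>Telescoping pieces of the approximating sequence, starting with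
    \<open>X 1\<close> so that the first \<open>Suc L\<close> pieces add up to
    \<open>X (Suc L)\<close>.\<close>
  define f where "f = (\<lambda>i. if i = 0 then X 1 else X (Suc i) - X i)"
  have fV: "V Z r (C / 2 ^ i) (f i)" for i using VlimD(1,2)[OF X] by (auto simp: f_def)
  have fs: "(\<Sum>i<Suc L. f i) = X (Suc L)" for L by (induction L) (auto simp: f_def)
  have "\<exists>t w. modl (V G r) y r s (C / 2 ^ i) t \<and> Vb Z r (q * (C / 2 ^ i)) w \<and> f i = t + w" for i
    using r by (intro reduce_V V_subst[OF fV ZG]) auto
  then obtain t w where t: "\<And>i. modl (V G r) y r s (C / 2 ^ i) (t i)"
    and w: "\<And>i. Vb Z r (q * C / 2 ^ i) (w i)" and f: "\<And>i. f i = t i + w i" by (simp, metis)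
  obtain t' B where t': "modl (Vb G r) y r s C t'" "\<And>L. nrm (t' - (\<Sum>i<L. t i)) \<le> B / 2 ^ L"
    using sum_modl[OF Vb_modl_of_V[OF t]] by blast
  obtain w' where w': "\<And>L. nrm (w' - (\<Sum>i<L. w i)) \<le> q * C / 2 ^ L" "Vb Z r (q * C) w'"
    using Vb_series[OF w _ Z] r by (metis less_imp_le)
  have "nrm (x - (t' + w')) \<le> max C B / 2 ^ L" for L
  proof -
    have "x - (t' + w') = (x - X (Suc L)) - ((t' - (\<Sum>i<Suc L. t i)) + (w' - (\<Sum>i<Suc L. w i)))"
      unfolding fs[symmetric] f sum.distrib by (simp add: algebra_simps)
    moreover have "nrm (x - X (Suc L)) \<le> max C B / 2 ^ Suc L"
      by (rule order_trans[OF VlimD(3)[OF X]]) (simp add: divide_right_mono)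
    moreover have "nrm (t' - (\<Sum>i<Suc L. t i)) \<le> max C B / 2 ^ Suc L"
      by (rule order_trans[OF t'(2)]) (simp add: divide_right_mono)
    moreover have "nrm (w' - (\<Sum>i<Suc L. w i)) \<le> max C B / 2 ^ Suc L"
    proof (rule order_trans[OF w'(1)])
      have "q * C \<le> 1 * C" using q01 C by (intro mult_right_mono) auto
      then show "q * C / 2 ^ Suc L \<le> max C B / 2 ^ Suc L" by (intro divide_right_mono) auto
    qed
    ultimately have "nrm (x - (t' + w')) \<le> max C B / 2 ^ Suc L" by (metis nrm_diff_le nrm_add_le)
    also have "\<dots> \<le> max C B / 2 ^ L" using C by (intro divide_left_mono) auto
    finally show ?thesis .
  qed
  then have "x - (t' + w') = 0" by (rule nrm_small_eq_0)
  then have "x = t' + w'" by simp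
  then show ?thesis using t' w' by blast
qed

lemma reduce_Vb_power:
  assumes "Vb Z r C x"
  shows "\<exists>t w. modl (Vb G r) y r s C t \<and> Vb Z r (q ^ n * C) w \<and> x = t + w"
proof (induction n)
  case 0
  have "C \<ge> 0" by (rule Vb_nonneg[OF assms])
  then have "modl (Vb G r) y r s C 0" using Vb_modl_of_V V_modl_0 r by blast
  then show ?case using assms by (intro exI[of _ 0] exI[of _ x]) auto
next
  case (Suc n)
  then obtain t w where t: "modl (Vb G r) y r s C t" "Vb Z r (q ^ n * C) w" "x = t + w" by blast
  obtain t' w' where t': "modl (Vb G r) y r s (q ^ n * C) t'" "Vb Z r (q * (q ^ n * C)) w'" "w = t' + w'"
    using reduce_Vb[OF t(2)] by blast
  have "C \<ge> 0" by (rule Vb_nonneg[OF assms])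
  moreover have "q ^ n \<le> 1" using q01 by (simp add: power_le_one)
  ultimately have "q ^ n * C \<le> C" using mult_right_mono[of "q ^ n" 1 C] by simp
  then have "modl (Vb G r) y r s C (t + t')" using t t' Vb_modl_add Vb_modl_mono by blast
  then show ?case using t t' by (intro exI[of _ "t + t'"] exI[of _ w']) (auto simp: algebra_simps)
qed

text \<open>Iterated reduction drives the error to zero, and the remainders split off on the way add
  up to a remainder that equals \<open>x\<close>.\<close>

lemma weierstrass_division:
  assumes "Vb Z r C x"
  shows "modl (Vb G r) y r s C x"
proof -
  \<comment> \<open>Several reductions are grouped into one so that the error at least halves, which
    matches the dyadic rate of completeness.\<close>
  obtain n where n: "q ^ n < 1 / 2" using real_arch_pow_inv[of "1/2" q] q01 by auto
  have "\<exists>t w. modl (Vb G r) y r s C t \<and> Vb Z r (C / 2) w \<and> x = t + w" if "Vb Z r C x" for C x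
  proof -
    have "q ^ n * C \<le> 1 / 2 * C" using n Vb_nonneg[OF that] by (intro mult_right_mono) auto
    then show ?thesis using reduce_Vb_power[OF that, of n] Vb_mono by fastforce
  qed
  then obtain T W where T: "\<And>C x. Vb Z r C x \<Longrightarrow> modl (Vb G r) y r s C (T C x)"
    and W: "\<And>C x. Vb Z r C x \<Longrightarrow> Vb Z r (C / 2) (W C x)" and TW: "\<And>C x. Vb Z r C x \<Longrightarrow> x = T C x + W C x"
    by metis
  define X where "X = rec_nat x (\<lambda>i x. W (C / 2 ^ i) x)"
  have X0: "X 0 = x" and XS: "X (Suc i) = W (C / 2 ^ i) (X i)" for i by (auto simp: X_def)
  have X: "Vb Z r (C / 2 ^ i) (X i)" for i
  proof (induction i)
    case (Suc i)
    then have "Vb Z r (C / 2 ^ i / 2) (X (Suc i))" unfolding XS by (rule W)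
    then show ?case by (simp add: field_simps)
  qed (simp add: X0 assms)
  obtain t B where t: "modl (Vb G r) y r s C t" "\<And>L. nrm (t - (\<Sum>i<L. T (C / 2 ^ i) (X i))) \<le> B / 2 ^ L"
    using sum_modl[of C "\<lambda>i. T (C / 2 ^ i) (X i)", OF T[OF X]] by blast
  have xs: "x = (\<Sum>i<L. T (C / 2 ^ i) (X i)) + X L" for L
    by (induction L) (use TW[OF X] in \<open>auto simp: X0 XS algebra_simps\<close>)
  have "nrm (x - t) \<le> max C B / 2 ^ L" for L
  proof -
    have "nrm (X L) \<le> max C B / 2 ^ L"
      by (rule order_trans[OF Vb_nrm[OF X Z]]) (use r in \<open>auto simp: divide_right_mono\<close>)
    moreover have "nrm (t - (\<Sum>i<L. T (C / 2 ^ i) (X i))) \<le> max C B / 2 ^ L"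
      by (rule order_trans[OF t(2)]) (auto simp: divide_right_mono)
    ultimately have "nrm (X L - (t - (\<Sum>i<L. T (C / 2 ^ i) (X i)))) \<le> max C B / 2 ^ L" by (rule nrm_diff_le)
    moreover have "X L - (t - (\<Sum>i<L. T (C / 2 ^ i) (X i))) = x - t" using xs[of L] by (simp add: algebra_simps)
    ultimately show ?thesis by simp
  qed
  then have "x - t = 0" by (rule nrm_small_eq_0)
  then have "x = t" by simp
  then show ?thesis using t by simp
qed

end

end

section \<open>Elementary preparations: digit expansions, double sums, exceptional radii\<close>

lemma digits_unique:
  fixes \<mu> \<nu> :: "nat \<Rightarrow> nat"
  assumes "\<And>i. i < n \<Longrightarrow> \<mu> i < B" "\<And>i. i < n \<Longrightarrow> \<nu> i < B"
    "(\<Sum>i<n. \<mu> i * B ^ i) = (\<Sum>i<n. \<nu> i * B ^ i)" "i < n"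
  shows "\<mu> i = \<nu> i"
  using assms
proof (induction n arbitrary: \<mu> \<nu> i)
  case (Suc n)
  have *: "(\<Sum>i<Suc n. f i * B ^ i) = f 0 + B * (\<Sum>i<n. f (Suc i) * B ^ i)" for f :: "nat \<Rightarrow> nat"
    by (subst sum.lessThan_Suc_shift) (simp add: sum_distrib_left algebra_simps)
  have B: "\<mu> 0 < B" "\<nu> 0 < B" using Suc.prems by auto
  have eq: "\<mu> 0 + B * (\<Sum>i<n. \<mu> (Suc i) * B ^ i) = \<nu> 0 + B * (\<Sum>i<n. \<nu> (Suc i) * B ^ i)"
    using Suc.prems(3) by (simp only: *)
  then have "(\<mu> 0 + B * (\<Sum>i<n. \<mu> (Suc i) * B ^ i)) mod B = (\<nu> 0 + B * (\<Sum>i<n. \<nu> (Suc i) * B ^ i)) mod B" by simp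
  then have 0: "\<mu> 0 = \<nu> 0" using B by simp
  then have "(\<Sum>i<n. \<mu> (Suc i) * B ^ i) = (\<Sum>i<n. \<nu> (Suc i) * B ^ i)" using eq B by simp
  then have "\<mu> (Suc j) = \<nu> (Suc j)" if "j < n" for j
    using Suc.IH[of "\<lambda>i. \<mu> (Suc i)" "\<lambda>i. \<nu> (Suc i)" j] Suc.prems(1,2) that by auto
  then show ?case using 0 Suc.prems(4) by (cases i) auto
qed simp

lemma sum_div_mod:
  fixes f :: "nat \<Rightarrow> nat \<Rightarrow> 'b::comm_monoid_add"
  assumes "B > 0"
  shows "(\<Sum>j<s. \<Sum>b<B. f j b) = (\<Sum>i<s * B. f (i div B) (i mod B))"
proof -
  have "(\<Sum>j<s. \<Sum>b<B. f j b) = (\<Sum>(j, b)\<in>{..<s} \<times> {..<B}. f j b)" by (simp add: sum.cartesian_product)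
  also have "\<dots> = (\<Sum>i<s * B. f (i div B) (i mod B))"
  proof (rule sum.reindex_bij_witness[of _ "\<lambda>i. (i div B, i mod B)" "\<lambda>(j, b). j * B + b"])
    fix a assume "a \<in> {..<s} \<times> {..<B}"
    then obtain j b where a: "a = (j, b)" "j < s" "b < B" by auto
    then have "j * B + b < Suc j * B" by simp
    also have "\<dots> \<le> s * B" using a by (intro mult_right_mono) auto
    finally show "(case a of (j, b) \<Rightarrow> j * B + b) \<in> {..<s * B}" using a by simp
  qed (use assms in \<open>auto simp: less_mult_imp_div_less\<close>)
  finally show ?thesis .
qed

text \<open>Two distinct powers balance at one positive radius at most. This lets
  \<open>noether_step\<close> choose a radius at which homogeneous parts of different degree have
  different norms.\<close>

lemma finite_real_power_eq:
  fixes a b :: real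
  assumes "a > 0" "b > 0" "i \<noteq> j"
  shows "finite {r. r > 0 \<and> a * r ^ i = b * r ^ j}"
proof -
  have *: "finite {r. r > 0 \<and> a * r ^ i = b * r ^ j}" if "i < j" "a > 0" "b > 0" for a b :: real and i j
  proof -
    have "r = s" if "r > 0" "a * r ^ i = b * r ^ j" "s > 0" "a * s ^ i = b * s ^ j" for r s
    proof -
      have "a = b * x ^ (j - i)" if "x > 0" "a * x ^ i = b * x ^ j" for x
      proof -
        have "x ^ j = x ^ (j - i) * x ^ i" using \<open>i < j\<close> by (simp add: power_add[symmetric])
        then show ?thesis using that by simp
      qed
      from this[OF that(1,2)] this[OF that(3,4)] have "r ^ (j - i) = s ^ (j - i)" using \<open>b > 0\<close> by simp
      then show ?thesis using that \<open>i < j\<close> power_eq_imp_eq_base[of r "j - i" s] by simp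
    qed
    note uniq = this
    show ?thesis
    proof (cases "\<exists>s>0. a * s ^ i = b * s ^ j")
      case True
      then obtain s where "s > 0" "a * s ^ i = b * s ^ j" by blast
      then have "{r. r > 0 \<and> a * r ^ i = b * r ^ j} \<subseteq> {s}" using uniq by blast
      then show ?thesis by (rule finite_subset) simp
    next
      case False
      then have "{r. r > 0 \<and> a * r ^ i = b * r ^ j} = {}" by blast
      then show ?thesis by (simp only: finite.emptyI)
    qed
  qed
  show ?thesis
  proof (cases "i < j")
    case False
    then have "j < i" using assms by simp
    moreover have "{r. r > 0 \<and> a * r ^ i = b * r ^ j} = {r. r > 0 \<and> b * r ^ j = a * r ^ i}" by auto
    ultimately show ?thesis using *[of j i b a] assms by simp
  qed (use * assms in auto)
qed

section \<open>Values at natural numbers and the elimination of a variable\<close>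

context valued
begin

lemma nrm_of_nat_diff: "a \<noteq> b \<Longrightarrow> nrm (of_nat a - of_nat b) = 1"
proof (induction a b rule: linorder_wlog)
  case (le a b)
  then have "nrm (of_nat b - of_nat a) = 1" using nrm_of_nat[of "b - a"] by (simp add: of_nat_diff)
  then show ?case by (simp add: nrm_diff_comm)
qed (simp add: nrm_diff_comm)

text \<open>Differences of distinct natural numbers have norm 1, so division by
  \<open>X - L0\<close> does not enlarge the values at the other points; induction on the degree
  bounds the quotient and hence \<open>f\<close>.\<close>

lemma coeff_bound:
  assumes "finite P" "card P > degree f" "\<And>L. L \<in> P \<Longrightarrow> nrm (poly f (of_nat L)) \<le> c"
  shows "nrm (coeff f i) \<le> c"
  using assms
proof (induction "degree f" arbitrary: f P i)
  case 0
  then obtain a where a: "f = [:a:]" by (metis degree_eq_zeroE)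
  obtain L where "L \<in> P" using 0 by (metis card.empty less_nat_zero_code ex_in_conv)
  then have "nrm a \<le> c" using 0 a by auto
  then show ?case using a order_trans[OF nrm_ge_0[of a]] by (cases i) auto
next
  case (Suc n)
  obtain L0 where L0: "L0 \<in> P" using Suc by (metis card.empty less_nat_zero_code ex_in_conv)
  define g where "g = synthetic_div f (of_nat L0)"
  have f: "f = [:- of_nat L0, 1:] * g + [:poly f (of_nat L0):]"
    using synthetic_div_correct'[of "of_nat L0" f] by (simp add: g_def)
  have dg: "n = degree g" using Suc(2) by (simp add: g_def degree_synthetic_div)
  have c0: "nrm (poly f (of_nat L0)) \<le> c" using Suc L0 by auto
  have gb: "nrm (coeff g i) \<le> c" for i
  proof (rule Suc(1)[OF dg])
    show "finite (P - {L0})" "card (P - {L0}) > degree g" using Suc L0 dg by auto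
    fix L assume L: "L \<in> P - {L0}"
    have "poly f (of_nat L) - poly f (of_nat L0) = (of_nat L - of_nat L0) * poly g (of_nat L)"
      by (subst f) (simp add: algebra_simps)
    then have "nrm (poly f (of_nat L) - poly f (of_nat L0)) = nrm (poly g (of_nat L))"
      using nrm_of_nat_diff[of L L0] L by (simp add: nrm_mult)
    moreover have "nrm (poly f (of_nat L) - poly f (of_nat L0)) \<le> c"
      using Suc.prems(3)[of L] L c0 by (intro nrm_diff_le) auto
    ultimately show "nrm (poly g (of_nat L)) \<le> c" by simp
  qed
  have 1: "nrm (coeff (pCons 0 g) i) \<le> c"
    using gb order_trans[OF nrm_ge_0 c0] by (cases i) auto
  have "nrm (of_nat L0 * coeff g i) \<le> 1 * c"
    unfolding nrm_mult using gb nrm_of_nat_le by (intro mult_mono) auto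
  then have 2: "nrm (coeff (pCons 0 g) i - of_nat L0 * coeff g i) \<le> c" using 1 by (intro nrm_diff_le) auto
  have 3: "nrm (coeff [:poly f (of_nat L0):] i) \<le> c" using c0 order_trans[OF nrm_ge_0 c0] by (cases i) auto
  have "coeff f i = (coeff (pCons 0 g) i - of_nat L0 * coeff g i) + coeff [:poly f (of_nat L0):] i"
    by (subst f) (simp del: coeff_pCons add: coeff_add)
  then show ?case using nrm_add_le[OF 2 3] by simp
qed

lemma value_attains_norm: "\<exists>L. \<forall>i. nrm (coeff f i) \<le> nrm (poly f (of_nat L))"
proof -
  let ?g = "\<lambda>L. nrm (poly f (of_nat L))"
  have "Max (?g ` {..degree f}) \<in> ?g ` {..degree f}" by (intro Max_in) auto
  then obtain L where "Max (?g ` {..degree f}) = ?g L" by (rule imageE)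
  then have L: "?g L = Max (?g ` {..degree f})" by (rule sym)
  have "nrm (coeff f i) \<le> ?g L" for i
    unfolding L by (rule coeff_bound[of "{..degree f}"]) auto
  then show ?thesis by blast
qed

text \<open>Kronecker substitution. On forms of degree \<open>s\<close> the exponents of the first
  \<open>m\<close> variables, read in base \<open>Suc s\<close>, give distinct numbers, so one
  univariate polynomial carries all the coefficients \<open>Q\<close>; the last exponent is
  determined by the degree. A natural number \<open>L\<close> at which this polynomial is as large
  as each coefficient yields \<open>l i = L ^ (Suc s ^ i)\<close>.\<close>

lemma leading_form_value:
  fixes Q :: "(nat \<Rightarrow> nat) \<Rightarrow> 'a"
  assumes S: "finite S" "S \<subseteq> Mon (Suc m)" "\<And>\<mu>. \<mu> \<in> S \<Longrightarrow> mdeg (Suc m) \<mu> = s"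
  shows "\<exists>l::nat \<Rightarrow> nat. \<forall>\<mu>\<in>S. nrm (Q \<mu>) \<le> nrm (\<Sum>\<mu>\<in>S. Q \<mu> * (\<Prod>i<m. of_nat (l i) ^ \<mu> i))"
proof -
  define e where "e = (\<lambda>\<mu>::nat \<Rightarrow> nat. \<Sum>i<m. \<mu> i * Suc s ^ i)"
  have le: "\<mu> i < Suc s" if "\<mu> \<in> S" "i < Suc m" for \<mu> i
  proof -
    have "\<mu> i \<le> (\<Sum>i<Suc m. \<mu> i)" using that by (intro member_le_sum) auto
    then show ?thesis using S(3)[OF that(1)] by (simp add: mdeg_def)
  qed
  have inj: "inj_on e S"
  proof (rule inj_onI, rule ext)
    fix \<mu> \<nu> i assume a: "\<mu> \<in> S" "\<nu> \<in> S" "e \<mu> = e \<nu>"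
    have eq: "\<mu> j = \<nu> j" if "j < m" for j
      using digits_unique[of m \<mu> "Suc s" \<nu> j] le[OF a(1)] le[OF a(2)] a(3) that by (auto simp: e_def)
    have "(\<Sum>i<Suc m. \<mu> i) = (\<Sum>i<Suc m. \<nu> i)" using S(3) a by (simp add: mdeg_def)
    then have "\<mu> m = \<nu> m" using eq by simp
    moreover have "\<mu> j = \<nu> j" if "j > m" for j
      using subsetD[OF S(2) a(1)] subsetD[OF S(2) a(2)] that by (auto simp: Mon_def)
    ultimately show "\<mu> i = \<nu> i" using eq by (metis linorder_neqE_nat)
  qed
  define f where "f = (\<Sum>\<mu>\<in>S. monom (Q \<mu>) (e \<mu>))"
  have cf: "coeff f (e \<mu>) = Q \<mu>" if "\<mu> \<in> S" for \<mu>
  proof -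
    have "coeff f (e \<mu>) = (\<Sum>\<nu>\<in>S. if \<nu> = \<mu> then Q \<nu> else 0)"
      unfolding f_def coeff_sum using inj that by (intro sum.cong) (auto simp: inj_on_def)
    then show ?thesis using that S(1) by simp
  qed
  obtain L where L: "\<And>i. nrm (coeff f i) \<le> nrm (poly f (of_nat L))" using value_attains_norm by blast
  have "poly f (of_nat L) = (\<Sum>\<mu>\<in>S. Q \<mu> * (\<Prod>i<m. of_nat (L ^ (Suc s ^ i)) ^ \<mu> i))"
    unfolding f_def poly_sum poly_monom e_def power_sum
    by (intro sum.cong refl arg_cong2[of _ _ _ _ "(*)"] prod.cong)
       (simp add: power_mult[symmetric] mult.commute)
  then show ?thesis using L cf by (intro exI[of _ "\<lambda>i. L ^ (Suc s ^ i)"]) metis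
qed

text \<open>A dependence supplies polynomials with small values at \<open>z\<close> but one
  persistently large coefficient. At a generic radius a single homogeneous part dominates, and the
  shear \<open>z i - l i * z m\<close> makes it regular in \<open>z m\<close>, so that Weierstrass
  division leaves only powers of \<open>z m\<close> below \<open>s\<close>.\<close>

lemma noether_step:
  assumes dep: "\<not> indep (Suc m) z R" and \<theta>: "0 < \<theta>" "\<theta> < R" and z: "\<And>i. i < Suc m \<Longrightarrow> nrm (z i) \<le> \<theta>"
  shows "\<exists>l \<rho> s. \<theta> < \<rho> \<and> \<rho> < R \<and>
    (\<forall>C x. Vb (z ` {..<Suc m}) R C x \<longrightarrow>
       modl (Vb ((\<lambda>i. z i - of_nat (l i) * z m) ` {..<m}) \<rho>) (z m) \<rho> s C x)"
proof -
  let ?k = "Suc m" and ?Z = "z ` {..<Suc m}"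
  have R: "R > 0" using \<theta> by simp
  obtain A C where A: "\<And>L. farr ?k R C (A L)" "\<And>L. farr ?k R (C / 2 ^ L) (\<lambda>\<mu>. A (Suc L) \<mu> - A L \<mu>)"
    "\<And>L. nrm (fev ?k z (A L)) \<le> C / 2 ^ L" and ex: "\<exists>L. \<not> farr ?k R (C / 2 ^ L) (A L)"
    using dep unfolding indep_def by blast
  obtain L0 where L0: "\<not> farr ?k R (C / 2 ^ L0) (A L0)" using ex by blast
  then obtain \<mu>0 where \<mu>0: "nrm (A L0 \<mu>0) * R ^ mdeg ?k \<mu>0 > C / 2 ^ L0"
    using farrD[OF A(1)[of L0]] unfolding farr_def by (auto simp: not_le)
  have C: "C \<ge> 0" using order_trans[OF nrm_ge_0 A(3)[of 0]] by simp
  \<comment> \<open>Measured at the smaller radius \<theta>, so that it bounds this term from below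
    at every radius \<rho> > \<theta>, before \<rho> is chosen.\<close>
  define c0 where "c0 = nrm (A L0 \<mu>0) * \<theta> ^ mdeg ?k \<mu>0"
  have "C / 2 ^ L0 \<ge> 0" using C by simp
  then have "A L0 \<mu>0 \<noteq> 0" using \<mu>0 by auto
  then have c0: "c0 > 0" using \<theta> nrm_pos by (simp add: c0_def)
  \<comment> \<open>Later changes of this coefficient are smaller than the coefficient itself, so
    its norm is frozen.\<close>
  have stable: "nrm (A L \<mu>0) = nrm (A L0 \<mu>0)" if "L \<ge> L0" for L
  proof -
    have "nrm (A L \<mu>0 - A L0 \<mu>0) * R ^ mdeg ?k \<mu>0 \<le> C / 2 ^ L0"
      using farrD(4)[OF farr_seq_diff[OF A(2) that]] R by simp
    also have "\<dots> < nrm (A L0 \<mu>0) * R ^ mdeg ?k \<mu>0" by fact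
    finally have "nrm (A L \<mu>0 - A L0 \<mu>0) < nrm (A L0 \<mu>0)" using R by simp
    then have "nrm (A L0 \<mu>0 - A L \<mu>0) < nrm (A L0 \<mu>0)" by (subst nrm_diff_comm)
    then show ?thesis by (rule nrm_eq_of_diff_less)
  qed
  obtain L1 where L1: "L1 \<ge> L0" "C / 2 ^ L1 < c0"
  proof -
    obtain n where "(1/2::real) ^ n < c0 / (C + 1)" using real_arch_pow_inv[of "c0 / (C+1)" "1/2"] c0 C by auto
    moreover have "(1/2::real) ^ (max n L0) \<le> (1/2) ^ n" by (intro power_decreasing) auto
    ultimately have "(1/2::real) ^ (max n L0) < c0 / (C + 1)" by linarith
    then have "(1/2::real) ^ (max n L0) * (C + 1) < c0" using C by (simp add: pos_less_divide_eq)
    moreover have "(1/2::real) ^ (max n L0) * C \<le> (1/2) ^ (max n L0) * (C + 1)" by (intro mult_left_mono) auto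
    ultimately have "C / 2 ^ max n L0 < c0" by (simp add: power_one_over field_simps)
    then show ?thesis using that[of "max n L0"] by simp
  qed
  \<comment> \<open>From index \<open>L1\<close> on, both the values at \<open>z\<close> and the
    further corrections stay below \<open>c0\<close>.\<close>
  define \<tau> where "\<tau> = C / 2 ^ L1"
  have \<tau>: "\<tau> \<ge> 0" "\<tau> < c0" using C L1 by (auto simp: \<tau>_def)
  define Q where "Q = A L1"
  define S where "S = {\<mu>. Q \<mu> \<noteq> 0}"
  have S: "finite S" "S \<subseteq> Mon ?k" using farrD(1,2)[OF A(1)[of L1]] by (auto simp: S_def Q_def)
  have QK: "Q \<mu> \<in> K" for \<mu> using farrD(3)[OF A(1)] by (simp add: Q_def)
  have Q0: "nrm (Q \<mu>0) = nrm (A L0 \<mu>0)" using stable[OF L1(1)] by (simp add: Q_def)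
  have \<mu>0S: "\<mu>0 \<in> S" using Q0 \<open>A L0 \<mu>0 \<noteq> 0\<close> nrm_eq_0_iff by (auto simp: S_def)
  have zR: "nrm g \<le> R" if "g \<in> ?Z" for g using that z \<theta> by fastforce
  \<comment> \<open>The values of the \<open>A L\<close> tend to 0, so the value of the truncation
    \<open>Q\<close> is the negative of the tail that was cut off, and as a power series that tail
    has norm at most \<tau>.\<close>
  have fQ: "Vb ?Z R \<tau> (fev ?k z Q)"
  proof -
    have d: "V ?Z R (C / 2 ^ i) (fev ?k z (A j) - fev ?k z (A i))" if "i \<le> j" for i j
      using V_fev[OF farr_seq_diff[OF A(2) that], of z] R
      by (simp add: fev_diff[OF farrD(1)[OF A(1)] farrD(1)[OF A(1)]])
    have "Vlim ?Z R \<tau> (\<lambda>L. fev ?k z Q - fev ?k z (A (L1 + L))) (fev ?k z Q)"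
      unfolding Vlim_def
    proof (intro allI conjI)
      fix L
      show "V ?Z R \<tau> (fev ?k z Q - fev ?k z (A (L1 + L)))"
        using V_minus[OF d[of L1 "L1 + L"]] by (simp add: \<tau>_def Q_def)
      show "V ?Z R (\<tau> / 2 ^ L) (fev ?k z Q - fev ?k z (A (L1 + Suc L)) - (fev ?k z Q - fev ?k z (A (L1 + L))))"
        using V_minus[OF d[of "L1 + L" "L1 + Suc L"]] by (simp add: \<tau>_def power_add)
      show "nrm (fev ?k z Q - (fev ?k z Q - fev ?k z (A (L1 + L)))) \<le> \<tau> / 2 ^ L"
        using A(3)[of "L1 + L"] by (simp add: \<tau>_def power_add)
    qed
    then show ?thesis by (auto simp: Vb_def)
  qed
  define D where "D = mdeg ?k ` S"
  have D: "finite D" "D \<noteq> {}" using S \<mu>0S by (auto simp: D_def)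
  define T where "T = (\<lambda>j. {\<mu> \<in> S. mdeg ?k \<mu> = j})"
  have T: "finite (T j)" for j using S by (simp add: T_def)
  have Tne: "T j \<noteq> {}" if "j \<in> D" for j using that by (auto simp: D_def T_def)
  define M where "M = (\<lambda>j. Max ((\<lambda>\<mu>. nrm (Q \<mu>)) ` T j))"
  have M_ge: "nrm (Q \<mu>) \<le> M j" if "\<mu> \<in> T j" for \<mu> j unfolding M_def using T that by (intro Max_ge) auto
  have M_ex: "\<exists>\<mu>\<in>T j. M j = nrm (Q \<mu>)" if "j \<in> D" for j
  proof -
    have "M j \<in> (\<lambda>\<mu>. nrm (Q \<mu>)) ` T j" unfolding M_def using T Tne[OF that] by (intro Max_in) auto
    then show ?thesis by blast
  qed
  have M_pos: "M j > 0" if "j \<in> D" for j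
  proof -
    from M_ex[OF that] obtain \<mu> where "\<mu> \<in> T j" "M j = nrm (Q \<mu>)" by blast
    then show ?thesis using nrm_pos by (auto simp: T_def S_def)
  qed
  \<comment> \<open>Only finitely many radii are excluded, those at which two homogeneous parts have
    equal norm.\<close>
  obtain \<rho> where \<rho>: "\<theta> < \<rho>" "\<rho> < R" and \<rho>D: "\<And>i j. i \<in> D \<Longrightarrow> j \<in> D \<Longrightarrow> i \<noteq> j \<Longrightarrow> M i * \<rho> ^ i \<noteq> M j * \<rho> ^ j"
  proof -
    define bad where "bad = (\<Union>i\<in>D. \<Union>j\<in>D - {i}. {r. r > 0 \<and> M i * r ^ i = M j * r ^ j})"
    have "finite bad" unfolding bad_def using D finite_real_power_eq M_pos by auto
    then have "infinite ({\<theta><..<R} - bad)" using infinite_Ioo[OF \<theta>(2)] by simp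
    then obtain \<rho> where "\<rho> \<in> {\<theta><..<R} - bad" by (metis finite.emptyI ex_in_conv)
    then show ?thesis using \<theta> by (intro that[of \<rho>]) (auto simp: bad_def)
  qed
  have \<rho>0: "\<rho> > 0" using \<rho> \<theta> by simp
  define N where "N = Max ((\<lambda>j. M j * \<rho> ^ j) ` D)"
  have "N \<in> (\<lambda>j. M j * \<rho> ^ j) ` D" unfolding N_def using D by (intro Max_in) auto
  then obtain s where s: "s \<in> D" "N = M s * \<rho> ^ s" by blast
  have N_ge: "M j * \<rho> ^ j \<le> N" if "j \<in> D" for j unfolding N_def using D that by (intro Max_ge) auto
  have N_gt: "M j * \<rho> ^ j < N" if "j \<in> D - {s}" for j
    using N_ge[of j] \<rho>D[of j s] that s by auto
  have "c0 \<le> nrm (Q \<mu>0) * \<rho> ^ mdeg ?k \<mu>0" unfolding c0_def Q0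
    using \<rho> \<theta> by (intro mult_left_mono power_mono) auto
  also have "\<dots> \<le> M (mdeg ?k \<mu>0) * \<rho> ^ mdeg ?k \<mu>0"
    using \<mu>0S \<rho>0 by (intro mult_right_mono M_ge) (auto simp: T_def)
  also have "\<dots> \<le> N" using \<mu>0S by (intro N_ge) (auto simp: D_def)
  finally have \<tau>N: "\<tau> < N" and Npos: "N > 0" using \<tau> c0 by auto
  \<comment> \<open>All sizes that compete with the dominant one, the tail included;
    \<open>q\<close> is the largest of them relative to \<open>N\<close>, hence below 1.\<close>
  define F where "F = insert \<tau> ((\<lambda>j. M j * \<rho> ^ j) ` (D - {s}))"
  have F: "finite F" "F \<noteq> {}" using D by (auto simp: F_def)
  define q where "q = Max F / N"
  have "Max F < N" using F N_gt \<tau>N by (auto simp: F_def)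
  then have q1: "q < 1" using Npos by (simp add: q_def)
  have Fle: "x \<le> q * N" if "x \<in> F" for x using that F Npos by (simp add: q_def)
  have "\<tau> \<le> q * N" using Fle by (simp add: F_def)
  then have "0 \<le> q * N" using \<tau> by linarith
  then have q0: "q \<ge> 0" using Npos by (simp add: zero_le_mult_iff)
  define H where "H = (\<lambda>j. \<Sum>\<mu>\<in>T j. Q \<mu> * mon ?k z \<mu>)"
  have HV: "V ?Z \<rho> (M j * \<rho> ^ j) (H j)" if "j \<in> D" for j
    unfolding H_def
  proof (rule V_sum)
    show "M j * \<rho> ^ j \<ge> 0" using M_pos[OF that] \<rho>0 by simp
    fix \<mu> assume \<mu>: "\<mu> \<in> T j"
    have "V ?Z \<rho> (\<rho> ^ mdeg ?k \<mu>) (mon ?k z \<mu>)" using \<rho>0 by (intro V_mon) (auto intro: V_gens)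
    then show "V ?Z \<rho> (M j * \<rho> ^ j) (Q \<mu> * mon ?k z \<mu>)"
      using M_ge[OF \<mu>] \<rho>0 \<mu> by (intro V_scale[OF _ QK]) (auto simp: T_def intro: mult_right_mono)
  qed
  have fev_H: "fev ?k z Q = (\<Sum>j\<in>D. H j)"
    unfolding fev_def H_def T_def D_def S_def[symmetric] using S(1) by (rule sum.image_gen)
  have subZ: "Vb ?Z \<rho> C x" if "Vb ?Z R C x" for C x
    using that \<rho> \<rho>0 by (rule_tac Vb_subst) (auto intro: V_mono[OF V_gens])
  \<comment> \<open>The dominant form is the small total minus the other forms, so its value is also
    that of a power series whose norm falls short of \<open>N\<close> by the factor
    \<open>q\<close>.\<close>
  have Hs: "Vb ?Z \<rho> (q * N) (H s)"
  proof -
    have "Vb ?Z \<rho> (q * N) (fev ?k z Q)" by (rule Vb_mono[OF subZ[OF fQ]]) fact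
    moreover have "Vb ?Z \<rho> (q * N) (\<Sum>j\<in>D - {s}. H j)"
    proof (rule Vb_sum)
      fix j assume j: "j \<in> D - {s}"
      then have "M j * \<rho> ^ j \<in> F" by (auto simp: F_def)
      then show "Vb ?Z \<rho> (q * N) (H j)" using HV[of j] j Fle \<rho>0 by (intro Vb_mono[OF Vb_V]) auto
    qed (use \<open>0 \<le> q * N\<close> \<rho>0 in auto)
    ultimately have "Vb ?Z \<rho> (q * N) (fev ?k z Q - (\<Sum>j\<in>D - {s}. H j))" by (rule Vb_diff)
    moreover have "fev ?k z Q = H s + (\<Sum>j\<in>D - {s}. H j)" unfolding fev_H using D s by (intro sum.remove)
    ultimately show ?thesis by simp
  qed
  have "T s \<subseteq> Mon ?k" "\<And>\<mu>. \<mu> \<in> T s \<Longrightarrow> mdeg ?k \<mu> = s" using S(2) by (auto simp: T_def)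
  from leading_form_value[OF T this] obtain l :: "nat \<Rightarrow> nat"
    where l: "\<And>\<mu>. \<mu> \<in> T s \<Longrightarrow> nrm (Q \<mu>) \<le> nrm (\<Sum>\<mu>\<in>T s. Q \<mu> * (\<Prod>i<m. of_nat (l i) ^ \<mu> i))"
    by blast
  define y where "y = z m"
  define G where "G = (\<lambda>i. z i - of_nat (l i) * z m) ` {..<m}"
  \<comment> \<open>Coefficient of \<open>y ^ s\<close> in the dominant form after the shear, that
    is, the form evaluated at \<open>(l, 1)\<close>. By the choice of \<open>l\<close> its norm is
    at least \<open>M s\<close>, so one can divide by it without loss.\<close>
  define \<kappa> where "\<kappa> = (\<Sum>\<mu>\<in>T s. Q \<mu> * (\<Prod>i<m. of_nat (l i) ^ \<mu> i))"
  have natK: "of_nat n \<in> K" for n by (rule subring_of_nat[OF K_ring])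
  have \<kappa>K: "\<kappa> \<in> K" unfolding \<kappa>_def
    by (intro subring_sum[OF K_ring] subring_mult[OF K_ring] QK subring_prod[OF K_ring] subring_power[OF K_ring] natK)
  obtain \<nu> where "\<nu> \<in> T s" "M s = nrm (Q \<nu>)" using M_ex[OF s(1)] by blast
  then have "M s \<le> nrm \<kappa>" using l unfolding \<kappa>_def by simp
  then have \<kappa>0: "nrm \<kappa> > 0" using M_pos[OF s(1)] by linarith
  then have \<kappa>n0: "\<kappa> \<noteq> 0" by auto
  have lead_z: "lead G y \<rho> 1 (if i < m then of_nat (l i) else 1) (z i)" if "i < Suc m" for i
  proof (cases "i < m")
    case True
    then have "lead G y \<rho> 1 (of_nat (l i)) ((z i - of_nat (l i) * z m) + of_nat (l i) * y)"
      using \<rho>0 by (intro lead_linear natK nrm_of_nat_le V_gens) (auto simp: G_def)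
    then show ?thesis using True by (simp add: y_def)
  next
    case False
    then have "i = m" using that by simp
    moreover have "lead G y \<rho> 1 1 (0 + 1 * y)" using \<rho>0 by (intro lead_linear V_0 subring_1[OF K_ring]) auto
    ultimately show ?thesis by (simp add: y_def)
  qed
  have lead_mon: "lead G y \<rho> s (\<Prod>i<m. of_nat (l i) ^ \<mu> i) (mon ?k z \<mu>)" if "\<mu> \<in> T s" for \<mu>
  proof -
    have "lead G y \<rho> (\<Sum>i<Suc m. 1 * \<mu> i) (\<Prod>i<Suc m. (if i < m then of_nat (l i) else 1) ^ \<mu> i) (\<Prod>i<Suc m. z i ^ \<mu> i)"
      using \<rho>0 by (intro lead_prod lead_power lead_z) auto
    moreover have "(\<Sum>i<Suc m. 1 * \<mu> i) = s" using that by (simp add: T_def mdeg_def)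
    moreover have "(\<Prod>i<Suc m. (if i < m then of_nat (l i) else 1) ^ \<mu> i) = (\<Prod>i<m. (of_nat (l i) :: 'a) ^ \<mu> i)"
      by simp
    ultimately show ?thesis by (simp only: mon_def)
  qed
  have "\<forall>\<mu>\<in>T s. \<exists>t. modl (V G \<rho>) y \<rho> s (\<rho> ^ s) t \<and> mon ?k z \<mu> = (\<Prod>i<m. of_nat (l i) ^ \<mu> i) * y ^ s + t"
    using lead_modl[OF lead_mon \<rho>0] by metis
  then obtain t where t: "\<And>\<mu>. \<mu> \<in> T s \<Longrightarrow> modl (V G \<rho>) y \<rho> s (\<rho> ^ s) (t \<mu>)"
    "\<And>\<mu>. \<mu> \<in> T s \<Longrightarrow> mon ?k z \<mu> = (\<Prod>i<m. of_nat (l i) ^ \<mu> i) * y ^ s + t \<mu>" by metis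
  define t1 where "t1 = (\<Sum>\<mu>\<in>T s. Q \<mu> * t \<mu>)"
  have Hs_eq: "H s = \<kappa> * y ^ s + t1"
    unfolding H_def \<kappa>_def t1_def sum_distrib_right sum.distrib[symmetric]
    by (intro sum.cong refl) (simp add: t(2) algebra_simps)
  have t1: "modl (V G \<rho>) y \<rho> s (M s * \<rho> ^ s) t1"
    unfolding t1_def
  proof (rule V_modl_sum)
    show "0 \<le> M s * \<rho> ^ s" using M_pos[OF s(1)] \<rho>0 by simp
    fix \<mu> assume \<mu>: "\<mu> \<in> T s"
    show "modl (V G \<rho>) y \<rho> s (M s * \<rho> ^ s) (Q \<mu> * t \<mu>)"
    proof (rule modl_scale[OF _ t(1)[OF \<mu>]])
      fix C x assume *: "V G \<rho> C x"
      have "nrm (Q \<mu>) * C \<le> M s * C" using M_ge[OF \<mu>] V_nonneg[OF *] \<rho>0 by (intro mult_right_mono) auto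
      then show "V G \<rho> (M s * C) (Q \<mu> * x)" by (intro V_scale[OF * QK])
    qed
  qed (use \<rho>0 in auto)
  have \<kappa>inv: "inverse \<kappa> \<in> K" by (rule K_inverse[OF \<kappa>K])
  have \<kappa>M: "nrm (inverse \<kappa>) * M s \<le> 1" unfolding nrm_inverse using \<open>M s \<le> nrm \<kappa>\<close> \<kappa>0 by (simp add: field_simps)
  define t0 where "t0 = - inverse \<kappa> * t1"
  define w0 where "w0 = inverse \<kappa> * H s"
  have rel: "y ^ s = t0 + w0" using \<kappa>n0 by (simp add: t0_def w0_def Hs_eq field_simps)
  have t0: "modl (V G \<rho>) y \<rho> s (\<rho> ^ s) t0"
  proof -
    have "modl (V G \<rho>) y \<rho> s (inverse (M s) * (M s * \<rho> ^ s)) (- inverse \<kappa> * t1)"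
    proof (rule modl_scale[OF _ t1])
      fix C x assume *: "V G \<rho> C x"
      have "nrm (- inverse \<kappa>) * C \<le> inverse (M s) * C"
        using \<kappa>M M_pos[OF s(1)] V_nonneg[OF *] \<rho>0 by (intro mult_right_mono) (auto simp: field_simps)
      then show "V G \<rho> (inverse (M s) * C) (- inverse \<kappa> * x)"
        by (intro V_scale[OF * subring_minus[OF K_ring \<kappa>inv]])
    qed
    moreover have "inverse (M s) * (M s * \<rho> ^ s) = \<rho> ^ s" using M_pos[OF s(1)] by simp
    ultimately show ?thesis unfolding t0_def by simp
  qed
  have zr: "nrm g \<le> \<rho>" if "g \<in> ?Z" for g using that z \<rho> by fastforce
  have w0: "Vb ?Z \<rho> (q * \<rho> ^ s) w0"
    unfolding w0_def
  proof (rule Vb_mult[OF Vb_V[OF V.const[OF \<kappa>inv order_refl]] Hs])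
    have "nrm (inverse \<kappa>) * (q * N) = (nrm (inverse \<kappa>) * M s) * (q * \<rho> ^ s)" by (simp add: s(2))
    also have "\<dots> \<le> 1 * (q * \<rho> ^ s)" using \<kappa>M q0 \<rho>0 by (intro mult_right_mono) auto
    finally show "nrm (inverse \<kappa>) * (q * N) \<le> q * \<rho> ^ s" by simp
  qed (use \<rho>0 zr in auto)
  \<comment> \<open>Degree 0 would turn the relation into a bound \<open>q < 1\<close> for the norm
    of 1.\<close>
  have spos: "s > 0"
  proof (rule ccontr)
    assume "\<not> s > 0"
    then have "s = 0" by simp
    then have "t0 = 0" using t0 by (simp add: modl_def)
    then have "nrm (y ^ s) \<le> q * \<rho> ^ s" using rel Vb_nrm[OF w0 zr] \<rho>0 by simp
    then show False using \<open>s = 0\<close> q1 by simp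
  qed
  have zl: "nrm (of_nat (l i) * z m) \<le> \<theta>" for i
    using mult_mono[OF nrm_of_nat_le[of "l i"] z[of m]] by (simp add: nrm_mult)
  have "modl (Vb G \<rho>) y \<rho> s C x" if "Vb ?Z R C x" for C x
  proof (rule weierstrass_division[OF \<rho>0 spos q0 q1 zr])
    show "nrm g \<le> \<rho>" if "g \<in> G" for g
      using that z zl \<rho>(1) by (auto simp: G_def intro!: nrm_diff_le intro: order_trans[of _ \<theta>])
    show "V ?Z \<rho> \<rho> g" if "g \<in> G" for g
    proof -
      from that obtain i where i: "i < m" "g = z i - of_nat (l i) * z m" by (auto simp: G_def)
      have "V ?Z \<rho> \<rho> (z i)" "V ?Z \<rho> \<rho> (z m)" using i by (auto intro: V_gens)
      moreover have "nrm (of_nat (l i)) * \<rho> \<le> \<rho>" using nrm_of_nat_le[of "l i"] \<rho>0 by (simp add: mult_le_cancel_right1)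
      ultimately show ?thesis unfolding i(2) by (intro V_diff V_scale[OF _ natK])
    qed
    show "y \<in> ?Z" by (simp add: y_def)
    show "V (insert y G) \<rho> \<rho> g" if "g \<in> ?Z" for g
    proof -
      from that obtain i where i: "i < Suc m" "g = z i" by auto
      show ?thesis
      proof (cases "i = m")
        case True then show ?thesis using i by (auto intro: V_gens simp: y_def)
      next
        case False
        have "V (insert y G) \<rho> \<rho> (z i - of_nat (l i) * z m)" "V (insert y G) \<rho> \<rho> y"
          using i False by (auto intro!: V_gens simp: G_def)
        moreover have "nrm (of_nat (l i)) * \<rho> \<le> \<rho>" using nrm_of_nat_le[of "l i"] \<rho>0 by (simp add: mult_le_cancel_right1)
        ultimately have "V (insert y G) \<rho> \<rho> ((z i - of_nat (l i) * z m) + of_nat (l i) * y)"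
          by (intro V.add V_scale[OF _ natK])
        then show ?thesis using i by (simp add: y_def)
      qed
    qed
    show "Vb ?Z \<rho> C x" by (rule subZ[OF that])
  qed (use rel t0 w0 in auto)
  then show ?thesis unfolding G_def y_def using \<rho> by blast
qed

text \<open>Without variables an array is a single constant, equal to its value.\<close>

lemma indep_0:
  assumes "r > 0" shows "indep 0 u r"
  unfolding indep_def
proof (intro allI impI)
  fix A C L assume A: "\<forall>L. farr 0 r C (A L)" "\<forall>L. nrm (fev 0 u (A L)) \<le> C / 2 ^ L"
  note AL = farrD[OF A(1)[rule_format, of L]]
  have M: "\<mu> \<in> Mon 0 \<Longrightarrow> \<mu> = (\<lambda>_. 0)" for \<mu> by (auto simp: Mon_def)
  have "fev 0 u (A L) = (\<Sum>\<mu>\<in>{\<lambda>_. 0}. A L \<mu> * mon 0 u \<mu>)"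
    using AL(2) M by (intro fev_superset) auto
  then have "fev 0 u (A L) = A L (\<lambda>_. 0)" by (simp add: mon_def)
  then have "nrm (A L (\<lambda>_. 0)) \<le> C / 2 ^ L" using A(2) by metis
  moreover have "C / 2 ^ L \<ge> 0" using A(2) order_trans[OF nrm_ge_0] by blast
  ultimately have "nrm (A L \<mu>) \<le> C / 2 ^ L" for \<mu> using AL(2)[of \<mu>] M[of \<mu>] by (cases "A L \<mu> = 0") auto
  then show "farr 0 r (C / 2 ^ L) (A L)" using AL by (auto simp: farr_def mdeg_def)
qed

text \<open>Induction on the number of variables, for all \<open>z\<close> and radii at once, since
  each step shears the variables and shrinks the radius. \<Lambda> is any set of small elements
  stable under the shears; later it consists of those \<open>x\<close> for which
  \<open>p * x\<close> is integral. The generators \<open>t\<close> and the constant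
  \<open>C0\<close> do not depend on \<open>x\<close>, so that all powers of one element can be
  treated uniformly.\<close>

theorem noether:
  fixes m :: nat
  assumes \<Lambda>: "\<And>x y n. x \<in> \<Lambda> \<Longrightarrow> y \<in> \<Lambda> \<Longrightarrow> x - of_nat n * y \<in> \<Lambda>" "\<And>x. x \<in> \<Lambda> \<Longrightarrow> nrm x \<le> \<theta>"
    and \<theta>: "0 < \<theta>" "\<theta> < R" and z: "\<And>i. i < m \<Longrightarrow> z i \<in> \<Lambda>"
  shows "\<exists>k u \<rho> B t C0. (\<forall>i<k. u i \<in> \<Lambda>) \<and> indep k u \<rho> \<and> \<theta> < \<rho> \<and> \<rho> \<le> R \<and> C0 > 0 \<and>
    (\<forall>C x. Vb (z ` {..<m}) R C x \<longrightarrow>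
      (\<exists>g. (\<forall>b<B. Vb (u ` {..<k}) \<rho> (C0 * C) (g b)) \<and> x = (\<Sum>b<(B::nat). g b * t b)))"
  (is "?P m z R")
proof -
  have "\<forall>z R. \<theta> < R \<longrightarrow> (\<forall>i<m. z i \<in> \<Lambda>) \<longrightarrow> ?P m z R"
proof (induction m)
  case 0
  show ?case
  proof (intro allI impI)
  fix z R assume 0: "\<theta> < R"
  have "R > 0" using 0 \<theta> by simp
  then show "?P 0 z R" using 0 indep_0[of R z]
    by (rule_tac exI[of _ 0], rule_tac exI[of _ z], rule_tac exI[of _ R], rule_tac exI[of _ 1],
        rule_tac exI[of _ "\<lambda>_. 1"], rule_tac exI[of _ 1]) (auto intro: exI[of _ "\<lambda>_. _"])
  qed
next
  case (Suc m)
  show ?case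
  proof (intro allI impI)
  fix z R assume R: "\<theta> < R" and z: "\<forall>i<Suc m. z i \<in> \<Lambda>"
  show "?P (Suc m) z R"
  proof (cases "indep (Suc m) z R")
    case True
    then show ?thesis using R z
      by (rule_tac exI[of _ "Suc m"], rule_tac exI[of _ z], rule_tac exI[of _ R], rule_tac exI[of _ 1],
          rule_tac exI[of _ "\<lambda>_. 1"], rule_tac exI[of _ 1]) (auto intro: exI[of _ "\<lambda>_. _"])
  next
    case False
    have "nrm (z i) \<le> \<theta>" if "i < Suc m" for i using \<Lambda>(2) z that by auto
    from noether_step[OF False \<theta>(1) R this] obtain l \<rho> s where \<rho>: "\<theta> < \<rho>" "\<rho> < R"
      and red: "\<And>C x. Vb (z ` {..<Suc m}) R C x \<Longrightarrow>
       modl (Vb ((\<lambda>i. z i - of_nat (l i) * z m) ` {..<m}) \<rho>) (z m) \<rho> s C x" by blast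
    define z' where "z' = (\<lambda>i. z i - of_nat (l i) * z m)"
    have "\<forall>i<m. z' i \<in> \<Lambda>" using \<Lambda>(1) z by (auto simp: z'_def)
    with Suc.IH \<rho>(1) have "?P m z' \<rho>" by blast
    then obtain k u \<rho>' B t C0 where u: "\<forall>i<k. u i \<in> \<Lambda>" "indep k u \<rho>'" "\<theta> < \<rho>'" "\<rho>' \<le> \<rho>" "C0 > 0"
      and rep: "\<And>C x. Vb (z' ` {..<m}) \<rho> C x \<Longrightarrow>
        \<exists>g. (\<forall>b<B. Vb (u ` {..<k}) \<rho>' (C0 * C) (g b)) \<and> x = (\<Sum>b<(B::nat). g b * t b)" by blast
    have \<rho>0: "\<rho> > 0" using \<rho> \<theta> by simp
    \<comment> \<open>Bounds the factors \<open>1 / \<rho> ^ j\<close> that division introduces, so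
      that \<open>C0 * C1\<close> serves all coefficients.\<close>
    obtain C1 where C1: "C1 > 0" "\<And>j. j < s \<Longrightarrow> 1 / \<rho> ^ j \<le> C1"
    proof
      show "(\<Sum>j\<le>s. 1 / \<rho> ^ j) > 0" using \<rho>0 by (intro sum_pos) auto
      show "1 / \<rho> ^ j \<le> (\<Sum>j\<le>s. 1 / \<rho> ^ j)" if "j < s" for j
        using that \<rho>0 by (intro member_le_sum) auto
    qed
    show "?P (Suc m) z R"
    \<comment> \<open>The new generators are products of old ones with powers of \<open>z m\<close>
      below \<open>s\<close>, numbered by quotient and remainder modulo \<open>B\<close>.\<close>
    proof (rule exI[of _ k], rule exI[of _ u], rule exI[of _ \<rho>'], rule exI[of _ "s * B"],
        rule exI[of _ "\<lambda>i. t (i mod B) * z m ^ (i div B)"], rule exI[of _ "C0 * C1"], intro conjI allI impI)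
      show "\<rho>' \<le> R" "C0 * C1 > 0" using u \<rho> C1 by auto
      fix C x assume x: "Vb (z ` {..<Suc m}) R C x"
      have C: "C \<ge> 0" by (rule Vb_nonneg[OF x])
      obtain c where c: "\<And>j. j < s \<Longrightarrow> Vb (z' ` {..<m}) \<rho> (C / \<rho> ^ j) (c j)" "x = (\<Sum>j<s. c j * z m ^ j)"
        using red[OF x] unfolding modl_def z'_def[symmetric] by blast
      have "\<exists>g. (\<forall>b<B. Vb (u ` {..<k}) \<rho>' (C0 * (C / \<rho> ^ j)) (g b)) \<and> c j = (\<Sum>b<(B::nat). g b * t b)" if "j < s" for j
        using rep[OF c(1)[OF that]] .
      then obtain g where g: "\<And>j b. j < s \<Longrightarrow> b < B \<Longrightarrow> Vb (u ` {..<k}) \<rho>' (C0 * (C / \<rho> ^ j)) (g j b)"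
        "\<And>j. j < s \<Longrightarrow> c j = (\<Sum>b<B. g j b * t b)" by metis
      have "\<exists>g. (\<forall>b<s * B. Vb (u ` {..<k}) \<rho>' (C0 * C1 * C) (g b)) \<and>
          x = (\<Sum>b<s * B. g b * (t (b mod B) * z m ^ (b div B)))"
      proof (cases "B = 0")
        case True
        then show ?thesis using c(2) g(2) by auto
      next
        case False
        have "x = (\<Sum>j<s. \<Sum>b<B. g j b * (t b * z m ^ j))"
          unfolding c(2) using g(2) by (intro sum.cong refl) (simp add: sum_distrib_right mult.assoc)
        also have "\<dots> = (\<Sum>i<s * B. g (i div B) (i mod B) * (t (i mod B) * z m ^ (i div B)))"
          using False by (intro sum_div_mod) auto
        finally have xx: "x = \<dots>" .
        have "Vb (u ` {..<k}) \<rho>' (C0 * C1 * C) (g (i div B) (i mod B))" if "i < s * B" for i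
        proof (rule Vb_mono[OF g(1)])
          show "i div B < s" using that by (simp add: less_mult_imp_div_less)
          then have "C0 * C * (1 / \<rho> ^ (i div B)) \<le> C0 * C * C1" using C1(2) u C by (intro mult_left_mono) auto
          then show "C0 * (C / \<rho> ^ (i div B)) \<le> C0 * C1 * C" by (simp add: algebra_simps)
        qed (use False in auto)
        with xx show ?thesis by (rule_tac exI[of _ "\<lambda>i. g (i div B) (i mod B)"]) simp
      qed
      then show "\<exists>g. (\<forall>b<s * B. Vb (u ` {..<k}) \<rho>' (C0 * C1 * C) (g b)) \<and>
          x = (\<Sum>b<s * B. g b * (t (b mod B) * z m ^ (b div B)))" .
    qed (use u in auto)
  qed
  qed
qed
  from mp[OF this[THEN spec, THEN spec, of R z] \<theta>(2)] show ?thesis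
    by (rule mp) (use z in auto)
qed

end

section \<open>Derivatives with respect to analytic coordinates\<close>

lemma fev_add:
  assumes "finite {\<mu>. a \<mu> \<noteq> 0}" "finite {\<mu>. b \<mu> \<noteq> 0}"
  shows "fev k u (\<lambda>\<mu>. a \<mu> + b \<mu>) = fev k u a + fev k u b"
proof -
  have f: "finite {\<mu>. - b \<mu> \<noteq> 0}" using assms(2) by simp
  have "fev k u (\<lambda>\<mu>. 0 - b \<mu>) = fev k u (\<lambda>_. 0) - fev k u b" using assms(2) by (intro fev_diff) auto
  then have "fev k u (\<lambda>\<mu>. - b \<mu>) = - fev k u b" by (simp add: fev_def)
  then show ?thesis using fev_diff[OF assms(1) f, of k u] by simp
qed

context valued
begin

lemma farr_nonneg: "farr k r C a \<Longrightarrow> r \<ge> 0 \<Longrightarrow> C \<ge> 0"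
  using farrD(4)[of k r C a] mult_nonneg_nonneg[OF nrm_ge_0 zero_le_power] order_trans by blast

text \<open>The polynomial ring over \<open>K\<close> generated by \<open>G\<close>, with the Gauss
  bound forgotten.\<close>

definition vals :: "'a set \<Rightarrow> real \<Rightarrow> 'a set" where "vals G r = {x. \<exists>C. V G r C x}"

lemma subring_vals: "r \<ge> 0 \<Longrightarrow> subring (vals G r)"
proof (rule subringI)
  assume r: "r \<ge> 0"
  show "1 \<in> vals G r" using V_1[OF order_refl] by (auto simp: vals_def)
  fix x y assume "x \<in> vals G r" "y \<in> vals G r"
  then obtain C C' where x: "V G r C x" and y: "V G r C' y" by (auto simp: vals_def)
  have "V G r (max C C') (x - y)" using V_mono[OF x, of "max C C'"] V_mono[OF y, of "max C C'"] by (intro V_diff) auto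
  moreover have "V G r (C * C') (x * y)" using V_mult[OF x y order_refl r] .
  ultimately show "x - y \<in> vals G r" "x * y \<in> vals G r" by (auto simp: vals_def)
qed

lemma K_vals: "a \<in> K \<Longrightarrow> a \<in> vals G r" using V.const[OF _ order_refl] by (auto simp: vals_def)
lemma gen_vals: "g \<in> G \<Longrightarrow> g \<in> vals G r" using V_gens by (auto simp: vals_def)

lemma derivation_vals:
  assumes "derivation d" "\<And>a. a \<in> K \<Longrightarrow> d a = 0" "\<And>g. g \<in> G \<Longrightarrow> d g = 0" "x \<in> vals G r"
  shows "d x = 0"
proof -
  obtain C where "V G r C x" using assms by (auto simp: vals_def)
  then show ?thesis
    by (induction rule: V.induct) (auto simp: derivation_add[OF assms(1)] derivation_mult[OF assms(1)] assms(2,3))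
qed

text \<open>A relation for \<open>u l\<close> whose coefficients avoid \<open>u l\<close> is
  assembled into one array by shifting. Independence makes the array zero, and its entries at
  exponent \<open>i\<close> of the \<open>l\<close>-th variable are those of the \<open>i\<close>-th
  coefficient.\<close>

lemma indep_transc:
  assumes ind: "indep k u r" and r: "r > 0" and l: "l < k"
  shows "transc (vals (u ` ({..<k} - {l})) r) (u l)"
  unfolding transc_def
proof (intro ballI impI)
  fix f assume f: "f \<in> polys_over (vals (u ` ({..<k} - {l})) r)" "poly f (u l) = 0"
  have "\<exists>C a. C \<ge> 0 \<and> farr k r C a \<and> fev k u a = coeff f i \<and> (\<forall>\<mu>. a \<mu> \<noteq> 0 \<longrightarrow> \<mu> l = 0)" for i
  proof -
    obtain C where "V (u ` ({..<k} - {l})) r C (coeff f i)" using f(1) by (auto simp: polys_over_def vals_def)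
    from V_imp_farr[OF this, of k] obtain a where a: "farr k r C a" "fev k u a = coeff f i"
      "\<forall>\<mu>. a \<mu> \<noteq> 0 \<longrightarrow> (\<forall>i. i \<notin> {..<k} - {l} \<longrightarrow> \<mu> i = 0)" using r by auto
    then show ?thesis using farr_nonneg[OF a(1)] r by (intro exI[of _ C] exI[of _ a]) auto
  qed
  then obtain C a where a: "\<And>i. C i \<ge> 0" "\<And>i. farr k r (C i) (a i)" "\<And>i. fev k u (a i) = coeff f i"
    "\<And>i \<mu>. a i \<mu> \<noteq> 0 \<Longrightarrow> \<mu> l = 0" by metis
  define B where "B = (\<Sum>i\<le>degree f. r ^ i * C i)"
  have Bi: "r ^ i * C i \<le> B" if "i \<le> degree f" for i
    unfolding B_def using a(1) r that by (intro member_le_sum) auto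
  have sh: "farr k r B (shift l i (a i))" if "i \<le> degree f" for i
    using r Bi[OF that] by (intro farr_shift[OF a(2) l]) auto
  define b where "b = (\<lambda>\<mu>. \<Sum>i\<le>degree f. shift l i (a i) \<mu>)"
  have "B \<ge> 0" unfolding B_def using a(1) r by (intro sum_nonneg) auto
  then have fb: "farr k r B b" unfolding b_def using sh r by (intro farr_sum) auto
  have "fev k u b = (\<Sum>i\<le>degree f. fev k u (shift l i (a i)))"
    unfolding b_def using farrD(1)[OF sh] by (intro fev_sum) auto
  also have "\<dots> = poly f (u l)" by (simp add: fev_shift[OF l] a(3) poly_altdef mult.commute)
  finally have b0: "b \<mu> = 0" for \<mu> using indep_algebraic[OF ind fb _ r] f(2) by simp
  have "a i \<mu> = 0" if i: "i \<le> degree f" for i \<mu>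
  proof (rule ccontr)
    assume *: "a i \<mu> \<noteq> 0"
    then have \<mu>: "\<mu> l = 0" by (rule a(4))
    have "b (\<mu>(l := i)) = (\<Sum>j\<le>degree f. if j = i then a i \<mu> else 0)"
      unfolding b_def
    proof (intro sum.cong refl)
      fix j
      have "\<mu>(l := 0) = \<mu>" using \<mu> by auto
      moreover have "a j (\<mu>(l := i - j)) = 0" if "j < i" using a(4)[of j "\<mu>(l := i - j)"] that by fastforce
      ultimately show "shift l j (a j) (\<mu>(l := i)) = (if j = i then a i \<mu> else 0)"
        by (auto simp: shift_def)
    qed
    then show False using b0 * i by simp
  qed
  then have "coeff f i = 0" if "i \<le> degree f" for i using a(3)[of i] that by (simp add: fev_def)
  then show "f = 0" using leading_coeff_0_iff by blast
qed

text \<open>A partial derivative prescribed on polynomials only. On power series its values come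
  from Zorn's lemma and are uncontrolled, which \<open>analytic_derivation\<close> repairs.\<close>

lemma coordinate_derivation:
  assumes ind: "indep k u r" and r: "r > 0" and l: "l < k"
  obtains D where "derivation D" "\<And>a. a \<in> K \<Longrightarrow> D a = 0" "\<And>j. j < k \<Longrightarrow> D (u j) = (if j = l then 1 else 0)"
proof -
  obtain D where D: "derivation D" "\<And>x. x \<in> vals (u ` ({..<k} - {l})) r \<Longrightarrow> D x = 0" "D (u l) = 1"
    using derivation_of_transc[OF subring_vals indep_transc[OF ind r l]] r by (metis less_imp_le)
  show ?thesis using D K_vals gen_vals by (intro that[of D]) auto
qed

text \<open>The sequence of values is lifted to coefficient arrays, to which \<open>indep\<close>
  applies. Hence a derivative defined by a limit does not depend on the approximating
  sequence.\<close>

lemma Vlim_0: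
  assumes ind: "indep k u r" and r: "r > 0" and Y: "Vlim (u ` {..<k}) r C Y 0"
  shows "V (u ` {..<k}) r (C / 2 ^ L) (Y L)"
proof -
  have r0: "r \<ge> 0" using r by simp
  obtain a0 where a0: "farr k r C a0" "fev k u a0 = Y 0" using V_imp_farr[OF VlimD(1)[OF Y] _ r0] by blast
  have "\<exists>b. farr k r (C / 2 ^ L) b \<and> fev k u b = Y (Suc L) - Y L" for L
    using V_imp_farr[OF VlimD(2)[OF Y, of L] _ r0] by blast
  then obtain b where b: "\<And>L. farr k r (C / 2 ^ L) (b L)" "\<And>L. fev k u (b L) = Y (Suc L) - Y L" by metis
  have C: "C \<ge> 0" by (rule farr_nonneg[OF a0(1) r0])
  have bC: "farr k r C (b L)" for L using half_le[OF C, of L 0] by (intro farr_mono[OF b(1)]) simp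
  define A where "A = rec_nat a0 (\<lambda>L a \<mu>. a \<mu> + b L \<mu>)"
  have A0: "A 0 = a0" and AS: "A (Suc L) = (\<lambda>\<mu>. A L \<mu> + b L \<mu>)" for L by (simp_all add: A_def)
  have A: "farr k r C (A L)" for L
    by (induction L) (auto simp: A0 AS a0 intro: farr_add bC r0)
  have fA: "fev k u (A L) = Y L" for L
    by (induction L) (auto simp: A0 AS a0 b(2) fev_add[OF farrD(1)[OF A] farrD(1)[OF bC]])
  have "farr k r (C / 2 ^ L) (A L)"
  proof (rule ind[unfolded indep_def, rule_format])
    show "farr k r C (A L)" for L by (rule A)
    show "farr k r (C / 2 ^ L) (\<lambda>\<mu>. A (Suc L) \<mu> - A L \<mu>)" for L by (simp add: AS b(1))
    show "nrm (fev k u (A L)) \<le> C / 2 ^ L" for L using VlimD(3)[OF Y, of L] by (simp add: fA)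
  qed
  then show ?thesis using V_fev[of k r _ "A L" u] r0 fA by metis
qed

text \<open>\<open>D0\<close> is restricted to polynomial values, where the Cauchy estimate holds,
  extended by continuity to power series in \<open>u\<close>, and only then to the whole field. The
  last extension is arbitrary, but the bound is claimed on power series only.\<close>

lemma analytic_derivation:
  assumes ind: "indep k u r" and r: "r > 0" and l: "l < k" and u: "\<And>i. i < k \<Longrightarrow> nrm (u i) \<le> r"
  obtains D where "derivation D" "\<And>a. a \<in> K \<Longrightarrow> D a = 0" "\<And>j. j < k \<Longrightarrow> D (u j) = (if j = l then 1 else 0)"
    "\<And>C x. Vb (u ` {..<k}) r C x \<Longrightarrow> nrm (D x) \<le> C / r"
proof -
  let ?U = "u ` {..<k}"
  obtain D0 where D0: "derivation D0" "\<And>a. a \<in> K \<Longrightarrow> D0 a = 0" "\<And>j. j < k \<Longrightarrow> D0 (u j) = (if j = l then 1 else 0)"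
    using coordinate_derivation[OF ind r l] by metis
  have U: "nrm g \<le> r" if "g \<in> ?U" for g using that u by auto
  have bd: "nrm (D0 x) \<le> C / r" if "V ?U r C x" for C x
    by (rule V_derivation[OF that D0(1,2) _ U r]) (use D0(3) in auto)
  have r0: "r \<ge> 0" using r by simp
  \<comment> \<open>Graph of the continuous extension: limits \<open>x\<close> paired with the
    limits \<open>d\<close> of the derivatives of their approximants.\<close>
  define G where "G = {(x, d). \<exists>C X. Vlim ?U r C X x \<and> (\<forall>L. nrm (d - D0 (X L)) \<le> C / r / 2 ^ L)}"
  have GI: "(x, d) \<in> G" if "Vlim ?U r C X x" "\<And>L. nrm (d - D0 (X L)) \<le> C / r / 2 ^ L" for x d C X
    using that by (auto simp: G_def)
  have GV: "(x, D0 x) \<in> G" if "V ?U r C x" for C x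
    using V_nonneg[OF that r0] r by (intro GI[OF Vlim_V[OF that r0]]) auto
  have two: "\<exists>C X Y. Vlim ?U r C X x \<and> (\<forall>L. nrm (d - D0 (X L)) \<le> C / r / 2 ^ L) \<and>
      Vlim ?U r C Y y \<and> (\<forall>L. nrm (e - D0 (Y L)) \<le> C / r / 2 ^ L)" if xy: "(x, d) \<in> G" "(y, e) \<in> G" for x d y e
  proof -
    from xy obtain C X C' Y where X: "Vlim ?U r C X x" "\<And>L. nrm (d - D0 (X L)) \<le> C / r / 2 ^ L"
      and Y: "Vlim ?U r C' Y y" "\<And>L. nrm (e - D0 (Y L)) \<le> C' / r / 2 ^ L" unfolding G_def by blast
    have *: "C / r / 2 ^ L \<le> max C C' / r / 2 ^ L" "C' / r / 2 ^ L \<le> max C C' / r / 2 ^ L" for L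
      using r by (auto intro!: divide_right_mono)
    show ?thesis
      using Vlim_mono[OF X(1), of "max C C'"] Vlim_mono[OF Y(1), of "max C C'"]
        order_trans[OF X(2) *(1)] order_trans[OF Y(2) *(2)] by (metis max.cobounded1 max.cobounded2)
  qed
  have "der_graph G"
  proof (rule der_graphI)
    show "(1, 0) \<in> G" using GV[OF V_1[OF order_refl]] derivation_1[OF D0(1)] by simp
    show "a = b" if xab: "(x, a) \<in> G" "(x, b) \<in> G" for x a b
    proof -
      obtain C X Y where X: "Vlim ?U r C X x" "\<And>L. nrm (a - D0 (X L)) \<le> C / r / 2 ^ L"
        and Y: "Vlim ?U r C Y x" "\<And>L. nrm (b - D0 (Y L)) \<le> C / r / 2 ^ L" using two[OF xab] by blast
      have "Vlim ?U r C (\<lambda>L. X L - Y L) 0" using Vlim_diff[OF X(1) Y(1)] by simp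
      from bd[OF Vlim_0[OF ind r this]] have Z: "nrm (D0 (X L) - D0 (Y L)) \<le> C / 2 ^ L / r" for L
        by (simp add: derivation_diff[OF D0(1)])
      have "nrm (a - b) \<le> C / r / 2 ^ L" for L
      proof -
        have "nrm (D0 (X L) - D0 (Y L)) \<le> C / r / 2 ^ L" using Z[of L] by (simp add: mult.commute)
        from nrm_add_le[OF nrm_diff_le[OF X(2) Y(2)] this]
        have "nrm ((a - D0 (X L)) - (b - D0 (Y L)) + (D0 (X L) - D0 (Y L))) \<le> C / r / 2 ^ L" .
        then show ?thesis by simp
      qed
      then have "a - b = 0" by (rule nrm_small_eq_0)
      then show ?thesis by simp
    qed
    fix x d y e assume xy: "(x, d) \<in> G" "(y, e) \<in> G"
    obtain C X Y where X: "Vlim ?U r C X x" "\<And>L. nrm (d - D0 (X L)) \<le> C / r / 2 ^ L"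
      and Y: "Vlim ?U r C Y y" "\<And>L. nrm (e - D0 (Y L)) \<le> C / r / 2 ^ L" using two[OF xy] by blast
    have C: "C \<ge> 0" by (rule Vlim_nonneg[OF X(1)])
    show "(x - y, d - e) \<in> G"
    proof (rule GI[OF Vlim_diff[OF X(1) Y(1)]])
      fix L
      have "nrm ((d - D0 (X L)) - (e - D0 (Y L))) \<le> C / r / 2 ^ L" using X(2) Y(2) by (rule nrm_diff_le)
      then show "nrm (d - e - D0 (X L - Y L)) \<le> C / r / 2 ^ L" by (simp add: derivation_diff[OF D0(1)] algebra_simps)
    qed
    show "(x * y, d * y + x * e) \<in> G"
    proof (rule GI[OF Vlim_mult[OF X(1) Y(1) U r0]])
      fix L
      have xb: "nrm x \<le> C" "nrm y \<le> C" using Vb_nrm[OF _ U r0] X Y unfolding Vb_def by blast+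
      have m: "nrm (p * q) \<le> C * C / r / 2 ^ L" if "nrm p \<le> C / r / 2 ^ L" "nrm q \<le> C" for p q
      proof -
        have "nrm p * nrm q \<le> (C / r / 2 ^ L) * C" using that C r by (intro mult_mono) auto
        then show ?thesis by (simp add: nrm_mult mult.commute)
      qed
      have m': "nrm (p * q) \<le> C * C / r / 2 ^ L" if "nrm p \<le> C / r" "nrm q \<le> C / 2 ^ L" for p q
      proof -
        have "nrm p * nrm q \<le> (C / r) * (C / 2 ^ L)" using that C r by (intro mult_mono) auto
        then show ?thesis by (simp add: nrm_mult)
      qed
      have "nrm ((d - D0 (X L)) * y + D0 (X L) * (y - Y L) + ((e - D0 (Y L)) * x + D0 (Y L) * (x - X L)))
        \<le> C * C / r / 2 ^ L"
        using X(2) Y(2) xb bd[OF VlimD(1)[OF X(1)]] bd[OF VlimD(1)[OF Y(1)]] VlimD(3)[OF X(1)] VlimD(3)[OF Y(1)]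
        by (intro nrm_add_le m m') auto
      then show "nrm (d * y + x * e - D0 (X L * Y L)) \<le> C * C / r / 2 ^ L"
        by (simp add: derivation_mult[OF D0(1)] algebra_simps)
    qed
  qed
  then obtain D where D: "derivation D" "\<And>x a. (x, a) \<in> G \<Longrightarrow> D x = a"
    using derivation_extends[of G] by blast
  show ?thesis
  proof (rule that[OF D(1)])
    show "D a = 0" if "a \<in> K" for a using D(2)[OF GV[OF V.const[OF that order_refl]]] D0(2)[OF that] by simp
    show "D (u j) = (if j = l then 1 else 0)" if "j < k" for j
      using D(2)[OF GV[OF V_gens]] D0(3)[OF that] that by simp
    show "nrm (D x) \<le> C / r" if "Vb ?U r C x" for C x
    proof -
      from that obtain X where X: "Vlim ?U r C X x" by (auto simp: Vb_def)
      have "nrm (D0 (X (Suc L)) - D0 (X L)) \<le> C / r / 2 ^ L" for L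
        using bd[OF VlimD(2)[OF X, of L]] by (simp add: derivation_diff[OF D0(1)] mult.commute)
      from complete[OF this] obtain d where d: "\<And>L. nrm (d - D0 (X L)) \<le> C / r / 2 ^ L" by blast
      have "D x = d" by (rule D(2)[OF GI[OF X d]])
      moreover have "nrm (d - D0 (X 0) + D0 (X 0)) \<le> C / r"
        using d[of 0] bd[OF VlimD(1)[OF X, of 0]] by (intro nrm_add_le) auto
      ultimately show ?thesis by simp
    qed
  qed
qed

section \<open>Termwise differentiation of exponential series\<close>

lemma nrm_fact: "nrm (fact n) = 1" using nrm_of_nat[of "fact n"] by simp

lemma fact_K: "fact n \<in> K" using subring_of_nat[OF K_ring, of "fact n"] by simp

definition expsum :: "'a \<Rightarrow> 'a \<Rightarrow> nat \<Rightarrow> 'a" where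
  "expsum w y n = (\<Sum>j<n. (w * y) ^ j / fact j)"

text \<open>\<open>D\<close> need not be continuous on the field, but it is bounded on power series
  in \<open>Z\<close>. The tail \<open>E - expsum w y m\<close> is such a series of size
  \<open>R ^ m\<close>, so its derivative tends to 0, while the partial sums satisfy the equation up
  to a shift of one index.\<close>

lemma exp_derivation:
  assumes R: "0 < R" "R < 1" and \<theta>: "0 \<le> \<theta>" "\<theta> \<le> R" and y: "y \<in> Z"
    and w: "w \<in> K" "nrm w \<le> 1" and E: "\<And>n. nrm (E - expsum w y n) \<le> \<theta> ^ n"
    and D: "derivation D" "\<And>a. a \<in> K \<Longrightarrow> D a = 0" and bd: "\<And>C x. Vb Z R C x \<Longrightarrow> nrm (D x) \<le> B * C"
  shows "D E = w * E * D y"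
proof -
  have tV: "V Z R (R ^ j) ((w * y) ^ j / fact j)" for j
  proof -
    have "nrm (w ^ j * inverse (fact j)) * R ^ j \<le> 1 * R ^ j"
      using w R by (intro mult_right_mono) (auto simp: nrm_mult nrm_power nrm_inverse nrm_fact power_le_one)
    then have "V Z R (R ^ j) ((w ^ j * inverse (fact j)) * y ^ j)"
      using R w by (intro V_scale[OF V_power[OF V_gens[OF y]]] subring_mult[OF K_ring] subring_power[OF K_ring] K_inverse fact_K) auto
    then show ?thesis by (simp add: field_simps power_mult_distrib)
  qed
  have seg: "V Z R (R ^ m) (expsum w y (m + i) - expsum w y m)" for m i
  proof (induction i)
    case (Suc i)
    have "V Z R (R ^ m) ((w * y) ^ (m + i) / fact (m + i))"
      using R by (intro V_mono[OF tV] power_decreasing) auto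
    from V.add[OF Suc this] show ?case by (simp add: expsum_def algebra_simps)
  qed (use R in \<open>auto intro: V_0\<close>)
  \<comment> \<open>Blocks of \<open>N\<close> terms turn the geometric rate \<open>R\<close> into
    the dyadic rate of \<open>Vlim\<close>.\<close>
  obtain N where N: "R ^ N < 1 / 2" using real_arch_pow_inv[of "1/2" R] R by auto
  have "Vb Z R (R ^ m) (E - expsum w y m)" for m
    unfolding Vb_def Vlim_def
  proof (intro exI[of _ "\<lambda>L. expsum w y (m + N * L) - expsum w y m"] allI conjI)
    fix L
    have pw: "R ^ (m + N * L) \<le> R ^ m / 2 ^ L"
    proof -
      have "(R ^ N) ^ L \<le> (1 / 2) ^ L" using N R by (intro power_mono) auto
      then have "R ^ m * (R ^ N) ^ L \<le> R ^ m * (1 / 2) ^ L" using R by (intro mult_left_mono) auto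
      then show ?thesis by (simp add: power_add power_mult power_one_over)
    qed
    show "V Z R (R ^ m) (expsum w y (m + N * L) - expsum w y m)" by (rule seg)
    have "V Z R (R ^ m / 2 ^ L) (expsum w y ((m + N * L) + N) - expsum w y (m + N * L))"
      by (rule V_mono[OF seg pw])
    then show "V Z R (R ^ m / 2 ^ L) (expsum w y (m + N * Suc L) - expsum w y m - (expsum w y (m + N * L) - expsum w y m))"
      by (simp add: algebra_simps)
    have "nrm (E - expsum w y (m + N * L)) \<le> R ^ (m + N * L)"
      by (rule order_trans[OF E]) (use \<theta> in \<open>intro power_mono; simp\<close>)
    then show "nrm (E - expsum w y m - (expsum w y (m + N * L) - expsum w y m)) \<le> R ^ m / 2 ^ L"
      using pw by simp
  qed
  then have 1: "nrm (D (E - expsum w y m)) \<le> B * R ^ m" for m by (rule bd)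
  have wy: "D (w * y) = w * D y" using D w by (simp add: derivation_mult[OF D(1)])
  have De: "D (expsum w y (Suc m)) = w * D y * expsum w y m" for m
  proof (induction m)
    case 0
    show ?case by (simp add: expsum_def derivation_1[OF D(1)])
  next
    case (Suc m)
    have "D ((w * y) ^ Suc m) = of_nat (Suc m) * (w * y) ^ m * (w * D y)"
      using derivation_power[OF D(1), of "w * y" "Suc m"] wy by simp
    then have "D (inverse (fact (Suc m)) * (w * y) ^ Suc m) = inverse (fact (Suc m)) * (of_nat (Suc m) * (w * y) ^ m * (w * D y))"
      using D(2)[OF K_inverse[OF fact_K[of "Suc m"]]] derivation_mult[OF D(1), of "inverse (fact (Suc m))" "(w * y) ^ Suc m"]
      by (simp only: mult_zero_left add_0)
    also have "\<dots> = w * D y * ((w * y) ^ m / fact m)"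
      by (simp add: divide_simps del: of_nat_Suc)
    finally have "D ((w * y) ^ Suc m / fact (Suc m)) = w * D y * ((w * y) ^ m / fact m)"
      by (simp add: divide_inverse mult.commute)
    moreover have "expsum w y (Suc (Suc m)) = expsum w y (Suc m) + (w * y) ^ Suc m / fact (Suc m)"
      unfolding expsum_def by (rule sum.lessThan_Suc)
    ultimately show ?case using Suc
      by (simp add: derivation_add[OF D(1)] expsum_def distrib_left)
  qed
  have "nrm (D E - w * E * D y) \<le> max B (nrm (D y)) * R ^ m" for m
  proof -
    have "nrm (D (E - expsum w y (Suc m))) \<le> max B (nrm (D y)) * R ^ m"
    proof -
      have "B * 1 \<ge> 0" using order_trans[OF nrm_ge_0 1[of 0]] by simp
      then have "B * R ^ Suc m \<le> max B (nrm (D y)) * R ^ m"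
        using R by (intro mult_mono power_decreasing) (auto intro: power_le_one)
      then show ?thesis using 1[of "Suc m"] by linarith
    qed
    moreover have "nrm (w * D y * (E - expsum w y m)) \<le> max B (nrm (D y)) * R ^ m"
    proof -
      have "nrm (E - expsum w y m) \<le> R ^ m" by (rule order_trans[OF E]) (use \<theta> in \<open>intro power_mono; simp\<close>)
      moreover have "nrm w * nrm (D y) \<le> 1 * max B (nrm (D y))" using w by (intro mult_mono) auto
      moreover have "max B (nrm (D y)) \<ge> 0" using nrm_ge_0[of "D y"] by linarith
      ultimately show ?thesis unfolding nrm_mult using R by (intro mult_mono) auto
    qed
    ultimately have "nrm (D (E - expsum w y (Suc m)) - w * D y * (E - expsum w y m)) \<le> max B (nrm (D y)) * R ^ m"
      by (rule nrm_diff_le)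
    moreover have "D (E - expsum w y (Suc m)) - w * D y * (E - expsum w y m) = D E - w * E * D y"
      by (simp add: derivation_diff[OF D(1)] De algebra_simps)
    ultimately show ?thesis by simp
  qed
  then have lim: "nrm (D E - w * E * D y) \<le> max B (nrm (D y)) * R ^ m" for m .
  have "(\<lambda>m. max B (nrm (D y)) * R ^ m) \<longlonglongrightarrow> max B (nrm (D y)) * 0"
    using R by (intro tendsto_mult_left LIMSEQ_realpow_zero) auto
  then have "nrm (D E - w * E * D y) \<le> max B (nrm (D y)) * 0" by (rule LIMSEQ_le_const) (use lim in auto)
  then have "nrm (D E - w * E * D y) = 0" using nrm_ge_0[of "D E - w * E * D y"] by linarith
  then show ?thesis by (simp only: nrm_eq_0_iff right_minus_eq)
qed

end

section \<open>Siegel's lemma and algebraic relations\<close>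

definition Box :: "nat \<Rightarrow> nat \<Rightarrow> (nat \<Rightarrow> nat) set" where "Box k d = {\<mu> \<in> Mon k. \<forall>i<k. \<mu> i < d}"

lemma Box_Suc: "Box (Suc k) d = (\<lambda>(\<mu>, j). \<mu>(k := j)) ` (Box k d \<times> {..<d})"
proof (intro equalityI subsetI)
  fix \<mu> assume "\<mu> \<in> Box (Suc k) d"
  then have "\<mu>(k := 0) \<in> Box k d" "\<mu> k < d" by (auto simp: Box_def Mon_def)
  then show "\<mu> \<in> (\<lambda>(\<mu>, j). \<mu>(k := j)) ` (Box k d \<times> {..<d})"
    by (intro image_eqI[of _ _ "(\<mu>(k := 0), \<mu> k)"]) auto
qed (auto simp: Box_def Mon_def)

lemma inj_Box: "inj_on (\<lambda>(\<mu>::nat \<Rightarrow> nat, j). \<mu>(k := j)) (Mon k \<times> A)"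
proof (rule inj_onI, clarify)
  fix \<mu> \<nu> :: "nat \<Rightarrow> nat" and i j assume a: "\<mu> \<in> Mon k" "\<nu> \<in> Mon k" and eq: "\<mu>(k := i) = \<nu>(k := j)"
  have "\<mu> x = \<nu> x" for x using a fun_cong[OF eq, of x] by (cases "x = k") (auto simp: Mon_def)
  moreover have "i = j" using fun_cong[OF eq, of k] by simp
  ultimately show "\<mu> = \<nu> \<and> i = j" by auto
qed

lemma card_Box: "finite (Box k d) \<and> card (Box k d) = d ^ k"
proof (induction k)
  case 0
  have "Box 0 d = {\<lambda>_. 0}" by (auto simp: Box_def Mon_def)
  then show ?case by simp
next
  case (Suc k)
  have "inj_on (\<lambda>(\<mu>::nat \<Rightarrow> nat, j). \<mu>(k := j)) (Box k d \<times> {..<d})"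
    by (rule inj_on_subset[OF inj_Box[of k UNIV]]) (auto simp: Box_def)
  then show ?case unfolding Box_Suc using Suc by (auto simp: card_image)
qed

lemma mdeg_Suc: "mdeg (Suc k) \<mu> = mdeg k \<mu> + \<mu> k" by (simp add: mdeg_def)

lemma mdeg_Box: "\<mu> \<in> Box k d \<Longrightarrow> mdeg k \<mu> \<le> k * d"
  unfolding mdeg_def by (rule order_trans[OF sum_bounded_above[where K = d]]) (auto simp: Box_def)

text \<open>The left side has degree \<open>k + 1\<close> in \<open>d\<close>, the right side
  \<open>k + 2\<close>: about \<open>d ^ k\<close> conditions of height proportional to
  \<open>d\<close> stand against \<open>d ^ Suc k\<close> unknowns of height
  \<open>d\<close>.\<close>

lemma polynomial_growth:
  fixes A A' :: real and B k :: nat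
  assumes "A \<ge> 0" "A' \<ge> 0"
  obtains d :: nat where "d > 0" "2 * (B * (A * d) ^ k) * (A' * d) < real d * real d ^ Suc k"
proof -
  define d where "d = Suc (nat \<lceil>2 * B * A ^ k * A'\<rceil>)"
  have d: "real d > 2 * B * A ^ k * A'" unfolding d_def by linarith
  have "2 * (B * (A * d) ^ k) * (A' * d) = (2 * B * A ^ k * A') * real d ^ Suc k"
    by (simp add: power_mult_distrib algebra_simps)
  also have "\<dots> < real d * real d ^ Suc k" using d by (intro mult_strict_right_mono) (auto simp: d_def)
  finally show ?thesis using that[of d] by (simp add: d_def)
qed

text \<open>\<open>Z\<close> plays the role of the integers and \<open>p\<close> that of the prime,
  with norm \<open>exp 1\<close> so that logarithms of norms are exponents of \<open>p\<close>.
  Siegel's lemma is assumed on that logarithmic scale: \<open>h\<close> and \<open>c\<close> bound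
  unknowns and coefficients, \<open>B\<close> is the smallness gained, and the factor 2 accounts for
  real and imaginary parts. The index sets consist of multi-indices because a locale fixes their
  type.\<close>

locale arith_valued = valued nrm K for nrm :: "'a::field_char_0 \<Rightarrow> real" and K +
  fixes Z :: "'a set" and p :: 'a
  assumes Z_ring: "subring Z" and Z_discrete: "x \<in> Z \<Longrightarrow> x \<noteq> 0 \<Longrightarrow> nrm x \<ge> 1"
    and p: "p \<in> Z" "nrm p = exp 1"
    and siegel: "\<And>(I :: (nat \<Rightarrow> nat) set) (J :: (nat \<Rightarrow> nat) set) ell h B c.
       finite I \<Longrightarrow> finite J \<Longrightarrow> (\<And>i j. i \<in> I \<Longrightarrow> j \<in> J \<Longrightarrow> ell j i \<in> K \<and> nrm (ell j i) \<le> exp c) \<Longrightarrow>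
       0 \<le> h \<Longrightarrow> 0 \<le> B \<Longrightarrow> 0 \<le> c \<Longrightarrow> 2 * real (card J) * (h + c + B) < h * real (card I) \<Longrightarrow>
       \<exists>x. (\<forall>i\<in>I. x i \<in> K \<and> x i \<in> Z \<and> nrm (x i) \<le> exp h) \<and> (\<exists>i\<in>I. x i \<noteq> 0) \<and>
         (\<forall>j\<in>J. nrm (\<Sum>i\<in>I. x i * ell j i) \<le> exp (- B))"
begin

text \<open>The auxiliary polynomial method. A polynomial in \<open>u\<close> and \<open>w\<close>
  of degree below \<open>d\<close> in each variable, with coefficients in \<open>Z\<close>, becomes
  integral after multiplication by \<open>p ^ (Suc k * d)\<close>, so it vanishes once its norm is
  below \<open>exp (- (k + 1) * d)\<close>. By \<open>rep\<close> its value is a combination of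
  \<open>B\<close> power series in the \<open>k\<close> coordinates; Siegel's lemma makes their
  coefficients of degree below \<open>J\<close> small, and the higher terms gain
  \<open>(\<theta> / \<rho>) ^ J\<close>. The conditions number at most \<open>B * J ^ k\<close>,
  with \<open>J\<close> proportional to \<open>d\<close>.\<close>

lemma algebraic_relation:
  fixes B :: nat
  assumes \<theta>: "0 < \<theta>" "\<theta> < \<rho>" "\<rho> \<le> 1" and u: "\<And>i. i < k \<Longrightarrow> nrm (u i) \<le> \<theta>" "\<And>i. i < k \<Longrightarrow> p * u i \<in> Z"
    and w: "nrm w \<le> 1" "p * w \<in> Z"
    and rep: "\<And>j. \<exists>g. (\<forall>b<B. Vb (u ` {..<k}) \<rho> C0 (g b)) \<and> w ^ j = (\<Sum>b<B. g b * t b)"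
  shows "\<exists>d x. (\<forall>\<mu>\<in>Box (Suc k) d. x \<mu> \<in> K) \<and> (\<exists>\<mu>\<in>Box (Suc k) d. x \<mu> \<noteq> 0) \<and>
    (\<Sum>\<mu>\<in>Box (Suc k) d. x \<mu> * (mon k u \<mu> * w ^ \<mu> k)) = 0"
proof -
  let ?U = "u ` {..<k}"
  have \<rho>0: "\<rho> > 0" using \<theta> by simp
  have U\<theta>: "nrm g \<le> \<theta>" if "g \<in> ?U" for g using that u by auto
  then have U: "nrm g \<le> \<rho>" if "g \<in> ?U" for g using that \<theta> by fastforce
  define C where "C = max 1 C0"
  obtain g where g: "\<And>j b. b < B \<Longrightarrow> Vb ?U \<rho> C (g j b)" "\<And>j. w ^ j = (\<Sum>b<B. g j b * t b)"
  proof -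
    obtain g where "\<And>j. (\<forall>b<B. Vb ?U \<rho> C0 (g j b)) \<and> w ^ j = (\<Sum>b<B. g j b * t b)" using rep by metis
    then show ?thesis using that[of g] Vb_mono[of ?U \<rho> C0 _ C] by (simp add: C_def)
  qed
  define T where "T = 1 + (\<Sum>b<B. nrm (t b))"
  have T: "nrm (t b) \<le> T" if "b < B" for b
  proof -
    have "nrm (t b) \<le> (\<Sum>b<B. nrm (t b))" using that by (intro member_le_sum) auto
    then show ?thesis by (simp add: T_def)
  qed
  have T1: "T \<ge> 1" by (simp add: T_def sum_nonneg)
  \<comment> \<open>Logarithmic sizes: \<open>a0\<close> of the power series, \<tau> of the
    generators \<open>t\<close>; \<open>q\<close> is the gain per degree from radius \<rho> to
    \<theta>, and \<open>e\<close> the loss per degree in bounding coefficients.\<close>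
  define a0 \<tau> q e where "a0 = ln C" and "\<tau> = ln T" and "q = ln (\<rho> / \<theta>)" and "e = ln (1 / \<rho>)"
  have pos: "a0 \<ge> 0" "\<tau> \<ge> 0" "q > 0" "e \<ge> 0" using \<theta> \<rho>0 T1 by (auto simp: a0_def C_def \<tau>_def q_def e_def)
  have ex: "exp a0 = C" "exp \<tau> = T" "exp q = \<rho> / \<theta>" "exp e = 1 / \<rho>"
    using \<theta> \<rho>0 T1 by (auto simp: a0_def C_def \<tau>_def q_def e_def max_def)
  \<comment> \<open>\<open>A\<close> and \<open>A'\<close> are chosen to give
    \<open>J \<le> A * d\<close> and \<open>d + c + B1 \<le> A' * d\<close> below.\<close>
  define A where "A = (real k + 2 + \<tau> + a0 + 1) / q + 1"
  define A' where "A' = 1 + a0 + A * e + (real k + 1) + \<tau> + 1"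
  have A: "A \<ge> 0" "A' \<ge> 0" using pos by (auto simp: A_def A'_def)
  obtain d :: nat where d: "d > 0" and growth: "2 * (B * (A * d) ^ k) * (A' * d) < real d * real d ^ Suc k"
    using polynomial_growth[OF A] by metis
  \<comment> \<open>Truncation degree from which the tail, multiplied by the sizes of unknowns,
    series and generators, stays below the final threshold \<epsilon>.\<close>
  define J where "J = nat \<lceil>((real k + 2) * d + \<tau> + a0 + 1) / q\<rceil>"
  have J1: "J * q \<ge> (real k + 2) * d + \<tau> + a0 + 1"
  proof -
    have "real J \<ge> ((real k + 2) * d + \<tau> + a0 + 1) / q" unfolding J_def by linarith
    then show ?thesis using pos by (simp add: field_simps)
  qed
  have J2: "real J \<le> A * d"
  proof -
    have "((real k + 2) * d + \<tau> + a0 + 1) / q \<le> ((real k + 2) * d + \<tau> * d + a0 * d + 1 * d) / q"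
      using pos d by (intro divide_right_mono add_mono mult_le_cancel_left1[THEN iffD2]) (auto simp: mult_le_cancel_left1)
    also have "\<dots> = (A - 1) * d" using pos by (simp add: A_def field_simps)
    finally have *: "((real k + 2) * d + \<tau> + a0 + 1) / q \<le> (A - 1) * d" .
    have "((real k + 2) * d + \<tau> + a0 + 1) / q \<ge> 0" using pos by auto
    then have "real J \<le> ((real k + 2) * d + \<tau> + a0 + 1) / q + 1" unfolding J_def by linarith
    also have "\<dots> \<le> (A - 1) * d + real d" using * d by (intro add_mono) auto
    finally show ?thesis by (simp add: algebra_simps)
  qed
  define c where "c = a0 + J * e"
  define B1 where "B1 = (real k + 1) * d + \<tau> + 1"
  have cB: "c \<ge> 0" "B1 \<ge> 0" using pos by (auto simp: c_def B1_def)
  have cB': "real d + c + B1 \<le> A' * d"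
  proof -
    have "J * e \<le> A * d * e" using J2 pos by (intro mult_right_mono) auto
    moreover have "a0 \<le> a0 * d" "\<tau> \<le> \<tau> * d" "1 \<le> real d" using pos d by (auto simp: mult_le_cancel_left1)
    ultimately show ?thesis by (simp add: A'_def c_def B1_def algebra_simps)
  qed
  define I where "I = Box (Suc k) d"
  \<comment> \<open>A condition is a pair of a monomial and a generator index \<open>b\<close>,
    coded as one multi-index with \<open>b\<close> in position \<open>k\<close>.\<close>
  define JJ where "JJ = (\<lambda>(\<nu>, b). \<nu>(k := b)) ` (Box k J \<times> {..<B})"
  have I: "finite I" "card I = d ^ Suc k" using card_Box[of "Suc k" d] by (auto simp: I_def)
  have JJ: "finite JJ" "card JJ \<le> J ^ k * B"
  proof -
    show "finite JJ" using card_Box[of k J] by (auto simp: JJ_def)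
    have "card JJ \<le> card (Box k J \<times> {..<B})" unfolding JJ_def using card_Box[of k J] by (intro card_image_le) auto
    then show "card JJ \<le> J ^ k * B" using card_Box[of k J] by simp
  qed
  \<comment> \<open>Error allowed when each power series is replaced by a polynomial, whose
    coefficients then lie in \<open>K\<close>.\<close>
  define \<eta> where "\<eta> = exp (- ((real k + 2) * d + \<tau> + 1))"
  have approx: "\<exists>a. farr k \<rho> C a \<and> nrm (mon k u \<mu> * g j b - fev k u a) \<le> \<eta>" if "b < B" for \<mu> j b
  proof -
    have "Vb ?U \<rho> C (mon k u \<mu> * g j b)"
    proof (rule Vb_mult[OF Vb_V[OF V_mon] g(1)[OF that] _ U])
      show "\<rho> ^ mdeg k \<mu> * C \<le> C" using \<theta> \<rho>0 by (simp add: C_def power_le_one mult_left_le_one_le)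
    qed (use \<rho>0 in \<open>auto intro: V_gens\<close>)
    then obtain X where X: "Vlim ?U \<rho> C X (mon k u \<mu> * g j b)" by (auto simp: Vb_def)
    have "\<eta> / C > 0" by (simp add: \<eta>_def C_def)
    then obtain L where "(1/2::real) ^ L < \<eta> / C" using real_arch_pow_inv[of "\<eta> / C" "1/2"] by auto
    then have L: "C / 2 ^ L \<le> \<eta>" by (simp add: C_def power_one_over field_simps)
    obtain a where "farr k \<rho> C a" "fev k u a = X L" using V_imp_farr[OF VlimD(1)[OF X]] \<rho>0 by (metis less_imp_le order_refl)
    then show ?thesis using order_trans[OF VlimD(3)[OF X] L] by metis
  qed
  define a where "a = (\<lambda>\<mu> j b. SOME a. farr k \<rho> C a \<and> nrm (mon k u \<mu> * g j b - fev k u a) \<le> \<eta>)"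
  have a: "farr k \<rho> C (a \<mu> j b)" "nrm (mon k u \<mu> * g j b - fev k u (a \<mu> j b)) \<le> \<eta>" if "b < B" for \<mu> j b
    using someI_ex[OF approx[OF that, of \<mu> j]] unfolding a_def by blast+
  define ell where "ell = (\<lambda>\<nu> \<mu>. a \<mu> (\<mu> k) (\<nu> k) (\<nu>(k := 0)))"
  have JJ_D: "\<nu> k < B" "\<nu>(k := 0) \<in> Box k J" if \<nu>: "\<nu> \<in> JJ" for \<nu>
  proof -
    obtain \<nu>' b where \<nu>': "\<nu>' \<in> Box k J" "b < B" "\<nu> = \<nu>'(k := b)" using \<nu> by (auto simp: JJ_def)
    have "\<nu>' k = 0" using \<nu>'(1) by (simp add: Box_def Mon_def)
    then have "\<nu>(k := 0) = \<nu>'" using \<nu>'(3) by auto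
    then show "\<nu> k < B" "\<nu>(k := 0) \<in> Box k J" using \<nu>' by auto
  qed
  have low_deg: "\<nu> i < J" if "\<nu> \<in> Mon k" "mdeg k \<nu> < J" "i < k" for \<nu> i
  proof -
    have "\<nu> i \<le> mdeg k \<nu>" unfolding mdeg_def using that by (intro member_le_sum) auto
    then show ?thesis using that by simp
  qed
  \<comment> \<open>Total degree below \<open>J\<close>, as the coefficient bound
    \<open>exp c\<close> requires.\<close>
  define JJ' where "JJ' = {\<nu> \<in> JJ. mdeg k \<nu> < J}"
  have JJ'_sub: "JJ' \<subseteq> JJ" "finite JJ'" using JJ by (auto simp: JJ'_def)
  have cardJJ': "real (card JJ') \<le> B * (A * d) ^ k"
  proof -
    have "card JJ' \<le> J ^ k * B" using card_mono[OF JJ(1) JJ'_sub(1)] JJ(2) by simp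
    then have "real (card JJ') \<le> real (J ^ k * B)" by (rule of_nat_mono)
    also have "\<dots> = B * real J ^ k" by simp
    also have "\<dots> \<le> B * (A * d) ^ k" using J2 by (intro mult_left_mono power_mono) auto
    finally show ?thesis .
  qed
  have "\<exists>x. (\<forall>i\<in>I. x i \<in> K \<and> x i \<in> Z \<and> nrm (x i) \<le> exp (real d)) \<and> (\<exists>i\<in>I. x i \<noteq> 0) \<and>
         (\<forall>j\<in>JJ'. nrm (\<Sum>i\<in>I. x i * ell j i) \<le> exp (- B1))"
    proof (rule siegel[OF I(1) JJ'_sub(2)])
      show "ell j i \<in> K \<and> nrm (ell j i) \<le> exp c" if "i \<in> I" "j \<in> JJ'" for i j
      proof -
        have jJ: "j \<in> JJ" "mdeg k j < J" using that(2) by (auto simp: JJ'_def)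
        define \<nu> where "\<nu> = j(k := 0)"
        note b = JJ_D(1)[OF jJ(1)]
        have "mdeg k \<nu> = mdeg k j" by (simp add: mdeg_def \<nu>_def)
        then have deg: "mdeg k \<nu> < J" using jJ by simp
        note fa = farrD[OF a(1)[OF b, of i "i k"]]
        have "\<rho> ^ J \<le> \<rho> ^ mdeg k \<nu>" using deg \<theta> \<rho>0 by (intro power_decreasing) auto
        then have "nrm (ell j i) * \<rho> ^ J \<le> C"
          using fa(4)[of \<nu>] mult_left_mono[of "\<rho> ^ J" "\<rho> ^ mdeg k \<nu>" "nrm (ell j i)"] by (simp add: ell_def \<nu>_def)
        then have "nrm (ell j i) \<le> C * (1 / \<rho>) ^ J" using \<rho>0 by (simp add: power_one_over field_simps)
        also have "\<dots> = exp c" by (simp add: c_def exp_add ex exp_of_nat_mult)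
        finally show ?thesis using fa(3)[of \<nu>] by (simp add: ell_def \<nu>_def)
      qed
      have "2 * real (card JJ') * (real d + c + B1) \<le> 2 * (B * (A * d) ^ k) * (A' * d)"
        using cardJJ' cB cB' A by (intro mult_mono) auto
      also have "\<dots> < real d * real (card I)" using growth I by simp
      finally show "2 * real (card JJ') * (real d + c + B1) < real d * real (card I)" .
    qed (use cB in auto)
  then obtain x where xx: "(\<forall>i\<in>I. x i \<in> K \<and> x i \<in> Z \<and> nrm (x i) \<le> exp (real d)) \<and> (\<exists>i\<in>I. x i \<noteq> 0) \<and>
         (\<forall>j\<in>JJ'. nrm (\<Sum>i\<in>I. x i * ell j i) \<le> exp (- B1))" ..
  have x: "\<And>i. i \<in> I \<Longrightarrow> x i \<in> K \<and> x i \<in> Z \<and> nrm (x i) \<le> exp d" "\<exists>i\<in>I. x i \<noteq> 0"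
    "\<And>j. j \<in> JJ' \<Longrightarrow> nrm (\<Sum>i\<in>I. x i * ell j i) \<le> exp (- B1)"
    using xx by simp_all
  define P where "P = (\<Sum>\<mu>\<in>I. x \<mu> * (mon k u \<mu> * w ^ \<mu> k))"
  define s where "s = (\<lambda>b. \<Sum>\<mu>\<in>I. x \<mu> * fev k u (a \<mu> (\<mu> k) b))"
  define s' where "s' = (\<lambda>b. \<Sum>\<mu>\<in>I. x \<mu> * (mon k u \<mu> * g (\<mu> k) b - fev k u (a \<mu> (\<mu> k) b)))"
  \<comment> \<open>One factor \<open>exp (- 1)\<close> below the size at which integrality permits
    a nonzero value.\<close>
  define \<epsilon> where "\<epsilon> = exp (- ((real k + 1) * d + 1))"
  have P: "P = (\<Sum>b<B. (s b + s' b) * t b)"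
  proof -
    have "P = (\<Sum>\<mu>\<in>I. \<Sum>b<B. x \<mu> * (mon k u \<mu> * g (\<mu> k) b) * t b)"
      unfolding P_def g(2) by (simp add: sum_distrib_left mult.assoc)
    also have "\<dots> = (\<Sum>b<B. \<Sum>\<mu>\<in>I. x \<mu> * (mon k u \<mu> * g (\<mu> k) b) * t b)" by (rule sum.swap)
    also have "\<dots> = (\<Sum>b<B. (s b + s' b) * t b)"
    proof (intro sum.cong refl)
      fix b
      have "s b + s' b = (\<Sum>\<mu>\<in>I. x \<mu> * (mon k u \<mu> * g (\<mu> k) b))"
        unfolding s_def s'_def sum.distrib[symmetric] by (intro sum.cong refl) (simp add: right_diff_distrib)
      then show "(\<Sum>\<mu>\<in>I. x \<mu> * (mon k u \<mu> * g (\<mu> k) b) * t b) = (s b + s' b) * t b"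
        by (simp add: sum_distrib_right)
    qed
    finally show ?thesis .
  qed
  have eT: "exp (- B1) * T \<le> \<epsilon>" "exp d * \<eta> * T \<le> \<epsilon>" "exp d * (C * (\<theta> / \<rho>) ^ J) * T \<le> \<epsilon>"
  proof -
    have "exp (- B1) * T = exp (- B1 + \<tau>)" by (simp only: exp_add ex)
    then show "exp (- B1) * T \<le> \<epsilon>" by (simp add: B1_def \<epsilon>_def)
    have "exp d * \<eta> * T = exp (d + - ((real k + 2) * d + \<tau> + 1) + \<tau>)" by (simp only: exp_add ex \<eta>_def)
    then show "exp d * \<eta> * T \<le> \<epsilon>" by (simp add: \<epsilon>_def algebra_simps)
    have "(\<theta> / \<rho>) = exp (- q)" using \<theta> \<rho>0 by (simp add: exp_minus ex)
    then have "(\<theta> / \<rho>) ^ J = exp (- (J * q))" by (simp flip: exp_of_nat_mult)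
    then have "exp d * (C * (\<theta> / \<rho>) ^ J) * T = exp (d + (a0 + - (J * q)) + \<tau>)" by (simp only: exp_add ex)
    also have "\<dots> \<le> \<epsilon>" using J1 by (simp add: \<epsilon>_def algebra_simps)
    finally show "exp d * (C * (\<theta> / \<rho>) ^ J) * T \<le> \<epsilon>" .
  qed
  have s'b: "nrm (s' b) * T \<le> \<epsilon>" if "b < B" for b
  proof -
    have "nrm (s' b) \<le> exp d * \<eta>"
      unfolding s'_def
    proof (rule nrm_sum_le)
      fix \<mu> assume "\<mu> \<in> I"
      then show "nrm (x \<mu> * (mon k u \<mu> * g (\<mu> k) b - fev k u (a \<mu> (\<mu> k) b))) \<le> exp d * \<eta>"
        unfolding nrm_mult[of "x \<mu>"] using x(1) a(2)[OF that] by (intro mult_mono) auto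
    qed (simp add: \<eta>_def)
    then show ?thesis using eT(2) T1 by (smt (verit) mult_right_mono)
  qed
  have monu: "nrm (mon k u \<nu>) \<le> \<theta> ^ mdeg k \<nu>" for \<nu>
    unfolding mon_def mdeg_def nrm_prod nrm_power power_sum using u \<theta> by (intro prod_mono) (auto intro: power_mono)
  have sb: "nrm (s b) * T \<le> \<epsilon>" if b: "b < B" for b
  proof -
    define S where "S = (\<Union>\<mu>\<in>I. {\<nu>. a \<mu> (\<mu> k) b \<nu> \<noteq> 0})"
    have S: "finite S" "S \<subseteq> Mon k" using farrD(1,2)[OF a(1)[OF b]] I by (auto simp: S_def)
    have "s b = (\<Sum>\<mu>\<in>I. x \<mu> * (\<Sum>\<nu>\<in>S. a \<mu> (\<mu> k) b \<nu> * mon k u \<nu>))"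
      unfolding s_def using S by (intro sum.cong refl arg_cong2[of _ _ _ _ "(*)"] fev_superset) (auto simp: S_def)
    also have "\<dots> = (\<Sum>\<nu>\<in>S. \<Sum>\<mu>\<in>I. x \<mu> * a \<mu> (\<mu> k) b \<nu> * mon k u \<nu>)"
      unfolding sum_distrib_left by (subst sum.swap) (simp add: mult.assoc)
    finally have sS: "s b = (\<Sum>\<nu>\<in>S. (\<Sum>\<mu>\<in>I. x \<mu> * a \<mu> (\<mu> k) b \<nu>) * mon k u \<nu>)" by (simp add: sum_distrib_right)
    have "nrm ((\<Sum>\<mu>\<in>I. x \<mu> * a \<mu> (\<mu> k) b \<nu>) * mon k u \<nu>) * T \<le> \<epsilon>" if \<nu>: "\<nu> \<in> S" for \<nu>
    proof (cases "mdeg k \<nu> < J")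
      case True
      have "\<nu> \<in> Box k J" using S(2) \<nu> low_deg[OF _ True] by (auto simp: Box_def)
      then have "\<nu>(k := b) \<in> JJ" using b by (force simp: JJ_def)
      moreover have "mdeg k (\<nu>(k := b)) = mdeg k \<nu>" by (simp add: mdeg_def)
      ultimately have "\<nu>(k := b) \<in> JJ'" using True by (simp add: JJ'_def)
      from x(3)[OF this] have 1: "nrm (\<Sum>\<mu>\<in>I. x \<mu> * ell (\<nu>(k := b)) \<mu>) \<le> exp (- B1)" .
      have "\<nu> k = 0" using S(2) \<nu> by (auto simp: Mon_def)
      then have "\<nu>(k := 0) = \<nu>" by auto
      then have "ell (\<nu>(k := b)) \<mu> = a \<mu> (\<mu> k) b \<nu>" for \<mu> by (simp add: ell_def)
      then have "nrm (\<Sum>\<mu>\<in>I. x \<mu> * a \<mu> (\<mu> k) b \<nu>) \<le> exp (- B1)" using 1 by simp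
      moreover have "nrm (mon k u \<nu>) \<le> 1" using monu[of \<nu>] \<theta> power_le_one[of \<theta> "mdeg k \<nu>"] by linarith
      ultimately have "nrm ((\<Sum>\<mu>\<in>I. x \<mu> * a \<mu> (\<mu> k) b \<nu>) * mon k u \<nu>) \<le> exp (- B1) * 1"
        unfolding nrm_mult[of "sum _ _"] by (intro mult_mono) auto
      then have "nrm ((\<Sum>\<mu>\<in>I. x \<mu> * a \<mu> (\<mu> k) b \<nu>) * mon k u \<nu>) * T \<le> exp (- B1) * T" using T1 by (intro mult_right_mono) auto
      then show ?thesis using eT(1) by linarith
    next
      case False
      have "nrm (\<Sum>\<mu>\<in>I. x \<mu> * a \<mu> (\<mu> k) b \<nu>) \<le> exp d * (C / \<rho> ^ mdeg k \<nu>)"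
      proof (rule nrm_sum_le)
        fix \<mu> assume \<mu>: "\<mu> \<in> I"
        have "nrm (a \<mu> (\<mu> k) b \<nu>) \<le> C / \<rho> ^ mdeg k \<nu>" using farrD(4)[OF a(1)[OF b], of \<mu> "\<mu> k" \<nu>] \<rho>0 by (simp add: field_simps)
        then show "nrm (x \<mu> * a \<mu> (\<mu> k) b \<nu>) \<le> exp d * (C / \<rho> ^ mdeg k \<nu>)"
          unfolding nrm_mult using x(1)[OF \<mu>] by (intro mult_mono) auto
      qed (use \<rho>0 in \<open>simp add: C_def\<close>)
      then have "nrm ((\<Sum>\<mu>\<in>I. x \<mu> * a \<mu> (\<mu> k) b \<nu>) * mon k u \<nu>) \<le> exp d * (C / \<rho> ^ mdeg k \<nu>) * \<theta> ^ mdeg k \<nu>"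
        unfolding nrm_mult[of "sum _ _"] using monu \<rho>0 by (intro mult_mono) (auto simp: C_def)
      also have "\<dots> = exp d * (C * (\<theta> / \<rho>) ^ mdeg k \<nu>)" by (simp add: power_divide)
      also have "\<dots> \<le> exp d * (C * (\<theta> / \<rho>) ^ J)"
        using False \<theta> \<rho>0 by (intro mult_left_mono power_decreasing) (auto simp: C_def)
      finally have "nrm ((\<Sum>\<mu>\<in>I. x \<mu> * a \<mu> (\<mu> k) b \<nu>) * mon k u \<nu>) * T \<le> exp d * (C * (\<theta> / \<rho>) ^ J) * T"
        using T1 by (intro mult_right_mono) auto
      then show ?thesis using eT(3) by linarith
    qed
    then have "nrm ((\<Sum>\<mu>\<in>I. x \<mu> * a \<mu> (\<mu> k) b \<nu>) * mon k u \<nu>) \<le> \<epsilon> / T" if "\<nu> \<in> S" for \<nu>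
      using that T1 by (simp add: field_simps)
    then have "nrm (s b) \<le> \<epsilon> / T" unfolding sS using T1 by (intro nrm_sum_le) (auto simp: \<epsilon>_def)
    then show ?thesis using T1 by (simp add: field_simps)
  qed
  have Pn: "nrm P \<le> \<epsilon>" unfolding P
  proof (rule nrm_sum_le)
    fix b assume "b \<in> {..<B}"
    then have b: "b < B" by simp
    have "nrm (s b + s' b) \<le> \<epsilon> / T" using sb[OF b] s'b[OF b] T1 by (intro nrm_add_le) (auto simp: field_simps)
    then have "nrm ((s b + s' b) * t b) \<le> \<epsilon> / T * T"
      unfolding nrm_mult using T[OF b] T1 by (intro mult_mono) (auto simp: \<epsilon>_def)
    then show "nrm ((s b + s' b) * t b) \<le> \<epsilon>" using T1 by simp
  qed (simp add: \<epsilon>_def)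
  \<comment> \<open>Each factor \<open>u i\<close> or \<open>w\<close> is paired with one factor
    \<open>p\<close>; the surplus powers of \<open>p\<close> are integral anyway.\<close>
  have "p ^ (Suc k * d) * P \<in> Z"
    unfolding P_def sum_distrib_left
  proof (rule subring_sum[OF Z_ring])
    fix \<mu> assume \<mu>: "\<mu> \<in> I"
    have "mdeg (Suc k) \<mu> \<le> Suc k * d" using \<mu> unfolding I_def by (rule mdeg_Box)
    then have "p ^ (Suc k * d) = p ^ (Suc k * d - mdeg (Suc k) \<mu>) * p ^ mdeg (Suc k) \<mu>"
      by (simp flip: power_add)
    also have "p ^ mdeg (Suc k) \<mu> = (\<Prod>i<k. p ^ \<mu> i) * p ^ \<mu> k"
      by (simp add: mdeg_Suc power_add) (simp add: mdeg_def power_sum)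
    finally have eq: "p ^ (Suc k * d) * (x \<mu> * (mon k u \<mu> * w ^ \<mu> k)) =
      p ^ (Suc k * d - mdeg (Suc k) \<mu>) * x \<mu> * ((\<Prod>i<k. (p * u i) ^ \<mu> i) * (p * w) ^ \<mu> k)"
      by (simp add: mon_def prod.distrib power_mult_distrib algebra_simps)
    have "(\<Prod>i<k. (p * u i) ^ \<mu> i) \<in> Z"
      using u(2) by (intro subring_prod[OF Z_ring] subring_power[OF Z_ring]) auto
    moreover have "(p * w) ^ \<mu> k \<in> Z" by (rule subring_power[OF Z_ring w(2)])
    moreover have "p ^ (Suc k * d - mdeg (Suc k) \<mu>) * x \<mu> \<in> Z"
      using x(1)[OF \<mu>] p by (intro subring_mult[OF Z_ring] subring_power[OF Z_ring]) auto
    ultimately show "p ^ (Suc k * d) * (x \<mu> * (mon k u \<mu> * w ^ \<mu> k)) \<in> Z"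
      unfolding eq using subring_mult[OF Z_ring] by blast
  qed
  moreover have "nrm (p ^ (Suc k * d) * P) < 1"
  proof -
    have "nrm (p ^ (Suc k * d)) = exp (real (Suc k * d))" using p by (simp add: nrm_power flip: exp_of_nat_mult)
    then have "nrm (p ^ (Suc k * d) * P) \<le> exp (real (Suc k * d)) * \<epsilon>"
      unfolding nrm_mult using Pn by (intro mult_mono) auto
    also have "\<dots> = exp (- 1)" by (simp add: \<epsilon>_def flip: exp_add) (simp add: algebra_simps)
    also have "\<dots> < 1" by simp
    finally show ?thesis .
  qed
  ultimately have "p ^ (Suc k * d) * P = 0" using Z_discrete not_less by blast
  moreover have "p \<noteq> 0" using p by auto
  ultimately have "P = 0" by simp
  then show ?thesis using x(1,2) unfolding P_def I_def by blast
qed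

text \<open>The relation has to stay nontrivial as a polynomial in \<open>w\<close>: if all its
  coefficients vanished, a nonzero polynomial in \<open>u\<close> alone would vanish, against
  \<open>indep\<close>.\<close>

lemma algebraic_over_coordinates:
  fixes B :: nat
  assumes ind: "indep k u \<rho>" and \<theta>: "0 < \<theta>" "\<theta> < \<rho>" "\<rho> \<le> 1" and u: "\<And>i. i < k \<Longrightarrow> nrm (u i) \<le> \<theta>" "\<And>i. i < k \<Longrightarrow> p * u i \<in> Z"
    and w: "nrm w \<le> 1" "p * w \<in> Z"
    and rep: "\<And>j. \<exists>g. (\<forall>b<B. Vb (u ` {..<k}) \<rho> C0 (g b)) \<and> w ^ j = (\<Sum>b<B. g b * t b)"
  shows "\<not> transc (vals (u ` {..<k}) \<rho>) w"
proof -
  let ?R = "vals (u ` {..<k}) \<rho>"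
  have \<rho>0: "\<rho> > 0" using \<theta> by simp
  have R: "subring ?R" using \<rho>0 by (intro subring_vals) auto
  obtain d x where x: "\<And>\<mu>. \<mu> \<in> Box (Suc k) d \<Longrightarrow> x \<mu> \<in> K" "\<exists>\<mu>\<in>Box (Suc k) d. x \<mu> \<noteq> 0"
    "(\<Sum>\<mu>\<in>Box (Suc k) d. x \<mu> * (mon k u \<mu> * w ^ \<mu> k)) = 0"
    using algebraic_relation[OF \<theta> u w rep] by blast
  define I where "I = Box (Suc k) d"
  have I: "finite I" "I \<subseteq> Mon (Suc k)" using card_Box by (auto simp: I_def Box_def)
  define f where "f = (\<Sum>\<mu>\<in>I. monom (x \<mu> * mon k u \<mu>) (\<mu> k))"
  have "poly f w = 0" using x(3) by (simp add: f_def poly_sum poly_monom I_def mult.assoc)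
  moreover have "f \<in> polys_over ?R" unfolding f_def
  proof (intro subring_sum[OF subring_polys_over[OF R]] monom_polys_over[OF R] subring_mult[OF R])
    fix \<mu> assume "\<mu> \<in> I"
    then show "x \<mu> \<in> ?R" using x by (intro K_vals) (auto simp: I_def)
    show "mon k u \<mu> \<in> ?R" unfolding mon_def
      by (intro subring_prod[OF R] subring_power[OF R] gen_vals) auto
  qed
  moreover have "f \<noteq> 0"
  proof
    assume f0: "f = 0"
    obtain \<mu>0 where \<mu>0: "\<mu>0 \<in> I" "x \<mu>0 \<noteq> 0" using x(2) by (auto simp: I_def)
    define j where "j = \<mu>0 k"
    define Ij where "Ij = {\<mu> \<in> I. \<mu> k = j}"
    \<comment> \<open>Coefficient array of the part of \<open>w\<close>-degree \<open>j\<close>;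
      position \<open>k\<close> of the multi-index, which held that degree, is reset to 0.\<close>
    define a where "a = (\<lambda>\<nu>. if \<nu> \<in> Mon k \<and> \<nu>(k := j) \<in> I then x (\<nu>(k := j)) else 0)"
    let ?\<phi> = "\<lambda>\<mu>::nat \<Rightarrow> nat. \<mu>(k := 0)"
    have supp: "{\<nu>. a \<nu> \<noteq> 0} \<subseteq> ?\<phi> ` Ij"
    proof
      fix \<nu> assume "\<nu> \<in> {\<nu>. a \<nu> \<noteq> 0}"
      then have \<nu>: "\<nu> \<in> Mon k" "\<nu>(k := j) \<in> I" by (auto simp: a_def split: if_splits)
      then have "\<nu> = ?\<phi> (\<nu>(k := j))" by (auto simp: Mon_def)
      moreover have "\<nu>(k := j) \<in> Ij" using \<nu> by (simp add: Ij_def)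
      ultimately show "\<nu> \<in> ?\<phi> ` Ij" by blast
    qed
    have Mon\<phi>: "?\<phi> \<mu> \<in> Mon k" if "\<mu> \<in> I" for \<mu>
      using subsetD[OF I(2) that] unfolding Mon_def by auto
    have inj: "inj_on ?\<phi> Ij"
    proof (rule inj_onI)
      fix \<mu> \<nu> assume "\<mu> \<in> Ij" "\<nu> \<in> Ij" and eq: "?\<phi> \<mu> = ?\<phi> \<nu>"
      then have "\<mu> k = \<nu> k" by (simp add: Ij_def)
      then show "\<mu> = \<nu>" using eq by (metis fun_upd_triv fun_upd_upd)
    qed
    have a\<phi>: "a (?\<phi> \<mu>) = x \<mu>" if "\<mu> \<in> Ij" for \<mu>
    proof -
      have "(?\<phi> \<mu>)(k := j) = \<mu>" using that by (auto simp: Ij_def)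
      then show ?thesis using that Mon\<phi>[of \<mu>] by (simp add: a_def Ij_def)
    qed
    have fin: "finite Ij" using I by (simp add: Ij_def)
    define C where "C = (\<Sum>\<mu>\<in>Ij. nrm (x \<mu>))"
    have fa: "farr k \<rho> C a"
      unfolding farr_def
    proof (intro conjI allI)
      show "finite {\<mu>. a \<mu> \<noteq> 0}" using supp fin finite_subset by blast
      show "{\<mu>. a \<mu> \<noteq> 0} \<subseteq> Mon k" by (auto simp: a_def)
      fix \<nu>
      show "a \<nu> \<in> K" using x(1) by (auto simp: a_def I_def subring_0[OF K_ring])
      show "nrm (a \<nu>) * \<rho> ^ mdeg k \<nu> \<le> C"
      proof (cases "a \<nu> = 0")
        case True then show ?thesis by (simp add: C_def sum_nonneg)
      next
        case False
        then obtain \<mu> where \<mu>: "\<mu> \<in> Ij" "\<nu> = ?\<phi> \<mu>" using supp by blast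
        have "nrm (x \<mu>) \<le> C" unfolding C_def using \<mu> fin by (intro member_le_sum) auto
        moreover have "nrm (a \<nu>) * \<rho> ^ mdeg k \<nu> \<le> nrm (a \<nu>) * 1"
          using \<theta> \<rho>0 by (intro mult_left_mono power_le_one) auto
        ultimately show ?thesis using a\<phi>[OF \<mu>(1)] \<mu>(2) by simp
      qed
    qed
    have "fev k u a = (\<Sum>\<nu>\<in>?\<phi> ` Ij. a \<nu> * mon k u \<nu>)" using fin supp by (intro fev_superset) auto
    also have "\<dots> = (\<Sum>\<mu>\<in>Ij. x \<mu> * mon k u \<mu>)"
      unfolding sum.reindex[OF inj] by (intro sum.cong refl) (simp add: a\<phi>, simp add: mon_def)
    also have "\<dots> = coeff f j"
      unfolding f_def Ij_def coeff_sum using I by (auto simp: sum.inter_filter intro: sum.cong)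
    finally have "fev k u a = 0" using f0 by simp
    then have "a (?\<phi> \<mu>0) = 0" by (rule indep_algebraic[OF ind fa _ \<rho>0])
    then show False using a\<phi>[of \<mu>0] \<mu>0 by (simp add: Ij_def j_def)
  qed
  ultimately show ?thesis unfolding transc_def by blast
qed

end

section \<open>Linear independence of exponentials\<close>

lemma derivation_smult_sum:
  assumes "\<And>l. l \<in> L \<Longrightarrow> derivation (D l)" shows "derivation (\<lambda>x. \<Sum>l\<in>L. c l * D l x)"
  unfolding derivation_on_def
  using assms by (auto simp: derivation_add derivation_mult sum.distrib[symmetric] sum_distrib_left sum_distrib_right algebra_simps intro!: sum.cong)

lemma derivation_minus_fun:
  assumes "derivation d" "derivation e" shows "derivation (\<lambda>x. d x - e x)"
  using assms unfolding derivation_on_def by (auto simp: algebra_simps)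

lemma derivation_commutator:
  assumes "derivation d" "derivation e" shows "derivation (\<lambda>x. d (e x) - e (d x))"
  unfolding derivation_on_def
  by (auto simp: derivation_add[OF assms(1)] derivation_add[OF assms(2)] derivation_mult[OF assms(1)]
      derivation_mult[OF assms(2)] algebra_simps)

context arith_valued
begin

theorem exponential_sums_independent:
  fixes y E c :: "nat \<Rightarrow> 'a"
  assumes \<theta>: "0 < \<theta>" "\<theta> < 1"
    and y: "\<And>i. i < m \<Longrightarrow> nrm (y i) \<le> \<theta>" "\<And>i. i < m \<Longrightarrow> p * y i \<in> Z"
    and tr: "\<And>i j. i < m \<Longrightarrow> j < m \<Longrightarrow> i \<noteq> j \<Longrightarrow> transc K (y i - y j)"
    and w: "w \<in> K" "nrm w = 1"
    and E: "\<And>i n. i < m \<Longrightarrow> nrm (E i - expsum w (y i) n) \<le> \<theta> ^ n"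
    and c: "\<And>i. i < m \<Longrightarrow> c i \<in> K" "i0 < m" "c i0 \<noteq> 0"
  shows "(\<Sum>i<m. c i * E i) \<noteq> 0"
proof
  assume rel: "(\<Sum>i<m. c i * E i) = 0"
  define R where "R = (1 + \<theta>) / 2"
  have R: "\<theta> < R" "R < 1" "0 < R" using \<theta> by (auto simp: R_def)
  \<comment> \<open>Stable under the shears of \<open>noether\<close> because their coefficients are
    natural numbers; this keeps \<open>p * u l\<close> integral.\<close>
  define \<Lambda> where "\<Lambda> = {x. p * x \<in> Z \<and> nrm x \<le> \<theta>}"
  have \<Lambda>: "x - of_nat n * x' \<in> \<Lambda>" if "x \<in> \<Lambda>" "x' \<in> \<Lambda>" for x x' n
  proof -
    have xZ: "p * x \<in> Z" "p * x' \<in> Z" using that by (auto simp: \<Lambda>_def)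
    have "p * x - of_nat n * (p * x') \<in> Z"
      by (rule subring_diff[OF Z_ring xZ(1) subring_mult[OF Z_ring subring_of_nat[OF Z_ring] xZ(2)]])
    moreover have "nrm (of_nat n * x') \<le> 1 * \<theta>"
      unfolding nrm_mult using that nrm_of_nat_le by (intro mult_mono) (auto simp: \<Lambda>_def)
    ultimately show ?thesis using that by (auto simp: \<Lambda>_def algebra_simps intro: nrm_diff_le)
  qed
  have "\<exists>k u \<rho> B t C0. (\<forall>i<k. u i \<in> \<Lambda>) \<and> indep k u \<rho> \<and> \<theta> < \<rho> \<and> \<rho> \<le> R \<and> C0 > 0 \<and>
    (\<forall>C x. Vb (y ` {..<m}) R C x \<longrightarrow>
      (\<exists>g. (\<forall>b<B. Vb (u ` {..<k}) \<rho> (C0 * C) (g b)) \<and> x = (\<Sum>b<(B::nat). g b * t b)))"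
    by (rule noether[where \<Lambda> = \<Lambda> and \<theta> = \<theta>]) (use \<Lambda> \<theta> R y in \<open>auto simp: \<Lambda>_def\<close>)
  then obtain k u \<rho> B t C0 where u': "\<forall>i<k. u i \<in> \<Lambda>" and ind: "indep k u \<rho>" and \<rho>: "\<theta> < \<rho>" "\<rho> \<le> R" and C0: "C0 > 0"
    and rep': "\<forall>C x. Vb (y ` {..<m}) R C x \<longrightarrow>
      (\<exists>g. (\<forall>b<B. Vb (u ` {..<k}) \<rho> (C0 * C) (g b)) \<and> x = (\<Sum>b<(B::nat). g b * t b))"
    by (elim exE conjE)
  note u = u'[rule_format] and rep = rep'[rule_format]
  let ?U = "u ` {..<k}" and ?Y = "y ` {..<m}"
  have \<rho>0: "\<rho> > 0" using \<rho> \<theta> by simp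
  have un: "nrm (u i) \<le> \<theta>" "p * u i \<in> Z" "nrm (u i) \<le> \<rho>" if "i < k" for i using u[OF that] \<rho> by (auto simp: \<Lambda>_def)
  define kills :: "'a set \<Rightarrow> ('a \<Rightarrow> 'a) \<Rightarrow> bool" where "kills = (\<lambda>S d. \<forall>a\<in>S. d a = 0)"
  \<comment> \<open>Stand-in for the algebraic closure of \<open>K(u)\<close>: in characteristic
    zero an element is algebraic exactly when every derivation trivial on the base kills it. Closure
    under the field operations is then immediate.\<close>
  define M where "M = {x. \<forall>d. derivation d \<longrightarrow> kills (K \<union> ?U) d \<longrightarrow> d x = 0}"
  have MI: "x \<in> M" if "\<And>d. derivation d \<Longrightarrow> kills (K \<union> ?U) d \<Longrightarrow> d x = 0" for x using that by (auto simp: M_def)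
  have MD: "d x = 0" if "x \<in> M" "derivation d" "kills (K \<union> ?U) d" for x d using that by (auto simp: M_def)
  have KM: "a \<in> M" if "a \<in> K" for a using that by (intro MI) (auto simp: kills_def)
  have M_ring: "subring M"
  proof (rule subringI)
    show "1 \<in> M" using KM subring_1[OF K_ring] by blast
    show "a - b \<in> M" "a * b \<in> M" if "a \<in> M" "b \<in> M" for a b
      using that by (auto intro!: MI simp: derivation_diff derivation_mult MD)
  qed
  have M_inv: "inverse a \<in> M" if "a \<in> M" for a
  proof (cases "a = 0")
    case False
    show ?thesis
    proof (rule MI)
      fix d assume d: "derivation d" "kills (K \<union> ?U) d"
      show "d (inverse a) = 0" using MD[OF that d] derivation_inverse[OF d(1) False] by simp
    qed
  qed (use that in simp)
  have yM: "y i \<in> M" if i: "i < m" for i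
  proof (rule MI)
    fix d assume d: "derivation d" "kills (K \<union> ?U) d"
    \<comment> \<open>All powers of \<open>y i\<close> are power series in \<open>y\<close> of norm
      at most 1, so a single constant serves them all, as \<open>algebraic_over_coordinates\<close>
      demands.\<close>
    have alg: "\<not> transc (vals ?U \<rho>) (y i)"
    proof (rule algebraic_over_coordinates[OF ind \<theta>(1) \<rho>(1) _ un(1,2)])
      show "\<rho> \<le> 1" using \<rho> R by simp
      show "nrm (y i) \<le> 1" "p * y i \<in> Z" using y[OF i] \<theta> by auto
      fix j
      have "V ?Y R (R ^ j) (y i ^ j)" using i R by (intro V_power V_gens) auto
      then have "Vb ?Y R (R ^ j) (y i ^ j)" using R by (intro Vb_V) auto
      then have "Vb ?Y R 1 (y i ^ j)" by (rule Vb_mono) (use R in \<open>simp add: power_le_one\<close>)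
      then show "\<exists>g. (\<forall>b<B. Vb ?U \<rho> (C0 * 1) (g b)) \<and> y i ^ j = (\<Sum>b<B. g b * t b)" by (rule rep)
    qed
    show "d (y i) = 0"
    proof (rule derivation_algebraic_eq_0[OF subring_vals d(1) _ alg])
      show "d r = 0" if "r \<in> vals ?U \<rho>" for r
        using derivation_vals[OF d(1) _ _ that] d(2) by (auto simp: kills_def)
    qed (use \<rho>0 in auto)
  qed
  have "\<exists>D. derivation D \<and> (\<forall>a\<in>K. D a = 0) \<and> (\<forall>j<k. D (u j) = (if j = l then 1 else 0)) \<and>
      (\<forall>i<m. D (E i) = w * E i * D (y i))" if l: "l < k" for l
  proof -
    obtain D where D: "derivation D" "\<And>a. a \<in> K \<Longrightarrow> D a = 0" "\<And>j. j < k \<Longrightarrow> D (u j) = (if j = l then 1 else 0)"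
      "\<And>C x. Vb ?U \<rho> C x \<Longrightarrow> nrm (D x) \<le> C / \<rho>"
      using analytic_derivation[OF ind \<rho>0 l un(3)] by metis
    \<comment> \<open>The product rule for \<open>g b * t b\<close> bounds \<open>D\<close> on power
      series in \<open>y\<close>; \<open>T\<close> collects the sizes of the generators and of their
      derivatives.\<close>
    define T where "T = (\<Sum>b<B. nrm (t b) + nrm (D (t b)))"
    have "nrm (D x) \<le> (C0 * (1 / \<rho> + 1) * T) * C" if x: "Vb ?Y R C x" for C x
    proof -
      have C: "C \<ge> 0" by (rule Vb_nonneg[OF x])
      obtain g where g: "\<And>b. b < B \<Longrightarrow> Vb ?U \<rho> (C0 * C) (g b)" "x = (\<Sum>b<B. g b * t b)" using rep[OF x] by blast
      have "nrm (D x) \<le> (C0 * C * (1 / \<rho> + 1)) * T"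
        unfolding g(2) derivation_sum[OF D(1)]
      proof (rule nrm_sum_le)
        show "0 \<le> C0 * C * (1 / \<rho> + 1) * T" using C0 C \<rho>0 by (auto simp: T_def intro!: mult_nonneg_nonneg sum_nonneg add_nonneg_nonneg)
        fix b assume b: "b \<in> {..<B}"
        have tb: "nrm (t b) + nrm (D (t b)) \<le> T" unfolding T_def using b by (intro member_le_sum) auto
        have g1: "nrm (g b) \<le> C0 * C" using b un \<rho>0 by (intro Vb_nrm[OF g(1)]) auto
        have "C0 * C * 1 \<le> C0 * C * (1 / \<rho> + 1)" using C0 C \<rho>0 by (intro mult_left_mono) auto
        then have g2: "nrm (g b) \<le> C0 * C * (1 / \<rho> + 1)" using g1 by linarith
        have "nrm (D (g b)) \<le> C0 * C * (1 / \<rho>)" using D(4)[OF g(1)] b by simp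
        also have "\<dots> \<le> C0 * C * (1 / \<rho> + 1)" using C0 C \<rho>0 by (intro mult_left_mono) auto
        finally have g3: "nrm (D (g b)) \<le> C0 * C * (1 / \<rho> + 1)" .
        have "nrm (D (g b) * t b) \<le> C0 * C * (1 / \<rho> + 1) * T" unfolding nrm_mult
          using g3 tb by (intro mult_mono order_trans[OF nrm_ge_0 g3]) (auto intro: order_trans[OF _ tb])
        moreover have "nrm (g b * D (t b)) \<le> C0 * C * (1 / \<rho> + 1) * T" unfolding nrm_mult
          using g2 tb by (intro mult_mono order_trans[OF nrm_ge_0 g2]) (auto intro: order_trans[OF _ tb])
        ultimately show "nrm (D (g b * t b)) \<le> C0 * C * (1 / \<rho> + 1) * T"
          by (simp add: derivation_mult[OF D(1)] nrm_add_le)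
      qed
      also have "\<dots> = (C0 * (1 / \<rho> + 1) * T) * C" by (simp only: mult_ac)
      finally show ?thesis .
    qed
    then have "D (E i) = w * E i * D (y i)" if "i < m" for i
      using R \<theta> w that by (intro exp_derivation[where Z = ?Y and R = R and \<theta> = \<theta>] E D) auto
    then show ?thesis using D by blast
  qed
  then have "\<forall>l\<in>{..<k}. \<exists>D. derivation D \<and> (\<forall>a\<in>K. D a = 0) \<and> (\<forall>j<k. D (u j) = (if j = l then 1 else 0)) \<and>
      (\<forall>i<m. D (E i) = w * E i * D (y i))" by simp
  from bchoice[OF this] obtain D where D': "\<forall>l\<in>{..<k}. derivation (D l) \<and> (\<forall>a\<in>K. D l a = 0) \<and>
      (\<forall>j<k. D l (u j) = (if j = l then 1 else 0)) \<and> (\<forall>i<m. D l (E i) = w * E i * D l (y i))" ..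
  have D: "\<And>l. l < k \<Longrightarrow> derivation (D l)" "\<And>l a. l < k \<Longrightarrow> a \<in> K \<Longrightarrow> D l a = 0"
    "\<And>l j. l < k \<Longrightarrow> j < k \<Longrightarrow> D l (u j) = (if j = l then 1 else 0)"
    "\<And>l i. l < k \<Longrightarrow> i < m \<Longrightarrow> D l (E i) = w * E i * D l (y i)"
    using D' by simp_all
  \<comment> \<open>The commutator of \<open>d\<close> and \<open>D l\<close> again kills
    \<open>K\<close> and the coordinates, so \<open>D l\<close> maps \<open>M\<close> into
    itself.\<close>
  have DM: "D l x \<in> M" if "l < k" "x \<in> M" for l x
  proof (rule MI)
    fix d assume d: "derivation d" "kills (K \<union> ?U) d"
    have "kills (K \<union> ?U) (\<lambda>x. d (D l x) - D l (d x))"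
      using d D[OF that(1)] derivation_0[OF d(1)] derivation_1[OF d(1)] derivation_0[OF D(1)[OF that(1)]]
      by (auto simp: kills_def)
    from MD[OF that(2) derivation_commutator[OF d(1) D(1)[OF that(1)]] this]
    show "d (D l x) = 0" using MD[OF that(2) d] derivation_0[OF D(1)[OF that(1)]] by simp
  qed
  \<comment> \<open>The difference of the two sides is a derivation that kills \<open>K\<close> and
    \<open>u\<close>, hence all of \<open>M\<close>.\<close>
  have expand: "d x = (\<Sum>l<k. d (u l) * D l x)" if d: "derivation d" "kills K d" and x: "x \<in> M" for d x
  proof -
    define e where "e = (\<lambda>x. \<Sum>l\<in>{..<k}. d (u l) * D l x)"
    have e: "derivation e" unfolding e_def by (rule derivation_smult_sum) (use D in auto)
    have "e (u j) = d (u j)" if "j < k" for j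
    proof -
      have "e (u j) = (\<Sum>l<k. if j = l then d (u l) else 0)" unfolding e_def using D(3) that by (intro sum.cong) auto
      then show ?thesis using that by simp
    qed
    then have "kills (K \<union> ?U) (\<lambda>x. d x - e x)" using d D(2) by (auto simp: kills_def e_def)
    from MD[OF x derivation_minus_fun[OF d(1) e] this] show ?thesis by (simp add: e_def)
  qed
  define good where "good = (\<lambda>S. S \<subseteq> {..<m} \<and> S \<noteq> {} \<and> (\<exists>f. (\<forall>i\<in>S. f i \<in> M \<and> f i \<noteq> 0) \<and> (\<Sum>i\<in>S. f i * E i) = 0))"
  have "good {i. i < m \<and> c i \<noteq> 0}"
  proof -
    have "(\<Sum>i\<in>{i. i < m \<and> c i \<noteq> 0}. c i * E i) = (\<Sum>i<m. c i * E i)" by (intro sum.mono_neutral_left) auto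
    then show ?thesis unfolding good_def using rel c KM by (auto intro!: exI[of _ c])
  qed
  then obtain S where S: "good S" and min: "\<And>S'. good S' \<Longrightarrow> card S \<le> card S'"
    using ex_has_least_nat[of good _ card] by blast
  have fS: "finite S" using S finite_subset by (auto simp: good_def)
  obtain f where f: "\<And>i. i \<in> S \<Longrightarrow> f i \<in> M" "\<And>i. i \<in> S \<Longrightarrow> f i \<noteq> 0" "(\<Sum>i\<in>S. f i * E i) = 0"
    using S unfolding good_def by blast
  have Sm: "i < m" if "i \<in> S" for i using S that by (auto simp: good_def)
  obtain a where a: "a \<in> S" using S by (auto simp: good_def)
  define h where "h = (\<lambda>i. f i * inverse (f a))"
  have hM: "h i \<in> M" if "i \<in> S" for i unfolding h_def using f that a by (intro subring_mult[OF M_ring] M_inv) auto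
  have ha: "h a = 1" using f a by (simp add: h_def)
  have hn: "h i \<noteq> 0" if "i \<in> S" for i using f that a by (simp add: h_def)
  have hs: "(\<Sum>i\<in>S. h i * E i) = 0"
  proof -
    have "(\<Sum>i\<in>S. h i * E i) = inverse (f a) * (\<Sum>i\<in>S. f i * E i)" by (simp add: h_def sum_distrib_left algebra_simps)
    then show ?thesis using f by simp
  qed
  have wM: "w \<in> M" using KM w by blast
  have deq: "D l (h i) = w * h i * D l (y a - y i)" if l: "l < k" and i: "i \<in> S" for l i
  proof -
    note d = D(1)[OF l]
    \<comment> \<open>Coefficients of the differentiated relation minus \<open>w * D l (y a)\<close>
      times the relation. As \<open>h a = 1\<close>, the entry at \<open>a\<close> vanishes, and
      minimality of \<open>S\<close> forces all the others to vanish.\<close>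
    define r where "r = (\<lambda>i. D l (h i) + w * h i * D l (y i - y a))"
    have rM: "r j \<in> M" if "j \<in> S" for j
      unfolding r_def using that a l Sm hM wM
      by (intro subring_add[OF M_ring] subring_mult[OF M_ring] DM subring_diff[OF M_ring] yM) auto
    have ra: "r a = 0" by (simp add: r_def ha derivation_1[OF d] derivation_0[OF d])
    have "(\<Sum>j\<in>S. r j * E j) = 0"
    proof -
      have "0 = D l (\<Sum>j\<in>S. h j * E j) - w * D l (y a) * (\<Sum>j\<in>S. h j * E j)" by (simp add: hs derivation_0[OF d])
      also have "\<dots> = (\<Sum>j\<in>S. D l (h j * E j) - w * D l (y a) * (h j * E j))"
        by (simp add: derivation_sum[OF d] sum_subtractf sum_distrib_left)
      also have "\<dots> = (\<Sum>j\<in>S. r j * E j)"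
        by (intro sum.cong refl) (simp add: r_def derivation_mult[OF d] derivation_diff[OF d] D(4)[OF l Sm] algebra_simps)
      finally show ?thesis by simp
    qed
    then have r0: "(\<Sum>j\<in>{j \<in> S. r j \<noteq> 0}. r j * E j) = 0"
      using fS by (subst sum.mono_neutral_left[of S]) auto
    have "{j \<in> S. r j \<noteq> 0} = {}"
    proof (rule ccontr)
      assume ne: "{j \<in> S. r j \<noteq> 0} \<noteq> {}"
      have "good {j \<in> S. r j \<noteq> 0}" unfolding good_def using ne r0 rM Sm by (intro conjI exI[of _ r]) auto
      then have "card S \<le> card {j \<in> S. r j \<noteq> 0}" by (rule min)
      moreover have "card {j \<in> S. r j \<noteq> 0} < card S" using a ra fS by (intro psubset_card_mono) auto
      ultimately show False by simp
    qed
    then have "r i = 0" using i by blast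
    then show ?thesis by (simp add: r_def derivation_diff[OF d] algebra_simps add_eq_0_iff)
  qed
  \<comment> \<open>The estimate for \<open>n = 1\<close> places \<open>E i\<close> within \<theta>
    < 1 of 1.\<close>
  have E0: "E i \<noteq> 0" if "i < m" for i
  proof
    assume "E i = 0"
    then show False using E[OF that, of 1] \<theta> by (simp add: expsum_def)
  qed
  have "S \<noteq> {a}"
  proof
    assume "S = {a}"
    then show False using hs ha E0[OF Sm[OF a]] by simp
  qed
  then obtain b where b: "b \<in> S" "b \<noteq> a" using a by blast
  \<comment> \<open>By the expansion along the coordinates, \<open>h b\<close> satisfies the
    equation of \<open>exp (w * (y a - y b))\<close> for every derivation over \<open>K\<close>, not
    only for the \<open>D l\<close>.\<close>
  show False
  proof (rule exponential_not_algebraic[OF K_ring tr[OF Sm[OF a] Sm[OF b(1)] b(2)[symmetric]] w(1) _ hn[OF b(1)]])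
    show "w \<noteq> 0" using w by auto
    fix d assume d: "derivation d" "\<And>a. a \<in> K \<Longrightarrow> d a = 0"
    then have kd: "kills K d" by (simp add: kills_def)
    have "d (h b) = (\<Sum>l<k. d (u l) * (w * h b * D l (y a - y b)))"
      unfolding expand[OF d(1) kd hM[OF b(1)]] using deq b by (intro sum.cong) auto
    also have "\<dots> = w * h b * (\<Sum>l<k. d (u l) * D l (y a - y b))" by (simp add: sum_distrib_left algebra_simps)
    also have "(\<Sum>l<k. d (u l) * D l (y a - y b)) = d (y a - y b)"
      using a b Sm by (intro expand[OF d(1) kd, symmetric] subring_diff[OF M_ring] yM) auto
    finally show "d (h b) = w * h b * d (y a - y b)" .
  qed
qed

end

section \<open>The field of moderate functions\<close>

definition ultra :: "'a filter \<Rightarrow> bool" where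
  "ultra U \<longleftrightarrow> U \<noteq> bot \<and> (\<forall>P. eventually P U \<or> eventually (\<lambda>x. \<not> P x) U)"

text \<open>Filters are handled as sets of predicates, so that refinement is inclusion and Zorn's
  lemma applies. To a maximal one, \<open>P\<close> could be adjoined unless its negation is already
  a member.\<close>

lemma ultra_exists:
  assumes "F \<noteq> bot"
  shows "\<exists>U. U \<le> F \<and> ultra U"
proof -
  define filt where "filt = (\<lambda>S :: ('a \<Rightarrow> bool) set. (\<lambda>_. False) \<notin> S \<and> (\<forall>P. eventually P F \<longrightarrow> P \<in> S) \<and>
    (\<forall>P\<in>S. \<forall>Q\<in>S. (\<lambda>x. P x \<and> Q x) \<in> S) \<and> (\<forall>P\<in>S. \<forall>Q. (\<forall>x. P x \<longrightarrow> Q x) \<longrightarrow> Q \<in> S))"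
  have base: "filt {P. eventually P F}"
    using assms unfolding filt_def trivial_limit_def by (auto intro: eventually_conj elim: eventually_mono)
  have "\<exists>W\<in>Collect filt. \<forall>X\<in>C. X \<subseteq> W" if C: "C \<in> chains (Collect filt)" for C
  proof (cases "C = {}")
    case True then show ?thesis using base by auto
  next
    case False
    have Cf: "filt X" if "X \<in> C" for X using C that by (auto simp: chains_def)
    have lin: "X \<subseteq> Y \<or> Y \<subseteq> X" if "X \<in> C" "Y \<in> C" for X Y using C that by (auto simp: chains_def chain_subset_def)
    have "filt (\<Union>C)" unfolding filt_def
    proof (intro conjI ballI allI impI)
      show "(\<lambda>_. False) \<notin> \<Union>C" using Cf unfolding filt_def by blast
      show "P \<in> \<Union>C" if "eventually P F" for P using Cf False that unfolding filt_def by blast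
      show "(\<lambda>x. P x \<and> Q x) \<in> \<Union>C" if "P \<in> \<Union>C" "Q \<in> \<Union>C" for P Q
      proof -
        from that obtain X Y where XY: "X \<in> C" "Y \<in> C" "P \<in> X" "Q \<in> Y" by blast
        then obtain W where "W \<in> C" "P \<in> W" "Q \<in> W" using lin[OF XY(1,2)] by blast
        then show ?thesis using Cf unfolding filt_def by blast
      qed
      show "Q \<in> \<Union>C" if "P \<in> \<Union>C" "\<forall>x. P x \<longrightarrow> Q x" for P Q using Cf that unfolding filt_def by blast
    qed
    then show ?thesis by blast
  qed
  then have "\<forall>C\<in>chains (Collect filt). \<exists>W\<in>Collect filt. \<forall>X\<in>C. X \<subseteq> W" by (rule ballI)
  from Zorn_Lemma2[OF this] obtain M where M': "M \<in> Collect filt" "\<forall>X\<in>Collect filt. M \<subseteq> X \<longrightarrow> X = M" by (elim bexE)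
  have M: "filt M" "\<And>X. filt X \<Longrightarrow> M \<subseteq> X \<Longrightarrow> X = M" using M' by simp_all
  have M_False: "(\<lambda>_. False) \<notin> M" and M_ev: "\<And>P. eventually P F \<Longrightarrow> P \<in> M"
    and M_conj: "\<And>P Q. P \<in> M \<Longrightarrow> Q \<in> M \<Longrightarrow> (\<lambda>x. P x \<and> Q x) \<in> M"
    and M_up: "\<And>P Q. P \<in> M \<Longrightarrow> (\<And>x. P x \<Longrightarrow> Q x) \<Longrightarrow> Q \<in> M"
    using M(1) unfolding filt_def by auto
  have M_True: "(\<lambda>_. True) \<in> M" by (rule M_ev) simp
  define U where "U = Abs_filter (\<lambda>P. P \<in> M)"
  have "is_filter (\<lambda>P. P \<in> M)"
  proof
    show "(\<lambda>x. True) \<in> M" by (rule M_True)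
    show "(\<lambda>x. P x \<and> Q x) \<in> M" if "P \<in> M" "Q \<in> M" for P Q by (rule M_conj[OF that])
    show "Q \<in> M" if "\<forall>x. P x \<longrightarrow> Q x" "P \<in> M" for P Q using that by (auto intro: M_up)
  qed
  then have U: "eventually P U \<longleftrightarrow> P \<in> M" for P unfolding U_def by (rule eventually_Abs_filter)
  have "U \<le> F" using M_ev by (simp add: le_filter_def U)
  moreover have "ultra U" unfolding ultra_def U trivial_limit_def
  proof (intro conjI allI)
    show "(\<lambda>x. False) \<notin> M" by (rule M_False)
    fix P
    show "P \<in> M \<or> (\<lambda>x. \<not> P x) \<in> M"
    proof (rule disjCI)
      assume notM: "(\<lambda>x. \<not> P x) \<notin> M"
      define X where "X = {Q. \<exists>R\<in>M. \<forall>x. R x \<and> P x \<longrightarrow> Q x}"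
      have "filt X" unfolding filt_def
      proof (intro conjI ballI allI impI)
        show "(\<lambda>_. False) \<notin> X"
        proof
          assume "(\<lambda>_. False) \<in> X"
          then obtain R where "R \<in> M" "\<forall>x. R x \<longrightarrow> \<not> P x" unfolding X_def by auto
          then have "(\<lambda>x. \<not> P x) \<in> M" by (auto intro: M_up)
          then show False using notM by simp
        qed
        show "Q \<in> X" if "eventually Q F" for Q using M_ev[OF that] unfolding X_def by auto
        show "(\<lambda>x. Q x \<and> Q' x) \<in> X" if QQ: "Q \<in> X" "Q' \<in> X" for Q Q'
        proof -
          obtain R R' where R: "R \<in> M" "\<forall>x. R x \<and> P x \<longrightarrow> Q x" "R' \<in> M" "\<forall>x. R' x \<and> P x \<longrightarrow> Q' x"
            using QQ unfolding X_def by blast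
          have "\<forall>x. (R x \<and> R' x) \<and> P x \<longrightarrow> Q x \<and> Q' x" using R by simp
          then show ?thesis unfolding X_def mem_Collect_eq by (rule bexI[OF _ M_conj[OF R(1,3)]])
        qed
        show "Q' \<in> X" if "Q \<in> X" "\<forall>x. Q x \<longrightarrow> Q' x" for Q Q' using that unfolding X_def by blast
      qed
      moreover have "M \<subseteq> X" unfolding X_def by auto
      ultimately have "X = M" by (rule M(2))
      moreover have "P \<in> X" unfolding X_def mem_Collect_eq by (rule bexI[OF _ M_True]) simp
      ultimately show "P \<in> M" by simp
    qed
  qed
  ultimately show ?thesis by blast
qed

text \<open>Pigeonhole on vectors with entries between 0 and \<open>H\<close>: real and imaginary
  parts of the linear forms are sorted into intervals of length \<open>\<delta> / 2\<close>, and two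
  vectors in the same cell are subtracted. The exponent \<open>2 * card J\<close> counts the real
  coordinates.\<close>

lemma siegel_complex:
  fixes a :: "'j \<Rightarrow> 'i \<Rightarrow> complex"
  assumes I: "finite I" and J: "finite J" and a: "\<And>i j. i \<in> I \<Longrightarrow> j \<in> J \<Longrightarrow> cmod (a j i) \<le> A" and "\<delta> > 0"
    and M: "real M \<ge> 2 * real (card I) * real H * A / \<delta> + 1" and count: "(2 * M + 1) ^ (2 * card J) < (H + 1) ^ card I"
  shows "\<exists>x :: 'i \<Rightarrow> int. (\<forall>i\<in>I. \<bar>x i\<bar> \<le> H) \<and> (\<exists>i\<in>I. x i \<noteq> 0) \<and>
    (\<forall>j\<in>J. cmod (\<Sum>i\<in>I. of_int (x i) * a j i) \<le> \<delta>)"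
proof -
  define X where "X = PiE I (\<lambda>_. {0..int H})"
  define \<eta> where "\<eta> = \<delta> / 2"
  have \<eta>: "\<eta> > 0" using assms by (simp add: \<eta>_def)
  define S where "S = (\<lambda>x j. \<Sum>i\<in>I. of_int (x i) * a j i)"
  define T where "T = PiE J (\<lambda>_. {- int M..int M} \<times> {- int M..int M})"
  define \<phi> where "\<phi> = (\<lambda>x. restrict (\<lambda>j. (\<lfloor>Re (S x j) / \<eta>\<rfloor>, \<lfloor>Im (S x j) / \<eta>\<rfloor>)) J)"
  have "card {0..int H} = H + 1" by simp
  then have cX: "card X = (H + 1) ^ card I" unfolding X_def using I by (subst card_PiE) (simp_all only: prod_constant)
  have "card ({- int M..int M} \<times> {- int M..int M}) = (2 * M + 1) ^ 2"
    by (simp add: power2_eq_square nat_add_distrib nat_mult_distrib)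
  then have cT: "card T = (2 * M + 1) ^ (2 * card J)" unfolding T_def using J by (subst card_PiE) (auto simp: power_mult)
  have fT: "finite T" unfolding T_def using J by (intro finite_PiE) auto
  have "\<phi> ` X \<subseteq> T"
  proof
    fix f assume "f \<in> \<phi> ` X"
    then obtain x where x: "x \<in> X" "f = \<phi> x" by blast
    have "(\<lfloor>Re (S x j) / \<eta>\<rfloor>, \<lfloor>Im (S x j) / \<eta>\<rfloor>) \<in> {- int M..int M} \<times> {- int M..int M}" if j: "j \<in> J" for j
    proof -
      have "cmod (S x j) \<le> (\<Sum>i\<in>I. real H * A)" unfolding S_def
      proof (rule sum_norm_le)
        fix i assume i: "i \<in> I"
        then have "0 \<le> x i" "x i \<le> int H" using x(1) by (auto simp: X_def PiE_iff)
        then have "norm (of_int (x i) :: complex) \<le> real H" by simp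
        then show "norm (of_int (x i) * a j i) \<le> real H * A"
          unfolding norm_mult using a[OF i j] by (intro mult_mono) auto
      qed
      also have "\<dots> = real (card I) * real H * A" by simp
      also have "\<dots> = (2 * real (card I) * real H * A / \<delta>) * \<eta>" using assms(4) by (simp add: \<eta>_def)
      also have "\<dots> \<le> (real M - 1) * \<eta>" using M \<eta> by (intro mult_right_mono) auto
      finally have *: "cmod (S x j) \<le> (real M - 1) * \<eta>" .
      have "\<lfloor>r / \<eta>\<rfloor> \<in> {- int M..int M}" if "\<bar>r\<bar> \<le> cmod (S x j)" for r
      proof -
        have "\<bar>r\<bar> \<le> (real M - 1) * \<eta>" using * that by linarith
        then have "\<bar>r / \<eta>\<bar> \<le> real M - 1" using \<eta> by (simp add: abs_divide field_simps)
        then have "- real M \<le> r / \<eta>" "r / \<eta> < real M + 1" by linarith+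
        then show ?thesis by (auto simp: le_floor_iff floor_le_iff)
      qed
      then show ?thesis using abs_Re_le_cmod abs_Im_le_cmod by blast
    qed
    then show "f \<in> T" using x by (auto simp: T_def \<phi>_def)
  qed
  then have "card (\<phi> ` X) \<le> card T" by (rule card_mono[OF fT])
  then have "card (\<phi> ` X) < card X" using cX cT count by simp
  then have "\<not> inj_on \<phi> X" using card_image by force
  then obtain x y where xy: "x \<in> X" "y \<in> X" "x \<noteq> y" "\<phi> x = \<phi> y" unfolding inj_on_def by blast
  show ?thesis
  proof (intro exI[of _ "\<lambda>i. x i - y i"] conjI ballI)
    show "\<bar>x i - y i\<bar> \<le> int H" if "i \<in> I" for i using xy that by (force simp: X_def PiE_iff)
    obtain i where "x i \<noteq> y i" using xy(3) by blast
    moreover have "i \<in> I" using xy(1,2) \<open>x i \<noteq> y i\<close> by (metis PiE_arb X_def)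
    ultimately show "\<exists>i\<in>I. x i - y i \<noteq> 0" by auto
    fix j assume j: "j \<in> J"
    have eq: "\<lfloor>Re (S x j) / \<eta>\<rfloor> = \<lfloor>Re (S y j) / \<eta>\<rfloor>" "\<lfloor>Im (S x j) / \<eta>\<rfloor> = \<lfloor>Im (S y j) / \<eta>\<rfloor>"
      using fun_cong[OF xy(4), of j] j by (auto simp: \<phi>_def)
    have close: "\<bar>r - s\<bar> \<le> \<eta>" if "\<lfloor>r / \<eta>\<rfloor> = \<lfloor>s / \<eta>\<rfloor>" for r s
    proof -
      have "\<bar>r / \<eta> - s / \<eta>\<bar> \<le> 1" using that by linarith
      then have "\<bar>(r - s) / \<eta>\<bar> \<le> 1" by (simp add: diff_divide_distrib)
      then show ?thesis using \<eta> by (simp add: abs_divide field_simps)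
    qed
    have eqS: "(\<Sum>i\<in>I. of_int (x i - y i) * a j i) = S x j - S y j"
      by (simp add: S_def sum_subtractf left_diff_distrib)
    have "cmod (S x j - S y j) \<le> \<bar>Re (S x j - S y j)\<bar> + \<bar>Im (S x j - S y j)\<bar>" by (rule cmod_le)
    also have "\<dots> \<le> \<eta> + \<eta>" using close[OF eq(1)] close[OF eq(2)] by (intro add_mono) simp_all
    also have "\<dots> = \<delta>" by (simp add: \<eta>_def)
    finally show "cmod (\<Sum>i\<in>I. of_int (x i - y i) * a j i) \<le> \<delta>" unfolding eqS .
  qed
qed

text \<open>Division by \<open>X - w t0\<close> keeps the polynomial monic and multiplies the bound
  on its values at the other points by at most \<open>2 / \<delta>\<close>; after
  \<open>degree f\<close> divisions the constant 1 remains.\<close>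

lemma monic_small_values:
  fixes f :: "complex poly"
  assumes "lead_coeff f = 1" "finite T" "card T > degree f" "inj_on w T" "0 < \<delta>" "\<delta> \<le> 1"
    and sep: "\<And>s t. s \<in> T \<Longrightarrow> t \<in> T \<Longrightarrow> s \<noteq> t \<Longrightarrow> cmod (w s - w t) \<ge> \<delta>"
    and small: "\<And>t. t \<in> T \<Longrightarrow> cmod (poly f (w t)) \<le> e"
  shows "1 \<le> e * (2 / \<delta>) ^ degree f"
  using assms
proof (induction "degree f" arbitrary: f T e)
  case 0
  then have "f = 1" by (metis degree_eq_zeroE lead_coeff_pCons(2) one_pCons pCons_0_0 coeff_pCons_0)
  moreover obtain t where "t \<in> T" using 0 by (metis card.empty less_nat_zero_code ex_in_conv)
  ultimately have "1 \<le> e" using 0(8)[of t] 0 by fastforce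
  then show ?case using 0 by simp
next
  case (Suc n)
  obtain t0 where t0: "t0 \<in> T" using Suc by (metis card.empty less_nat_zero_code ex_in_conv)
  define g where "g = synthetic_div f (w t0)"
  have f: "f = [:- w t0, 1:] * g + [:poly f (w t0):]" using synthetic_div_correct'[of "w t0" f] by (simp add: g_def)
  have dg: "degree g = n" using Suc(2) by (simp add: g_def degree_synthetic_div)
  have "coeff f (Suc n) = coeff g n - w t0 * coeff g (Suc n)" by (subst f) simp
  then have lg: "lead_coeff g = 1" using Suc dg by (simp add: coeff_eq_0)
  have "1 \<le> (2 * e / \<delta>) * (2 / \<delta>) ^ degree g"
  proof (rule Suc(1)[OF dg[symmetric] lg])
    show "finite (T - {t0})" "card (T - {t0}) > degree g" using Suc t0 dg by auto
    show "inj_on w (T - {t0})" using Suc by (auto simp: inj_on_def)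
    fix t assume t: "t \<in> T - {t0}"
    have "poly f (w t) - poly f (w t0) = (w t - w t0) * poly g (w t)" by (subst f) (simp add: algebra_simps)
    then have "cmod (w t - w t0) * cmod (poly g (w t)) \<le> cmod (poly f (w t)) + cmod (poly f (w t0))"
      by (metis norm_mult norm_triangle_ineq4)
    also have "\<dots> \<le> 2 * e" using Suc.prems(8)[of t] Suc.prems(8)[of t0] t t0 by auto
    finally have "cmod (w t - w t0) * cmod (poly g (w t)) \<le> 2 * e" .
    moreover have "\<delta> * cmod (poly g (w t)) \<le> cmod (w t - w t0) * cmod (poly g (w t))"
      using Suc.prems(7)[of t t0] t t0 by (intro mult_right_mono) auto
    ultimately show "cmod (poly g (w t)) \<le> 2 * e / \<delta>" using Suc by (simp add: field_simps)
  qed (use Suc in auto)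
  moreover have "degree f = Suc n" using Suc by simp
  ultimately show ?case by (simp add: dg algebra_simps)
qed

section \<open>Scales and exceptional configurations\<close>

type_synonym scaling = "(nat \<Rightarrow> real) \<times> (nat \<times> nat) filter"

text \<open>A point \<open>(n, t)\<close> stands for the \<open>n\<close>-th prime and a residue
  \<open>t\<close>; the scale depends on \<open>n\<close> alone. Being at least 2 everywhere, it has
  powers that increase with the exponent at every point.\<close>

definition admissible :: "scaling \<Rightarrow> bool" where
  "admissible = (\<lambda>(\<rho>, U). (\<forall>n. \<rho> n \<ge> 2) \<and> ultra U \<and> filterlim (\<lambda>x. \<rho> (fst x)) at_top U)"

text \<open>The condition on \<open>T\<close> makes \<open>y i - y j\<close> transcendental over the functions of the first
  index: a polynomial with bounded degree would be small at too many well separated points.\<close>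

definition small_sum ::
  "(nat \<Rightarrow> real) \<Rightarrow> (nat \<times> nat) filter \<Rightarrow> nat \<Rightarrow> (nat \<Rightarrow> nat \<times> nat \<Rightarrow> real) \<Rightarrow> (nat \<Rightarrow> nat \<Rightarrow> complex) \<Rightarrow> real \<Rightarrow> bool"
  where "small_sum \<rho> U m y c e \<longleftrightarrow> m > 0 \<and> e > 0 \<and>
    (\<forall>i<m. \<forall>x. \<bar>y i x\<bar> \<le> \<rho> (fst x) powr - e \<and> \<rho> (fst x) * y i x \<in> \<int>) \<and>
    (\<forall>i<m. \<forall>n. cmod (c i n) \<ge> 1) \<and> (\<forall>i<m. \<exists>s. \<forall>n. cmod (c i n) \<le> \<rho> n powr s) \<and>
    (\<forall>i<m. \<forall>j<m. i \<noteq> j \<longrightarrow> (\<forall>A. eventually A U \<longrightarrow> (\<forall>d. \<exists>n T. finite T \<and> card T = d \<and>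
       (\<forall>t\<in>T. A (n, t)) \<and> inj_on (\<lambda>t. y i (n, t) - y j (n, t)) T))) \<and>
    (\<forall>s. eventually (\<lambda>x. cmod (\<Sum>i<m. c i (fst x) * exp (2 * pi * \<i> * y i x)) \<le> \<rho> (fst x) powr s) U)"

definition exceptional :: "scaling \<Rightarrow> bool" where
  "exceptional = (\<lambda>(\<rho>, U). (\<forall>n. \<rho> n \<in> \<int>) \<and> (\<exists>m y c e. small_sum \<rho> U m y c e))"

lemma admissible_ex: "\<exists>z. admissible z"
proof -
  have "filtercomap fst at_top \<noteq> (bot :: (nat \<times> nat) filter)"
    by (rule filtercomap_neq_bot_surj) auto
  then obtain U :: "(nat \<times> nat) filter" where U: "U \<le> filtercomap fst at_top" "ultra U" using ultra_exists by blast
  have "filterlim fst at_top U" unfolding filterlim_def using U(1) by (simp add: filtermap_le_iff_le_filtercomap)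
  then have "filterlim (\<lambda>x. real (fst x)) at_top U" by (rule filterlim_compose[OF filterlim_real_sequentially])
  then have "filterlim (\<lambda>x. real (fst x) + 2) at_top U"
    by (rule filterlim_at_top_mono) (rule always_eventually, simp)
  then have "admissible (\<lambda>n. real n + 2, U)" using U by (simp add: admissible_def)
  then show ?thesis by (rule exI)
qed

text \<open>The field of moderate functions has to be a type, so the scale is a global constant;
  it is chosen exceptional whenever that is possible.\<close>

definition scale :: scaling where
  "scale = (SOME z. admissible z \<and> ((\<exists>z'. admissible z' \<and> exceptional z') \<longrightarrow> exceptional z))"

definition rho :: "nat \<times> nat \<Rightarrow> real" where "rho x = fst scale (fst x)"
definition UU :: "(nat \<times> nat) filter" where "UU = snd scale"

lemma scale: "admissible scale" "admissible z \<Longrightarrow> exceptional z \<Longrightarrow> exceptional scale"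
proof -
  have "\<exists>z. admissible z \<and> ((\<exists>z'. admissible z' \<and> exceptional z') \<longrightarrow> exceptional z)"
    using admissible_ex by blast
  from someI_ex[OF this] have s: "admissible scale \<and> ((\<exists>z'. admissible z' \<and> exceptional z') \<longrightarrow> exceptional scale)"
    unfolding scale_def .
  show "admissible scale" using s by blast
  show "admissible z \<Longrightarrow> exceptional z \<Longrightarrow> exceptional scale" using s by blast
qed

lemma rho_ge_2: "rho x \<ge> 2" and ultra_UU: "ultra UU" and rho_lim: "filterlim rho at_top UU"
proof -
  obtain r U where s: "scale = (r, U)" by (rule prod.exhaust)
  have "admissible (r, U)" using scale(1) unfolding s .
  then show "rho x \<ge> 2" "ultra UU" "filterlim rho at_top UU"
    unfolding rho_def[abs_def] UU_def s by (simp_all add: admissible_def)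
qed

lemma rho_pos: "rho x > 0" "rho x > 1" "rho x \<ge> 1" using rho_ge_2[of x] by auto

lemma UU_not: "\<not> eventually P UU \<Longrightarrow> eventually (\<lambda>x. \<not> P x) UU"
  using ultra_UU by (auto simp: ultra_def)

lemma UU_ex: "eventually P UU \<Longrightarrow> \<exists>x. P x"
  using ultra_UU eventually_happens'[of UU P] unfolding ultra_def by blast

section \<open>Growth exponents, moderate and negligible functions\<close>

definition bd :: "(nat \<times> nat \<Rightarrow> complex) \<Rightarrow> real \<Rightarrow> bool" where
  "bd f s \<longleftrightarrow> eventually (\<lambda>x. cmod (f x) \<le> rho x powr s) UU"

lemma not_bd: "\<not> bd f s \<Longrightarrow> eventually (\<lambda>x. cmod (f x) > rho x powr s) UU"
  using UU_not[of "\<lambda>x. cmod (f x) \<le> rho x powr s"] by (simp add: bd_def not_le)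

lemma bd_mono: "bd f s \<Longrightarrow> s \<le> t \<Longrightarrow> bd f t"
  unfolding bd_def by (erule eventually_mono) (meson order_trans powr_mono rho_pos(3))

text \<open>Constants are absorbed by an arbitrarily small positive power of \<open>rho\<close>;
  this is why sums lose a little in the exponent.\<close>

lemma const_le_rho: "s > 0 \<Longrightarrow> eventually (\<lambda>x. c \<le> rho x powr s) UU"
proof -
  assume s: "s > 0"
  have "eventually (\<lambda>x. rho x \<ge> (max c 1) powr (1 / s)) UU"
    using rho_lim unfolding filterlim_at_top by blast
  then show ?thesis
  proof (rule eventually_mono)
    fix x assume "(max c 1) powr (1 / s) \<le> rho x"
    then have "((max c 1) powr (1 / s)) powr s \<le> rho x powr s" using s by (intro powr_mono2) auto
    then show "c \<le> rho x powr s" using s by (simp add: powr_powr)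
  qed
qed

lemma bd_mult: "bd f s \<Longrightarrow> bd g t \<Longrightarrow> bd (\<lambda>x. f x * g x) (s + t)"
  unfolding bd_def norm_mult powr_add by (erule (1) eventually_elim2) (intro mult_mono norm_ge_zero powr_ge_zero)

lemma bd_add:
  assumes "bd f s" "bd g s" "s < t" shows "bd (\<lambda>x. f x + g x) t"
proof -
  have "eventually (\<lambda>x. 2 \<le> rho x powr (t - s)) UU" using assms by (intro const_le_rho) auto
  with assms(1,2)[unfolded bd_def] show ?thesis unfolding bd_def
  proof eventually_elim
    case (elim x)
    have "cmod (f x + g x) \<le> 2 * rho x powr s" using norm_triangle_ineq[of "f x" "g x"] elim by linarith
    also have "\<dots> \<le> rho x powr (t - s) * rho x powr s" using elim by (intro mult_right_mono) auto
    also have "\<dots> = rho x powr t" by (simp flip: powr_add)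
    finally show ?case .
  qed
qed

lemma bd_minus [simp]: "bd (\<lambda>x. - f x) s \<longleftrightarrow> bd f s" by (simp add: bd_def)

lemma bd_diff: "bd f s \<Longrightarrow> bd g s \<Longrightarrow> s < t \<Longrightarrow> bd (\<lambda>x. f x - g x) t"
  using bd_add[of f s "\<lambda>x. - g x" t] by simp

definition moderate :: "(nat \<times> nat \<Rightarrow> complex) \<Rightarrow> bool" where "moderate f \<longleftrightarrow> (\<exists>s. bd f s)"
definition negl :: "(nat \<times> nat \<Rightarrow> complex) \<Rightarrow> bool" where "negl f \<longleftrightarrow> (\<forall>s. bd f s)"

lemma bd_const: "s > 0 \<Longrightarrow> bd (\<lambda>_. c) s" unfolding bd_def by (rule const_le_rho)
lemma moderate_const: "moderate (\<lambda>_. c)" using bd_const[of 1] by (auto simp: moderate_def)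

lemma bd_two: "bd f s \<Longrightarrow> bd g t \<Longrightarrow> bd f (max s t) \<and> bd g (max s t)" by (auto intro: bd_mono)

lemma moderate_add: "moderate f \<Longrightarrow> moderate g \<Longrightarrow> moderate (\<lambda>x. f x + g x)"
  unfolding moderate_def by (metis bd_add bd_two less_add_one)
lemma moderate_minus: "moderate f \<Longrightarrow> moderate (\<lambda>x. - f x)" by (simp add: moderate_def)
lemma moderate_diff: "moderate f \<Longrightarrow> moderate g \<Longrightarrow> moderate (\<lambda>x. f x - g x)"
  using moderate_add[of f "\<lambda>x. - g x"] moderate_minus by simp
lemma moderate_mult: "moderate f \<Longrightarrow> moderate g \<Longrightarrow> moderate (\<lambda>x. f x * g x)"
  unfolding moderate_def using bd_mult by blast
lemma negl_0: "negl (\<lambda>_. 0)" by (simp add: negl_def bd_def)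
lemma negl_add: "negl f \<Longrightarrow> negl g \<Longrightarrow> negl (\<lambda>x. f x + g x)"
  unfolding negl_def using bd_add[of f _ g] by (meson lt_ex)
lemma negl_minus: "negl f \<Longrightarrow> negl (\<lambda>x. - f x)" by (simp add: negl_def)
lemma negl_diff: "negl f \<Longrightarrow> negl g \<Longrightarrow> negl (\<lambda>x. f x - g x)"
  using negl_add[of f "\<lambda>x. - g x"] negl_minus by simp
lemma negl_mult: "negl f \<Longrightarrow> moderate g \<Longrightarrow> negl (\<lambda>x. f x * g x)"
  unfolding negl_def moderate_def using bd_mult[of f _ g] by (metis diff_add_cancel)
lemma negl_mult2: "moderate f \<Longrightarrow> negl g \<Longrightarrow> negl (\<lambda>x. f x * g x)"
  using negl_mult[of g f] by (simp add: mult.commute)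

text \<open>Along an ultrafilter the failure of an upper bound is a lower bound almost everywhere.
  This is what makes nonzero classes invertible.\<close>

lemma bd_not_inverse:
  assumes "\<not> bd f s" shows "bd (\<lambda>x. inverse (f x)) (- s)"
  unfolding bd_def using not_bd[OF assms]
proof (rule eventually_mono)
  fix x assume *: "rho x powr s < cmod (f x)"
  have "inverse (cmod (f x)) \<le> inverse (rho x powr s)" using * rho_pos[of x] by (intro le_imp_inverse_le) auto
  then show "cmod (inverse (f x)) \<le> rho x powr - s" by (simp add: norm_inverse powr_minus)
qed

lemma not_negl_nonzero: "\<not> negl f \<Longrightarrow> eventually (\<lambda>x. f x \<noteq> 0) UU"
proof -
  assume "\<not> negl f"
  then obtain s where "\<not> bd f s" by (auto simp: negl_def)
  from not_bd[OF this] show ?thesis by (rule eventually_mono) auto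
qed

lemma bd_cong: "eventually (\<lambda>x. f x = g x) UU \<Longrightarrow> bd f s \<longleftrightarrow> bd g s"
  unfolding bd_def by (rule eventually_cong) (auto elim: eventually_mono)

lemma negl_cong: "eventually (\<lambda>x. f x = g x) UU \<Longrightarrow> negl f \<longleftrightarrow> negl g"
  by (simp add: negl_def bd_cong)

lemma bd_negl_diff: "bd f s \<Longrightarrow> negl (\<lambda>x. f x - g x) \<Longrightarrow> s < t \<Longrightarrow> bd g t"
  using bd_diff[of f s "\<lambda>x. f x - g x" t] by (simp add: negl_def)

lemma negl_eq: "negl (\<lambda>x. f x - g x) \<Longrightarrow> negl f \<longleftrightarrow> negl g"
  using negl_diff[of f "\<lambda>x. f x - g x"] negl_add[of "\<lambda>x. f x - g x" g] by auto

text \<open>A partial equivalence, reflexive exactly on the moderate functions, so that all others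
  are left out of the quotient.\<close>

definition rel :: "(nat \<times> nat \<Rightarrow> complex) \<Rightarrow> (nat \<times> nat \<Rightarrow> complex) \<Rightarrow> bool" where
  "rel f g \<longleftrightarrow> moderate f \<and> moderate g \<and> negl (\<lambda>x. f x - g x)"

quotient_type hyp = "nat \<times> nat \<Rightarrow> complex" / partial: rel
proof (rule part_equivpI)
  show "\<exists>x. rel x x" by (auto simp: rel_def moderate_const negl_0 intro!: exI[of _ "\<lambda>_. 0"])
  show "symp rel" by (rule sympI) (auto simp: rel_def dest: negl_minus)
  show "transp rel" by (rule transpI) (auto simp: rel_def dest: negl_add)
qed

text \<open>The pointwise inverse of a negligible function need not be moderate, so the zero class
  is treated separately; for any other \<open>f\<close> the zeros form a set outside the
  ultrafilter.\<close>

definition rinv :: "(nat \<times> nat \<Rightarrow> complex) \<Rightarrow> nat \<times> nat \<Rightarrow> complex" where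
  "rinv f = (if negl f then (\<lambda>_. 0) else (\<lambda>x. inverse (f x)))"

lemma moderate_rinv: "moderate (rinv f)"
proof (cases "negl f")
  case True then show ?thesis using moderate_const[of 0] by (simp add: rinv_def)
next
  case False
  then obtain s where "\<not> bd f s" by (auto simp: negl_def)
  from bd_not_inverse[OF this] show ?thesis using False by (auto simp: rinv_def moderate_def)
qed

lemma rel_rinv: "rel f g \<Longrightarrow> rel (rinv f) (rinv g)"
proof -
  assume r: "rel f g"
  then have eq: "negl f \<longleftrightarrow> negl g" by (simp add: rel_def negl_eq)
  have "negl (\<lambda>x. rinv f x - rinv g x)"
  proof (cases "negl f")
    case True then show ?thesis using eq negl_0 by (simp add: rinv_def)
  next
    case False
    have "negl (\<lambda>x. - (f x - g x) * (rinv f x * rinv g x))"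
      using r by (intro negl_mult moderate_mult moderate_rinv negl_minus) (simp add: rel_def)
    moreover have "eventually (\<lambda>x. - (f x - g x) * (rinv f x * rinv g x) = rinv f x - rinv g x) UU"
    proof -
      have ng: "\<not> negl g" using eq False by simp
      show ?thesis using not_negl_nonzero[OF False] not_negl_nonzero[OF ng]
        by (rule eventually_elim2) (simp add: rinv_def False ng field_simps)
    qed
    ultimately show ?thesis by (subst (asm) negl_cong)
  qed
  then show ?thesis by (simp add: rel_def moderate_rinv)
qed

lemma rel_refl_iff: "rel f f \<longleftrightarrow> moderate f" by (simp add: rel_def negl_0)

lemma abs_hyp_eq_iff:
  assumes "moderate f" "moderate g"
  shows "abs_hyp f = abs_hyp g \<longleftrightarrow> negl (\<lambda>x. f x - g x)"
  using Quotient3_rel[OF Quotient3_hyp, of f g] assms by (simp add: rel_refl_iff) (simp add: rel_def)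

instantiation hyp :: field
begin

lift_definition zero_hyp :: hyp is "\<lambda>_. 0" by (simp add: rel_def moderate_const negl_0)
lift_definition one_hyp :: hyp is "\<lambda>_. 1" by (simp add: rel_def moderate_const negl_0)
lift_definition plus_hyp :: "hyp \<Rightarrow> hyp \<Rightarrow> hyp" is "\<lambda>f g x. f x + g x"
  by (auto simp: rel_def moderate_add add_diff_add intro: negl_add)
lift_definition uminus_hyp :: "hyp \<Rightarrow> hyp" is "\<lambda>f x. - f x"
  by (auto simp: rel_def moderate_minus dest: negl_minus)
lift_definition minus_hyp :: "hyp \<Rightarrow> hyp \<Rightarrow> hyp" is "\<lambda>f g x. f x - g x"
  by (auto simp: rel_def moderate_diff diff_diff_eq2 algebra_simps dest: negl_diff)
lift_definition times_hyp :: "hyp \<Rightarrow> hyp \<Rightarrow> hyp" is "\<lambda>f g x. f x * g x"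
proof -
  fix f f' g g' assume a: "rel f f'" "rel g g'"
  have "negl (\<lambda>x. f x * (g x - g' x) + (f x - f' x) * g' x)"
    using a by (intro negl_add negl_mult negl_mult2) (auto simp: rel_def)
  then show "rel (\<lambda>x. f x * g x) (\<lambda>x. f' x * g' x)"
    using a by (auto simp: rel_def moderate_mult algebra_simps)
qed
lift_definition inverse_hyp :: "hyp \<Rightarrow> hyp" is rinv by (rule rel_rinv)
definition divide_hyp :: "hyp \<Rightarrow> hyp \<Rightarrow> hyp" where "divide_hyp a b = a * inverse b"

instance
proof
  fix a b c :: hyp
  show "a + b + c = a + (b + c)"
    by transfer (auto simp: rel_refl_iff algebra_simps intro: moderate_add)
  show "a + b = b + a" by transfer (auto simp: rel_refl_iff algebra_simps intro: moderate_add)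
  show "0 + a = a" by transfer simp
  show "- a + a = 0" by transfer (auto simp: rel_def negl_0 moderate_const)
  show "a - b = a + - b" by transfer (auto simp: rel_refl_iff intro: moderate_diff)
  show "a * b * c = a * (b * c)" by transfer (auto simp: rel_refl_iff algebra_simps intro: moderate_mult)
  show "a * b = b * a" by transfer (auto simp: rel_refl_iff algebra_simps intro: moderate_mult)
  show "1 * a = a" by transfer simp
  show "(a + b) * c = a * c + b * c"
    by transfer (auto simp: rel_refl_iff algebra_simps intro: moderate_mult moderate_add)
  show "(0::hyp) \<noteq> 1"
  proof (transfer, rule notI)
    assume "rel (\<lambda>_. 0) (\<lambda>_. 1)"
    then have "bd (\<lambda>_. 0 - 1) (-1)" by (simp add: rel_def negl_def)
    from UU_ex[OF this[unfolded bd_def]] obtain x where "1 \<le> rho x powr - 1" by auto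
    then show False using rho_ge_2[of x] by (simp add: powr_minus field_simps)
  qed
  show "a \<noteq> 0 \<Longrightarrow> inverse a * a = 1"
  proof transfer
    fix f assume f: "rel f f" "\<not> rel f (\<lambda>_. 0)"
    then have n: "\<not> negl f" by (auto simp: rel_def moderate_const)
    have "eventually (\<lambda>x. 0 = rinv f x * f x - 1) UU"
      using not_negl_nonzero[OF n] by (rule eventually_mono) (simp add: rinv_def n)
    from negl_cong[OF this] have "negl (\<lambda>x. rinv f x * f x - 1)" using negl_0 by simp
    then show "rel (\<lambda>x. rinv f x * f x) (\<lambda>_. 1)"
      using f by (auto simp: rel_def moderate_const intro: moderate_mult moderate_rinv)
  qed
  show "a div b = a * inverse b" by (simp add: divide_hyp_def)
  show "inverse (0::hyp) = 0" by transfer (simp add: rinv_def negl_0 rel_def moderate_const)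
qed

end

instance hyp :: field_char_0
proof
  show "inj (of_nat :: nat \<Rightarrow> hyp)"
  proof (rule injI)
    have of_nat: "of_nat n = abs_hyp (\<lambda>_. of_nat n)" for n
    proof (induction n)
      case (Suc n)
      have "abs_hyp (\<lambda>_. of_nat n) + 1 = abs_hyp (\<lambda>_. of_nat n + 1)"
        unfolding one_hyp_def by (rule plus_hyp.abs_eq) (simp_all add: rel_refl_iff moderate_const)
      then show ?case using Suc by (simp add: add.commute)
    qed (simp add: zero_hyp_def)
    fix n m assume "of_nat n = (of_nat m :: hyp)"
    then have "rel (\<lambda>_. of_nat n) (\<lambda>_. of_nat m)"
      by (simp add: of_nat abs_hyp_eq_iff rel_def moderate_const)
    then have "bd (\<lambda>_. of_nat n - of_nat m) (-1)" by (simp add: rel_def negl_def)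
    from UU_ex[OF this[unfolded bd_def]] obtain x where x: "cmod (of_nat n - of_nat m) \<le> rho x powr - 1" by auto
    have "rho x powr - 1 < 1" using rho_ge_2[of x] by (simp add: powr_minus field_simps)
    moreover have "cmod (of_nat n - of_nat m) = \<bar>real n - real m\<bar>" by (metis norm_of_real of_real_diff of_real_of_nat_eq)
    ultimately show "n = m" using x by linarith
  qed
qed

lemma hyp_cases: obtains f where "moderate f" "a = abs_hyp f"
proof
  show "moderate (rep_hyp a)" using Quotient3_rep_reflp[OF Quotient3_hyp, of a] by (simp add: rel_refl_iff)
  show "a = abs_hyp (rep_hyp a)" using Quotient3_abs_rep[OF Quotient3_hyp, of a] by simp
qed

lemma abs_hyp_add: "moderate f \<Longrightarrow> moderate g \<Longrightarrow> abs_hyp f + abs_hyp g = abs_hyp (\<lambda>x. f x + g x)"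
  by (rule plus_hyp.abs_eq) (simp_all add: rel_refl_iff)
lemma abs_hyp_diff: "moderate f \<Longrightarrow> moderate g \<Longrightarrow> abs_hyp f - abs_hyp g = abs_hyp (\<lambda>x. f x - g x)"
  by (rule minus_hyp.abs_eq) (simp_all add: rel_refl_iff)
lemma abs_hyp_mult: "moderate f \<Longrightarrow> moderate g \<Longrightarrow> abs_hyp f * abs_hyp g = abs_hyp (\<lambda>x. f x * g x)"
  by (rule times_hyp.abs_eq) (simp_all add: rel_refl_iff)
lemma abs_hyp_inverse: "moderate f \<Longrightarrow> inverse (abs_hyp f) = abs_hyp (rinv f)"
  by (rule inverse_hyp.abs_eq) (simp add: rel_refl_iff)
lemma abs_hyp_0: "0 = abs_hyp (\<lambda>_. 0)" by (simp add: zero_hyp_def)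
lemma abs_hyp_1: "1 = abs_hyp (\<lambda>_. 1)" by (simp add: one_hyp_def)

lemma abs_hyp_eq_0_iff: "moderate f \<Longrightarrow> abs_hyp f = 0 \<longleftrightarrow> negl f"
  by (simp add: abs_hyp_0 abs_hyp_eq_iff moderate_const)

lemma moderate_sum: "(\<And>i. i \<in> I \<Longrightarrow> moderate (f i)) \<Longrightarrow> moderate (\<lambda>x. \<Sum>i\<in>I. f i x)"
  by (induction I rule: infinite_finite_induct) (auto intro: moderate_add simp: moderate_const)

lemma abs_hyp_sum:
  "(\<And>i. i \<in> I \<Longrightarrow> moderate (f i)) \<Longrightarrow> (\<Sum>i\<in>I. abs_hyp (f i)) = abs_hyp (\<lambda>x. \<Sum>i\<in>I. f i x)"
proof (induction I rule: infinite_finite_induct)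
  case (insert i I)
  then have "abs_hyp (f i) + (\<Sum>i\<in>I. abs_hyp (f i)) = abs_hyp (\<lambda>x. f i x + (\<Sum>i\<in>I. f i x))"
    using abs_hyp_add[of "f i" "\<lambda>x. \<Sum>i\<in>I. f i x"] by (simp add: moderate_sum)
  then show ?case using insert by simp
qed (simp_all add: abs_hyp_0)

lemma moderate_power: "moderate f \<Longrightarrow> moderate (\<lambda>x. f x ^ k)"
  by (induction k) (simp_all add: moderate_const moderate_mult)

lemma abs_hyp_power: "moderate f \<Longrightarrow> abs_hyp f ^ k = abs_hyp (\<lambda>x. f x ^ k)"
  by (induction k) (simp_all add: abs_hyp_1 abs_hyp_mult moderate_power)

lemma abs_hyp_of_nat: "of_nat k = abs_hyp (\<lambda>_. of_nat k)"
  by (induction k) (simp_all add: abs_hyp_0 abs_hyp_1 abs_hyp_add moderate_const)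

lemma abs_hyp_divide_of_nat:
  assumes "moderate f" "k > 0"
  shows "abs_hyp f / of_nat k = abs_hyp (\<lambda>x. f x / of_nat k)"
proof -
  have "moderate (\<lambda>x. f x / of_nat k)"
    using moderate_mult[OF assms(1) moderate_const[of "inverse (of_nat k)"]] by (simp add: field_simps)
  then have "abs_hyp (\<lambda>x. f x / of_nat k) * of_nat k = abs_hyp f"
    using assms by (simp add: abs_hyp_of_nat abs_hyp_mult moderate_const)
  then show ?thesis using assms(2) by (simp add: nonzero_divide_eq_eq)
qed

text \<open>Exponential of the growth exponent; the infimum over all representatives makes it depend
  on the class only. The class 0 is singled out because its exponents are unbounded below. The
  infimum need not be attained, so returning from norms to pointwise bounds takes a strict
  inequality.\<close>

definition nrm :: "hyp \<Rightarrow> real" where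
  "nrm a = (if a = 0 then 0 else exp (Inf {s. \<exists>f. moderate f \<and> abs_hyp f = a \<and> bd f s}))"

lemma nrm_zero: "nrm 0 = 0" by (simp add: nrm_def)
lemma nrm_pos: "a \<noteq> 0 \<Longrightarrow> nrm a > 0" by (simp add: nrm_def)
lemma nrm_nonneg: "nrm a \<ge> 0" by (simp add: nrm_def)

lemma bd_rep: "moderate f \<Longrightarrow> moderate g \<Longrightarrow> abs_hyp f = abs_hyp g \<Longrightarrow> bd f s \<Longrightarrow> s < t \<Longrightarrow> bd g t"
  by (rule bd_negl_diff) (simp_all add: abs_hyp_eq_iff)

lemma nrm_le:
  assumes "moderate f" "bd f s" shows "nrm (abs_hyp f) \<le> exp s"
proof (cases "abs_hyp f = 0")
  case False
  then obtain s0 where s0: "\<not> bd f s0" using assms(1) by (auto simp: abs_hyp_eq_0_iff negl_def)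
  have "bdd_below {s. \<exists>g. moderate g \<and> abs_hyp g = abs_hyp f \<and> bd g s}"
  proof (rule bdd_belowI)
    fix t assume "t \<in> {s. \<exists>g. moderate g \<and> abs_hyp g = abs_hyp f \<and> bd g s}"
    then obtain g where "moderate g" "abs_hyp g = abs_hyp f" "bd g t" by blast
    then show "s0 \<le> t" using bd_rep[of g f t s0] assms(1) s0 by (meson not_le)
  qed
  then have "Inf {s. \<exists>g. moderate g \<and> abs_hyp g = abs_hyp f \<and> bd g s} \<le> s"
    by (rule cInf_lower[rotated]) (use assms in blast)
  then show ?thesis using False by (simp add: nrm_def)
qed (simp add: nrm_zero)

lemma nrm_less_bd:
  assumes "moderate f" "nrm (abs_hyp f) < exp s" shows "bd f s"
proof (cases "abs_hyp f = 0")
  case True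
  then show ?thesis using assms(1) by (simp add: abs_hyp_eq_0_iff negl_def)
next
  case False
  let ?S = "{s. \<exists>g. moderate g \<and> abs_hyp g = abs_hyp f \<and> bd g s}"
  have "Inf ?S < s" using assms(2) False by (simp add: nrm_def)
  moreover have "?S \<noteq> {}" using assms(1) by (auto simp: moderate_def)
  ultimately have "\<exists>t\<in>?S. t < s" by (intro cInf_lessD)
  then obtain t where "t \<in> ?S" "t < s" by (rule bexE)
  then show ?thesis using bd_rep[OF _ assms(1)] by blast
qed

lemma nrm_leI:
  assumes "moderate f" "\<And>s. s > \<sigma> \<Longrightarrow> bd f s" shows "nrm (abs_hyp f) \<le> exp \<sigma>"
proof (rule ccontr)
  assume "\<not> ?thesis"
  then have n: "exp \<sigma> < nrm (abs_hyp f)" by simp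
  then have n0: "nrm (abs_hyp f) > 0" using exp_gt_zero less_trans by blast
  then have "\<sigma> < ln (nrm (abs_hyp f))" using n by (metis exp_less_cancel_iff exp_ln)
  then obtain s where s: "\<sigma> < s" "s < ln (nrm (abs_hyp f))" using dense by blast
  have "nrm (abs_hyp f) \<le> exp s" by (rule nrm_le[OF assms(1) assms(2)[OF s(1)]])
  also have "\<dots> < nrm (abs_hyp f)" using s(2) n0 by (metis exp_less_cancel_iff exp_ln)
  finally show False by simp
qed

lemma nrm_ge_1:
  assumes "moderate f" "eventually (\<lambda>x. cmod (f x) \<ge> 1) UU" shows "nrm (abs_hyp f) \<ge> 1"
proof (rule ccontr)
  assume "\<not> ?thesis"
  then have "nrm (abs_hyp f) < 1" by simp
  then obtain r where r: "max 0 (nrm (abs_hyp f)) < r" "r < 1" using dense[of "max 0 (nrm (abs_hyp f))" 1] by auto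
  then have "bd f (ln r)" using assms(1) by (intro nrm_less_bd) auto
  then obtain x where x: "1 \<le> cmod (f x)" "cmod (f x) \<le> rho x powr ln r"
    using UU_ex[OF eventually_conj[OF assms(2)]] unfolding bd_def by blast
  have "rho x powr ln r < 1" using rho_pos(2)[of x] r by (intro powr_less_one) auto
  then show False using x by linarith
qed

lemma nrm_const: "c \<noteq> 0 \<Longrightarrow> cmod c \<ge> 1 \<Longrightarrow> nrm (abs_hyp (\<lambda>_. c)) = 1"
  using nrm_leI[of "\<lambda>_. c" 0] nrm_ge_1[of "\<lambda>_. c"] by (simp add: moderate_const bd_const)

lemma nrm_of_nat: "k > 0 \<Longrightarrow> nrm (of_nat k) = 1"
  by (simp add: abs_hyp_of_nat nrm_const)

lemma nrm_mult_le: "nrm (a * b) \<le> nrm a * nrm b"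
proof (cases "a = 0 \<or> b = 0")
  case True then show ?thesis by (auto simp: nrm_zero)
next
  case False
  then have pos: "nrm a > 0" "nrm b > 0" by (simp_all add: nrm_pos)
  obtain f where f: "moderate f" "a = abs_hyp f" by (rule hyp_cases)
  obtain g where g: "moderate g" "b = abs_hyp g" by (rule hyp_cases)
  have "nrm (abs_hyp (\<lambda>x. f x * g x)) \<le> exp (ln (nrm a) + ln (nrm b))"
  proof (rule nrm_leI)
    show "moderate (\<lambda>x. f x * g x)" using f g by (simp add: moderate_mult)
    fix s assume s: "ln (nrm a) + ln (nrm b) < s"
    define d where "d = (s - ln (nrm a) - ln (nrm b)) / 2"
    have d: "d > 0" using s by (simp add: d_def)
    have "nrm a < exp (ln (nrm a) + d)" using pos d by (simp add: exp_add)
    then have 1: "bd f (ln (nrm a) + d)" using f by (intro nrm_less_bd) auto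
    have "nrm b < exp (ln (nrm b) + d)" using pos d by (simp add: exp_add)
    then have "bd g (ln (nrm b) + d)" using g by (intro nrm_less_bd) auto
    from bd_mult[OF 1 this] show "bd (\<lambda>x. f x * g x) s" by (simp add: d_def)
  qed
  then show ?thesis using pos f g by (simp add: exp_add abs_hyp_mult)
qed

lemma nrm_inverse_le: "b \<noteq> 0 \<Longrightarrow> nrm (inverse b) \<le> inverse (nrm b)"
proof -
  assume b: "b \<noteq> 0"
  obtain g where g: "moderate g" "b = abs_hyp g" by (rule hyp_cases)
  have n: "\<not> negl g" using b g by (simp add: abs_hyp_eq_0_iff)
  have pos: "nrm b > 0" using b by (rule nrm_pos)
  have "nrm (abs_hyp (rinv g)) \<le> exp (- ln (nrm b))"
  proof (rule nrm_leI)
    show "moderate (rinv g)" by (rule moderate_rinv)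
    fix s assume s: "- ln (nrm b) < s"
    have "\<not> bd g (- s)"
    proof
      assume "bd g (- s)"
      then have "nrm b \<le> exp (- s)" using g nrm_le by simp
      then have "ln (nrm b) \<le> - s" using pos by (metis exp_le_cancel_iff exp_ln)
      then show False using s by simp
    qed
    from bd_not_inverse[OF this] show "bd (rinv g) s" by (simp add: rinv_def n)
  qed
  then show ?thesis using pos g by (simp add: exp_minus abs_hyp_inverse)
qed

text \<open>Writing \<open>a = a * b * inverse b\<close> turns submultiplicativity into the reverse
  inequality.\<close>

lemma nrm_mult: "nrm (a * b) = nrm a * nrm b"
proof (cases "b = 0")
  case False
  have "nrm a = nrm (a * b * inverse b)" using False by (simp add: mult.assoc)
  also have "\<dots> \<le> nrm (a * b) * nrm (inverse b)" by (rule nrm_mult_le)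
  also have "\<dots> \<le> nrm (a * b) * inverse (nrm b)" by (intro mult_left_mono nrm_inverse_le nrm_nonneg False)
  finally have "nrm a * nrm b \<le> nrm (a * b)" using nrm_pos[OF False] by (simp add: field_simps)
  then show ?thesis using nrm_mult_le[of a b] by simp
qed (simp add: nrm_zero)

lemma nrm_add: "nrm (a + b) \<le> max (nrm a) (nrm b)"
proof (cases "a = 0 \<and> b = 0")
  case False
  define m where "m = max (nrm a) (nrm b)"
  have m: "m > 0" using False nrm_pos[of a] nrm_pos[of b] by (auto simp: m_def less_max_iff_disj)
  obtain f where f: "moderate f" "a = abs_hyp f" by (rule hyp_cases)
  obtain g where g: "moderate g" "b = abs_hyp g" by (rule hyp_cases)
  have "nrm (abs_hyp (\<lambda>x. f x + g x)) \<le> exp (ln m)"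
  proof (rule nrm_leI)
    show "moderate (\<lambda>x. f x + g x)" using f g by (simp add: moderate_add)
    fix s assume "ln m < s"
    then obtain t where t: "ln m < t" "t < s" using dense by blast
    have "m < exp t" using t(1) m by (metis exp_less_cancel_iff exp_ln)
    then have "nrm a < exp t" "nrm b < exp t" by (auto simp: m_def)
    then have "bd f t" "bd g t" using f g by (auto intro: nrm_less_bd)
    then show "bd (\<lambda>x. f x + g x) s" using t(2) by (rule bd_add)
  qed
  then show ?thesis using m f g by (simp add: abs_hyp_add m_def)
qed (simp add: nrm_zero)

lemma nrm_eventually:
  assumes "moderate f" "moderate g" "nrm (abs_hyp f - abs_hyp g) < exp s"
  shows "eventually (\<lambda>x. cmod (f x - g x) \<le> rho x powr s) UU"
  using nrm_less_bd[of "\<lambda>x. f x - g x" s] assms by (simp add: abs_hyp_diff moderate_diff bd_def)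

text \<open>Spherical completeness by diagonalisation: the limit follows the sequence as far as its
  finitely many estimates already hold.\<close>

lemma nrm_complete:
  assumes "\<And>i. nrm (a (Suc i) - a i) \<le> C / 2 ^ i"
  shows "\<exists>l. \<forall>i. nrm (l - a i) \<le> C / 2 ^ i"
proof (cases "C > 0")
  case False
  have "a (Suc i) - a i = 0" for i
  proof (rule ccontr)
    assume "a (Suc i) - a i \<noteq> 0"
    then have "0 < C / 2 ^ i" using assms[of i] nrm_pos by (meson less_le_trans)
    then show False using False by (simp add: zero_less_divide_iff)
  qed
  then have "a (Suc i) = a i" for i by simp
  then have eq: "a i = a 0" for i by (induction i) auto
  have "C / 2 ^ i \<ge> 0" for i using assms[of i] nrm_nonneg order_trans by blast
  then have "nrm (a 0 - a i) \<le> C / 2 ^ i" for i using eq[of i] by (simp add: nrm_zero)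
  then show ?thesis by blast
next
  case C: True
  have mono: "nrm (a (i + k) - a i) \<le> C / 2 ^ i" for i k
  proof (induction k)
    case (Suc k)
    have "nrm (a (i + Suc k) - a i) = nrm ((a (Suc (i + k)) - a (i + k)) + (a (i + k) - a i))" by simp
    also have "\<dots> \<le> max (nrm (a (Suc (i + k)) - a (i + k))) (nrm (a (i + k) - a i))" by (rule nrm_add)
    also have "\<dots> \<le> C / 2 ^ i"
    proof (rule max.boundedI[OF _ Suc])
      have "C / 2 ^ (i + k) \<le> C / 2 ^ i" using C by (intro divide_left_mono) auto
      then show "nrm (a (Suc (i + k)) - a (i + k)) \<le> C / 2 ^ i" using assms[of "i + k"] by linarith
    qed
    finally show ?case .
  qed (use C in \<open>simp add: nrm_zero\<close>)
  have "\<forall>i. \<exists>f. moderate f \<and> a i = abs_hyp f" by (meson hyp_cases)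
  then obtain X where X: "\<And>i. moderate (X i)" "\<And>i. a i = abs_hyp (X i)" by metis
  define \<sigma> where "\<sigma> = (\<lambda>i::nat. ln (C / 2 ^ i))"
  \<comment> \<open>The slack \<open>1 / real j\<close> turns norm bounds into pointwise bounds that
    hold eventually, and it disappears as \<open>j\<close> grows.\<close>
  define P where "P = (\<lambda>J x. \<forall>j\<le>J. \<forall>i<j. cmod (X j x - X i x) \<le> rho x powr (\<sigma> i + 1 / real j))"
  \<comment> \<open>The cap \<open>real J \<le> rho x\<close> makes the set finite; as
    \<open>rho\<close> tends to infinity, \<open>N x\<close> still exceeds every given
    \<open>J\<close> eventually.\<close>
  define N where "N = (\<lambda>x. Max {J. real J \<le> rho x \<and> P J x})"
  have "P 0 x" for x by (simp add: P_def)
  then have ne: "0 \<in> {J. real J \<le> rho x \<and> P J x}" for x using rho_pos(1)[of x] by auto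
  have fin: "finite {J. real J \<le> rho x \<and> P J x}" for x
  proof (rule finite_subset)
    show "{J. real J \<le> rho x \<and> P J x} \<subseteq> {..nat \<lfloor>rho x\<rfloor>}" by (auto simp: le_nat_floor)
  qed simp
  have PN: "P (N x) x" for x
    using Max_in[OF fin[of x]] ne[of x] unfolding N_def by blast
  have evP: "eventually (P J) UU" for J
  proof -
    have "eventually (\<lambda>x. cmod (X j x - X i x) \<le> rho x powr (\<sigma> i + 1 / real j)) UU" if "i < j" for i j
    proof (rule nrm_eventually[OF X(1) X(1)])
      have "nrm (abs_hyp (X j) - abs_hyp (X i)) \<le> exp (\<sigma> i)"
        using mono[of i "j - i"] that C by (simp add: X(2) \<sigma>_def)
      also have "\<dots> < exp (\<sigma> i + 1 / real j)" using that by simp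
      finally show "nrm (abs_hyp (X j) - abs_hyp (X i)) < exp (\<sigma> i + 1 / real j)" .
    qed
    then have "eventually (\<lambda>x. \<forall>j\<in>{..J}. \<forall>i\<in>{..<j}. cmod (X j x - X i x) \<le> rho x powr (\<sigma> i + 1 / real j)) UU"
      by (intro eventually_ball_finite ballI) auto
    then show ?thesis unfolding P_def by (rule eventually_mono) auto
  qed
  have N_ge: "eventually (\<lambda>x. N x \<ge> J) UU" for J
  proof -
    have "eventually (\<lambda>x. real J \<le> rho x) UU" using rho_lim unfolding filterlim_at_top by blast
    with evP[of J] show ?thesis
    proof eventually_elim
      case (elim x)
      then show ?case unfolding N_def by (intro Max_ge fin) simp
    qed
  qed
  define L where "L = (\<lambda>x. X (N x) x)"
  have L: "bd (\<lambda>x. L x - X i x) s" if s: "\<sigma> i < s" for i s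
  proof -
    obtain J0 :: nat where J0: "1 / (s - \<sigma> i) < real J0" using reals_Archimedean2 by blast
    show ?thesis unfolding bd_def using N_ge[of "max J0 (Suc i)"]
    proof eventually_elim
      case (elim x)
      have "cmod (L x - X i x) \<le> rho x powr (\<sigma> i + 1 / real (N x))"
        using PN[of x] elim unfolding P_def L_def by auto
      also have "\<dots> \<le> rho x powr s"
      proof (rule powr_mono)
        have "1 / (s - \<sigma> i) < real (N x)" using J0 elim by linarith
        then show "\<sigma> i + 1 / real (N x) \<le> s" using s elim by (simp add: field_simps)
        show "1 \<le> rho x" by (rule rho_pos)
      qed
      finally show ?case .
    qed
  qed
  have "moderate (\<lambda>x. (L x - X 0 x) + X 0 x)"
    using L[of 0 "\<sigma> 0 + 1"] X by (intro moderate_add) (auto simp: moderate_def)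
  then have mL: "moderate L" by simp
  have "nrm (abs_hyp L - a i) \<le> C / 2 ^ i" for i
  proof -
    have "nrm (abs_hyp (\<lambda>x. L x - X i x)) \<le> exp (\<sigma> i)"
      using mL X L by (intro nrm_leI moderate_diff)
    then show ?thesis using mL X C by (simp add: abs_hyp_diff \<sigma>_def)
  qed
  then show ?thesis by blast
qed

text \<open>The field \<open>K\<close>: functions constant in \<open>t\<close>. Transcendence over
  it expresses genuine dependence on \<open>t\<close>.\<close>

definition fst_hyp :: "hyp set" where
  "fst_hyp = {a. \<exists>f. moderate (\<lambda>x. f (fst x)) \<and> a = abs_hyp (\<lambda>x. f (fst x))}"

definition int_hyp :: "hyp set" where
  "int_hyp = {a. \<exists>f. moderate f \<and> (\<forall>x. f x \<in> \<int>) \<and> a = abs_hyp f}"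

lemma fst_hypI: "moderate (\<lambda>x. f (fst x)) \<Longrightarrow> abs_hyp (\<lambda>x. f (fst x)) \<in> fst_hyp"
  unfolding fst_hyp_def by blast

lemma int_hypI: "moderate f \<Longrightarrow> (\<And>x. f x \<in> \<int>) \<Longrightarrow> abs_hyp f \<in> int_hyp"
  unfolding int_hyp_def by blast

lemma subring_fst_hyp: "subring fst_hyp"
proof (rule subringI)
  show "1 \<in> fst_hyp" unfolding abs_hyp_1 using fst_hypI[of "\<lambda>_. 1"] by (simp add: moderate_const)
  fix a b assume "a \<in> fst_hyp" "b \<in> fst_hyp"
  then obtain f g where fg: "moderate (\<lambda>x. f (fst x))" "a = abs_hyp (\<lambda>x. f (fst x))"
    "moderate (\<lambda>x. g (fst x))" "b = abs_hyp (\<lambda>x. g (fst x))" unfolding fst_hyp_def by blast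
  show "a - b \<in> fst_hyp" using fst_hypI[of "\<lambda>n. f n - g n"] fg by (simp add: abs_hyp_diff moderate_diff)
  show "a * b \<in> fst_hyp" using fst_hypI[of "\<lambda>n. f n * g n"] fg by (simp add: abs_hyp_mult moderate_mult)
qed

lemma fst_hyp_inverse: "a \<in> fst_hyp \<Longrightarrow> inverse a \<in> fst_hyp"
proof -
  assume "a \<in> fst_hyp"
  then obtain f where f: "moderate (\<lambda>x. f (fst x))" "a = abs_hyp (\<lambda>x. f (fst x))" unfolding fst_hyp_def by blast
  have m: "moderate (rinv (\<lambda>x. f (fst x)))" by (rule moderate_rinv)
  show ?thesis
  proof (cases "negl (\<lambda>x. f (fst x))")
    case True
    then show ?thesis using fst_hypI[of "\<lambda>_. 0"] f m by (simp add: abs_hyp_inverse rinv_def)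
  next
    case False
    then show ?thesis using fst_hypI[of "\<lambda>n. inverse (f n)"] f m by (simp add: abs_hyp_inverse rinv_def)
  qed
qed

lemma subring_int_hyp: "subring int_hyp"
proof (rule subringI)
  show "1 \<in> int_hyp" unfolding abs_hyp_1 by (rule int_hypI) (simp_all add: moderate_const)
  fix a b assume "a \<in> int_hyp" "b \<in> int_hyp"
  then obtain f g where fg: "moderate f" "a = abs_hyp f" "\<And>x. f x \<in> \<int>"
    "moderate g" "b = abs_hyp g" "\<And>x. g x \<in> \<int>" unfolding int_hyp_def by blast
  show "a - b \<in> int_hyp" using int_hypI[of "\<lambda>x. f x - g x"] fg by (simp add: abs_hyp_diff moderate_diff)
  show "a * b \<in> int_hyp" using int_hypI[of "\<lambda>x. f x * g x"] fg by (simp add: abs_hyp_mult moderate_mult)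
qed

lemma int_norm_ge_1: "(z::complex) \<in> \<int> \<Longrightarrow> z \<noteq> 0 \<Longrightarrow> cmod z \<ge> 1"
proof -
  assume "z \<in> \<int>" "z \<noteq> 0"
  then obtain k :: int where "z = of_int k" "k \<noteq> 0" by (auto elim: Ints_cases)
  then show ?thesis by simp
qed

lemma int_hyp_discrete:
  assumes "a \<in> int_hyp" "a \<noteq> 0" shows "nrm a \<ge> 1"
proof -
  obtain f where f: "moderate f" "a = abs_hyp f" "\<And>x. f x \<in> \<int>" using assms(1) unfolding int_hyp_def by blast
  have "\<not> negl f" using assms(2) f by (simp add: abs_hyp_eq_0_iff)
  from not_negl_nonzero[OF this] have "eventually (\<lambda>x. cmod (f x) \<ge> 1) UU"
    by (rule eventually_mono) (rule int_norm_ge_1[OF f(3)])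
  then show ?thesis using nrm_ge_1 f by simp
qed

definition rho_hyp :: hyp where "rho_hyp = abs_hyp (\<lambda>x. of_real (rho x))"

lemma bd_rho: "bd (\<lambda>x. of_real (rho x)) 1"
  unfolding bd_def by (rule always_eventually) (use rho_pos in \<open>simp add: less_imp_le abs_of_pos\<close>)

lemma moderate_rho: "moderate (\<lambda>x. of_real (rho x))" using bd_rho by (auto simp: moderate_def)

lemma nrm_rho: "nrm rho_hyp = exp 1"
proof (rule antisym)
  show "nrm rho_hyp \<le> exp 1" unfolding rho_hyp_def by (rule nrm_le[OF moderate_rho bd_rho])
  show "exp 1 \<le> nrm rho_hyp"
  proof (rule ccontr)
    assume "\<not> ?thesis"
    then have "nrm rho_hyp < exp 1" by simp
    then obtain r where r: "max 0 (nrm rho_hyp) < r" "r < exp 1" using dense[of "max 0 (nrm rho_hyp)" "exp 1"] by auto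
    have l: "ln r < 1" using r by (metis exp_less_cancel_iff exp_ln max_less_iff_conj)
    have "bd (\<lambda>x. of_real (rho x)) (ln r)" using r by (intro nrm_less_bd moderate_rho) (auto simp: rho_hyp_def)
    then obtain x where "cmod (of_real (rho x)) \<le> rho x powr ln r" unfolding bd_def using UU_ex by blast
    moreover have "rho x powr ln r < rho x powr 1" using l rho_pos[of x] by (intro powr_less_mono) auto
    ultimately show False using rho_pos[of x] by simp
  qed
qed

lemma valued_hyp: "valued nrm fst_hyp"
  by unfold_locales (auto simp: nrm_zero nrm_pos nrm_mult nrm_add nrm_of_nat subring_fst_hyp fst_hyp_inverse intro: nrm_complete)

text \<open>An ultrafilter that contains a finite union contains one of the sets. This fixes one
  coordinate at which the Siegel solutions are nonzero along the ultrafilter.\<close>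

lemma UU_bex:
  assumes "finite I" "eventually (\<lambda>x. \<exists>i\<in>I. P i x) UU"
  shows "\<exists>i\<in>I. eventually (P i) UU"
proof (rule ccontr)
  assume "\<not> ?thesis"
  then have "eventually (\<lambda>x. \<not> P i x) UU" if "i \<in> I" for i using that by (intro UU_not) blast
  then have "eventually (\<lambda>x. \<forall>i\<in>I. \<not> P i x) UU" using assms(1) by (intro eventually_ball_finite ballI)
  from UU_ex[OF eventually_conj[OF assms(2) this]] show False by blast
qed

text \<open>\<open>siegel_complex\<close> is applied for each \<open>n\<close> separately. The
  linear forms depend on \<open>n\<close> only, so the chosen solution \<open>v n\<close> does too
  and its entries lie in \<open>fst_hyp\<close>.\<close>

lemma siegel_hyp:
  fixes ell :: "'j \<Rightarrow> 'i \<Rightarrow> hyp"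
  assumes I: "finite I" and J: "finite J"
    and ell: "\<And>i j. i \<in> I \<Longrightarrow> j \<in> J \<Longrightarrow> ell j i \<in> fst_hyp \<and> nrm (ell j i) \<le> exp c"
    and pos: "0 \<le> h" "0 \<le> B" "0 \<le> c" and count: "2 * real (card J) * (h + c + B) < h * real (card I)"
  shows "\<exists>x. (\<forall>i\<in>I. x i \<in> fst_hyp \<and> x i \<in> int_hyp \<and> nrm (x i) \<le> exp h) \<and> (\<exists>i\<in>I. x i \<noteq> 0) \<and>
    (\<forall>j\<in>J. nrm (\<Sum>i\<in>I. x i * ell j i) \<le> exp (- B))"
proof -
  define a where "a = (\<lambda>j i. SOME f. moderate (\<lambda>x. f (fst x)) \<and> ell j i = abs_hyp (\<lambda>x. f (fst x)))"
  have "moderate (\<lambda>x. a j i (fst x)) \<and> ell j i = abs_hyp (\<lambda>x. a j i (fst x))" if "i \<in> I" "j \<in> J" for i j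
  proof -
    have "\<exists>f. moderate (\<lambda>x. f (fst x)) \<and> ell j i = abs_hyp (\<lambda>x. f (fst x))"
      using ell[OF that] by (simp add: fst_hyp_def)
    then show ?thesis unfolding a_def by (rule someI_ex)
  qed
  then have a: "\<And>i j. i \<in> I \<Longrightarrow> j \<in> J \<Longrightarrow> moderate (\<lambda>x. a j i (fst x))"
    "\<And>i j. i \<in> I \<Longrightarrow> j \<in> J \<Longrightarrow> ell j i = abs_hyp (\<lambda>x. a j i (fst x))" by simp_all
  \<comment> \<open>The strict inequality between exponents leaves room for \<eta>, which is paid
    twice on each of \<open>2 * card J\<close> coordinates: for passing from norms to pointwise
    bounds, and for constant factors.\<close>
  define gap where "gap = h * real (card I) - 2 * real (card J) * (h + c + B)"
  define \<eta> where "\<eta> = gap / (4 * real (card J) + 1)"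
  have gap: "gap > 0" using count by (simp add: gap_def)
  then have \<eta>: "\<eta> > 0" by (simp add: \<eta>_def)
  have gap\<eta>: "4 * real (card J) * \<eta> < gap"
  proof -
    have "(4 * real (card J) + 1) * \<eta> = gap" unfolding \<eta>_def by (simp add: add_pos_nonneg less_imp_neq[symmetric] del: of_nat_mult)
    then show ?thesis using \<eta> by (simp add: distrib_right)
  qed
  define r where "r = (\<lambda>n. rho (n, 0))"
  have r: "rho x = r (fst x)" for x by (simp add: r_def rho_def)
  define H where "H = (\<lambda>n. nat \<lfloor>r n powr h\<rfloor>)"
  define good where "good = (\<lambda>n (v :: 'i \<Rightarrow> int). (\<forall>i\<in>I. \<bar>v i\<bar> \<le> int (H n)) \<and> (\<exists>i\<in>I. v i \<noteq> 0) \<and>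
     (\<forall>j\<in>J. cmod (\<Sum>i\<in>I. of_int (v i) * a j i n) \<le> r n powr - B))"
  define v where "v = (\<lambda>n. SOME v. good n v)"
  have r2: "r n \<ge> 2" for n unfolding r_def by (rule rho_ge_2)
  have ev_a: "eventually (\<lambda>x. cmod (a j i (fst x)) \<le> r (fst x) powr (c + \<eta>)) UU" if "i \<in> I" "j \<in> J" for i j
  proof -
    have "nrm (abs_hyp (\<lambda>x. a j i (fst x))) \<le> exp c" using ell a(2) that by simp
    also have "exp c < exp (c + \<eta>)" using \<eta> by simp
    finally have "bd (\<lambda>x. a j i (fst x)) (c + \<eta>)" by (rule nrm_less_bd[OF a(1)[OF that]])
    then show ?thesis by (simp add: bd_def r)
  qed
  have "eventually (\<lambda>x. \<forall>i\<in>I. \<forall>j\<in>J. cmod (a j i (fst x)) \<le> r (fst x) powr (c + \<eta>)) UU"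
    using ev_a by (intro eventually_ball_finite ballI I J)
  moreover have "eventually (\<lambda>x. 4 * real (card I) + 5 \<le> rho x powr \<eta>) UU"
    by (rule const_le_rho[OF \<eta>])
  ultimately have "eventually (\<lambda>x. good (fst x) (v (fst x))) UU"
  proof eventually_elim
    case (elim x)
    define n where "n = fst x"
    have rn: "r n \<ge> 2" "r n > 0" "r n \<ge> 1" using r2[of n] by auto
    define M where "M = nat \<lceil>2 * real (card I) * real (H n) * r n powr (c + \<eta>) / r n powr - B + 1\<rceil>"
    have Hr: "real (H n) \<le> r n powr h" unfolding H_def by (simp add: of_nat_floor)
    have "\<exists>v :: 'i \<Rightarrow> int. good n v" unfolding good_def
    proof (rule siegel_complex[OF I J])
      show "cmod (a j i n) \<le> r n powr (c + \<eta>)" if "i \<in> I" "j \<in> J" for i j using elim(1) that by (simp add: n_def)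
      show "0 < r n powr - B" using rn by simp
      show "2 * real (card I) * real (H n) * r n powr (c + \<eta>) / r n powr - B + 1 \<le> real M"
        unfolding M_def by (rule real_nat_ceiling_ge)
      \<comment> \<open>Collects the powers of the scale in the number of cells; the remaining
        constant is at most \<open>r n powr \<eta>\<close>.\<close>
      define Q where "Q = r n powr (h + c + B + \<eta>)"
      have Q1: "Q \<ge> 1" unfolding Q_def using rn pos \<eta> by (intro ge_one_powr_ge_zero) auto
      have Mle: "real M \<le> 2 * real (card I) * Q + 2"
      proof -
        have "2 * real (card I) * real (H n) * r n powr (c + \<eta>) / r n powr - B
          = 2 * real (card I) * (real (H n) * r n powr (c + \<eta>) * r n powr B)" by (simp add: powr_minus divide_inverse)
        also have "\<dots> \<le> 2 * real (card I) * (r n powr h * r n powr (c + \<eta>) * r n powr B)"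
          by (intro mult_left_mono mult_right_mono Hr) auto
        also have "r n powr h * r n powr (c + \<eta>) * r n powr B = Q" by (simp add: Q_def add_ac flip: powr_add)
        finally have *: "2 * real (card I) * real (H n) * r n powr (c + \<eta>) / r n powr - B \<le> 2 * real (card I) * Q" .
        have "0 \<le> 2 * real (card I) * real (H n) * r n powr (c + \<eta>) / r n powr - B" by simp
        then show ?thesis unfolding M_def using * by linarith
      qed
      have "real (2 * M + 1) \<le> 4 * real (card I) * Q + 5" using Mle by simp
      also have "\<dots> \<le> (4 * real (card I) + 5) * Q" using Q1 by (simp add: distrib_right)
      also have "\<dots> \<le> r n powr \<eta> * Q" using elim(2) Q1 by (intro mult_right_mono) (auto simp: r n_def)
      also have "\<dots> = r n powr (h + c + B + 2 * \<eta>)" by (simp add: Q_def add_ac flip: powr_add)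
      finally have "real (2 * M + 1) ^ (2 * card J) \<le> (r n powr (h + c + B + 2 * \<eta>)) ^ (2 * card J)"
        by (intro power_mono) auto
      also have "\<dots> = r n powr (real (2 * card J) * (h + c + B + 2 * \<eta>))"
        using rn by (simp add: powr_power mult.commute)
      also have "\<dots> < r n powr (h * real (card I))"
        using gap\<eta> rn by (intro powr_less_mono) (simp_all add: gap_def algebra_simps)
      also have "\<dots> = (r n powr h) ^ card I" using rn by (simp add: powr_power mult.commute)
      also have "\<dots> \<le> real (H n + 1) ^ card I"
      proof (rule power_mono)
        have "r n powr h \<ge> 0" by simp
        then show "r n powr h \<le> real (H n + 1)" unfolding H_def by linarith
      qed simp
      finally have "real ((2 * M + 1) ^ (2 * card J)) < real ((H n + 1) ^ card I)" by simp
      then show "(2 * M + 1) ^ (2 * card J) < (H n + 1) ^ card I" unfolding of_nat_less_iff .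
    qed
    then show ?case unfolding v_def n_def[symmetric] by (rule someI_ex)
  qed
  then have ev: "eventually (\<lambda>x. \<forall>i\<in>I. \<bar>v (fst x) i\<bar> \<le> int (H (fst x))) UU"
    "eventually (\<lambda>x. \<exists>i\<in>I. v (fst x) i \<noteq> 0) UU"
    "eventually (\<lambda>x. \<forall>j\<in>J. cmod (\<Sum>i\<in>I. of_int (v (fst x) i) * a j i (fst x)) \<le> rho x powr - B) UU"
    by (rule eventually_mono, simp add: good_def r)+
  define f where "f = (\<lambda>i (x :: nat \<times> nat). of_int (v (fst x) i) :: complex)"
  have bdf: "bd (f i) h" if "i \<in> I" for i unfolding bd_def using ev(1)
  proof eventually_elim
    case (elim x)
    then have "\<bar>v (fst x) i\<bar> \<le> int (H (fst x))" using that by blast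
    then have "real_of_int \<bar>v (fst x) i\<bar> \<le> real_of_int (int (H (fst x)))" by (simp only: of_int_le_iff)
    also have "\<dots> \<le> r (fst x) powr h" unfolding H_def by (simp add: of_nat_floor)
    finally show ?case by (simp add: f_def r)
  qed
  then have mf: "moderate (f i)" if "i \<in> I" for i using that unfolding moderate_def by blast
  obtain i0 where i0: "i0 \<in> I" "eventually (\<lambda>x. v (fst x) i0 \<noteq> 0) UU" using UU_bex[OF I ev(2)] by blast
  show ?thesis
  proof (intro exI[of _ "\<lambda>i. abs_hyp (f i)"] conjI ballI bexI[of _ i0] i0)
    fix i assume i: "i \<in> I"
    show "abs_hyp (f i) \<in> fst_hyp" using mf[OF i] unfolding f_def by (rule fst_hypI)
    show "abs_hyp (f i) \<in> int_hyp" using mf[OF i] by (rule int_hypI) (simp add: f_def)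
    show "nrm (abs_hyp (f i)) \<le> exp h" by (rule nrm_le[OF mf[OF i] bdf[OF i]])
  next
    have "eventually (\<lambda>x. cmod (f i0 x) \<ge> 1) UU"
      using i0(2) by (rule eventually_mono) (simp add: f_def flip: of_int_abs)
    from nrm_ge_1[OF mf[OF i0(1)] this] show "abs_hyp (f i0) \<noteq> 0" by (auto simp: nrm_zero)
  next
    fix j assume j: "j \<in> J"
    have "(\<Sum>i\<in>I. abs_hyp (f i) * ell j i) = (\<Sum>i\<in>I. abs_hyp (\<lambda>x. f i x * a j i (fst x)))"
      using mf a j by (intro sum.cong refl) (simp add: abs_hyp_mult)
    also have "\<dots> = abs_hyp (\<lambda>x. \<Sum>i\<in>I. f i x * a j i (fst x))"
      using mf a j by (intro abs_hyp_sum moderate_mult)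
    finally have eq: "(\<Sum>i\<in>I. abs_hyp (f i) * ell j i) = abs_hyp (\<lambda>x. \<Sum>i\<in>I. f i x * a j i (fst x))" .
    show "nrm (\<Sum>i\<in>I. abs_hyp (f i) * ell j i) \<le> exp (- B)" unfolding eq
    proof (rule nrm_le)
      show "moderate (\<lambda>x. \<Sum>i\<in>I. f i x * a j i (fst x))" using mf a j by (intro moderate_sum moderate_mult)
      show "bd (\<lambda>x. \<Sum>i\<in>I. f i x * a j i (fst x)) (- B)"
        unfolding bd_def f_def using ev(3) by (rule eventually_mono) (use j in blast)
    qed
  qed
qed

lemma arith_valued_hyp:
  assumes "\<And>x. rho x \<in> \<int>" shows "arith_valued nrm fst_hyp int_hyp rho_hyp"
proof -
  interpret valued nrm fst_hyp by (rule valued_hyp)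
  show ?thesis
  proof
    have "of_real (rho x) \<in> (\<int> :: complex set)" for x using assms[of x] by (auto elim!: Ints_cases)
    then show "rho_hyp \<in> int_hyp" unfolding rho_hyp_def by (intro int_hypI moderate_rho)
  qed (rule subring_int_hyp int_hyp_discrete nrm_rho siegel_hyp; assumption)+
qed

section \<open>Transcendence over \<open>K\<close> and the contradiction\<close>

lemma poly_abs_hyp:
  assumes "\<And>k. k \<le> degree f \<Longrightarrow> moderate (\<lambda>x. g k (fst x)) \<and> coeff f k = abs_hyp (\<lambda>x. g k (fst x))" "moderate u"
  shows "poly f (abs_hyp u) = abs_hyp (\<lambda>x. \<Sum>k\<le>degree f. g k (fst x) * u x ^ k)"
    and "moderate (\<lambda>x. \<Sum>k\<le>degree f. g k (fst x) * u x ^ k)"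
proof -
  have "poly f (abs_hyp u) = (\<Sum>k\<le>degree f. abs_hyp (\<lambda>x. g k (fst x) * u x ^ k))"
    unfolding poly_altdef using assms by (intro sum.cong) (simp_all add: abs_hyp_power abs_hyp_mult moderate_power)
  also have "\<dots> = abs_hyp (\<lambda>x. \<Sum>k\<le>degree f. g k (fst x) * u x ^ k)"
    using assms by (intro abs_hyp_sum moderate_mult moderate_power) auto
  finally show "poly f (abs_hyp u) = abs_hyp (\<lambda>x. \<Sum>k\<le>degree f. g k (fst x) * u x ^ k)" .
  show "moderate (\<lambda>x. \<Sum>k\<le>degree f. g k (fst x) * u x ^ k)"
    using assms by (intro moderate_sum moderate_mult moderate_power) auto
qed

text \<open>A relation of degree \<open>d\<close> over \<open>fst_hyp\<close> gives for each
  \<open>n\<close> a monic polynomial that is tiny at \<open>u (n, t)\<close> for many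
  \<open>t\<close>. As \<open>rho * u\<close> is integral, distinct values over the same
  \<open>n\<close> are at least \<open>1 / r\<close> apart, and \<open>d + 1\<close> of them
  contradict \<open>monic_small_values\<close>.\<close>

lemma transc_hyp:
  fixes u :: "nat \<times> nat \<Rightarrow> real"
  assumes mu: "moderate (\<lambda>x. of_real (u x))" and int: "\<And>x. rho x * u x \<in> \<int>"
    and fib: "\<And>A d. eventually A UU \<Longrightarrow>
      \<exists>n T. finite T \<and> card T = d \<and> (\<forall>t\<in>T. A (n, t)) \<and> inj_on (\<lambda>t. u (n, t)) T"
  shows "transc fst_hyp (abs_hyp (\<lambda>x. of_real (u x)))"
  unfolding transc_def
proof (intro ballI impI, rule ccontr)
  fix f assume f: "f \<in> polys_over fst_hyp" "poly f (abs_hyp (\<lambda>x. of_real (u x))) = 0" "f \<noteq> 0"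
  define g where "g = smult (inverse (lead_coeff f)) f"
  define d where "d = degree g"
  have lf: "lead_coeff f \<in> fst_hyp" using f(1) by (simp add: polys_over_def)
  have g: "coeff g k \<in> fst_hyp" for k
  proof -
    have "coeff f k \<in> fst_hyp" using f(1) by (simp add: polys_over_def)
    with fst_hyp_inverse[OF lf] show ?thesis using subring_fst_hyp by (simp add: g_def subring_def)
  qed
  have lg: "coeff g d = 1" using f(3) by (simp add: g_def d_def)
  have pg: "poly g (abs_hyp (\<lambda>x. of_real (u x))) = 0" using f(2) by (simp add: g_def)
  define h0 where "h0 = (\<lambda>k. SOME h. moderate (\<lambda>x. h (fst x)) \<and> coeff g k = abs_hyp (\<lambda>x. h (fst x)))"
  have h0: "moderate (\<lambda>x. h0 k (fst x)) \<and> coeff g k = abs_hyp (\<lambda>x. h0 k (fst x))" for k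
  proof -
    have "\<exists>h. moderate (\<lambda>x. h (fst x)) \<and> coeff g k = abs_hyp (\<lambda>x. h (fst x))"
      using g[of k] by (simp add: fst_hyp_def)
    then show ?thesis unfolding h0_def by (rule someI_ex)
  qed
  \<comment> \<open>The top coefficient is represented by the constant function 1, so that the
    polynomial is monic for every \<open>n\<close>.\<close>
  define h where "h = (\<lambda>k n. if k < d then h0 k n else 1)"
  have h: "moderate (\<lambda>x. h k (fst x)) \<and> coeff g k = abs_hyp (\<lambda>x. h k (fst x))" if "k \<le> degree g" for k
  proof (cases "k = d")
    case True then show ?thesis using lg by (simp add: h_def moderate_const abs_hyp_1)
  next
    case False then show ?thesis using h0[of k] that by (simp add: h_def d_def)
  qed
  define F where "F = (\<lambda>n. monom 1 d + (\<Sum>k<d. monom (h k n) k))"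
  have dS: "degree (\<Sum>k<d. monom (h k n) k) < d" if "d > 0" for n
    using that by (intro degree_sum_less) (auto intro: le_less_trans[OF degree_monom_le])
  have dF: "degree (F n) = d" and lF: "coeff (F n) d = 1" for n
  proof -
    show "degree (F n) = d"
    proof (cases "d = 0")
      case False
      then show ?thesis unfolding F_def using dS[of n]
        by (subst degree_add_eq_left) (simp_all add: degree_monom_eq)
    qed (simp add: F_def)
    show "coeff (F n) d = 1" by (simp add: F_def coeff_sum)
  qed
  have pF: "poly (F n) z = (\<Sum>k\<le>d. h k n * z ^ k)" for n z
  proof -
    have "{..d} = insert d {..<d}" by auto
    then show ?thesis by (simp add: F_def poly_sum poly_monom h_def)
  qed
  note P = poly_abs_hyp[OF h mu, folded d_def]
  have "negl (\<lambda>x. \<Sum>k\<le>d. h k (fst x) * of_real (u x) ^ k)"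
    using P pg by (simp add: abs_hyp_eq_0_iff)
  \<comment> \<open>In the exponent \<open>2 * d + 1\<close>, \<open>d\<close> pays for the
    separation \<open>1 / r\<close>, another \<open>d\<close> for the factors 2 (as
    \<open>2 \<le> r\<close>), and 1 is left for the contradiction.\<close>
  then have "eventually (\<lambda>x. cmod (poly (F (fst x)) (of_real (u x))) \<le> rho x powr (- real (2 * d + 1))) UU"
    unfolding negl_def bd_def pF by blast
  from fib[OF this, of "d + 1"] obtain n T where T: "finite T" "card T = d + 1"
    "\<And>t. t \<in> T \<Longrightarrow> cmod (poly (F n) (of_real (u (n, t)))) \<le> rho (n, t) powr (- real (2 * d + 1))"
    "inj_on (\<lambda>t. u (n, t)) T" by auto
  define r where "r = rho (n, 0)"
  have r: "rho (n, t) = r" for t by (simp add: r_def rho_def)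
  have r2: "r \<ge> 2" "r > 0" unfolding r_def using rho_ge_2[of "(n, 0)"] by auto
  have "1 \<le> r powr (- real (2 * d + 1)) * (2 / (1 / r)) ^ degree (F n)"
  proof (rule monic_small_values[where T = T and w = "\<lambda>t. of_real (u (n, t))"])
    show "lead_coeff (F n) = 1" "degree (F n) < card T" using dF lF T by simp_all
    show "inj_on (\<lambda>t. complex_of_real (u (n, t))) T" using T(4) by (simp add: inj_on_def)
    show "0 < 1 / r" "1 / r \<le> 1" using r2 by simp_all
    show "cmod (poly (F n) (of_real (u (n, t)))) \<le> r powr (- real (2 * d + 1))" if "t \<in> T" for t
      using T(3)[OF that] by (simp add: r)
    fix s t assume st: "s \<in> T" "t \<in> T" "s \<noteq> t"
    then have "u (n, s) \<noteq> u (n, t)" using T(4) by (auto simp: inj_on_def)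
    moreover have "r * u (n, s) - r * u (n, t) \<in> \<int>" using int[of "(n, s)"] int[of "(n, t)"] r by auto
    ultimately have "\<bar>r * u (n, s) - r * u (n, t)\<bar> \<ge> 1" using r2 by (intro Ints_nonzero_abs_ge1) auto
    then have "1 \<le> r * \<bar>u (n, s) - u (n, t)\<bar>" using r2 by (simp add: abs_mult flip: right_diff_distrib)
    then have "1 / r \<le> \<bar>u (n, s) - u (n, t)\<bar>" using r2 by (simp add: field_simps)
    then show "1 / r \<le> cmod (complex_of_real (u (n, s)) - complex_of_real (u (n, t)))"
      by (simp flip: of_real_diff)
  qed (use T in auto)
  also have "r powr (- real (2 * d + 1)) = inverse (r ^ (2 * d + 1))"
    unfolding powr_minus powr_realpow[OF r2(2)] ..
  also have "inverse (r ^ (2 * d + 1)) * (2 / (1 / r)) ^ degree (F n) = inverse (r ^ (2 * d + 1)) * (2 * r) ^ d"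
    by (simp add: dF)
  also have "\<dots> \<le> inverse (r ^ (2 * d + 1)) * (r * r) ^ d"
    using r2 by (intro mult_left_mono power_mono mult_right_mono) auto
  also have "(r * r) ^ d = r ^ (2 * d)" by (simp add: power_mult power2_eq_square)
  also have "inverse (r ^ (2 * d + 1)) * r ^ (2 * d) = 1 / r" using r2 by (simp add: field_simps)
  finally show False using r2 by simp
qed

text \<open>If any admissible scale is exceptional, so is the one from which the field was built.
  Over that field the tiny sum is an exact linear relation, which
  \<open>exponential_sums_independent\<close> excludes.\<close>

theorem not_exceptional:
  assumes "admissible z" shows "\<not> exceptional z"
proof
  assume "exceptional z"
  then have ex: "exceptional scale" using assms scale(2) by blast
  obtain \<rho> U where sc: "scale = (\<rho>, U)" by (rule prod.exhaust)
  have rho: "rho x = \<rho> (fst x)" and UU: "UU = U" for x by (simp_all add: rho_def UU_def sc)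
  have rho_int: "\<And>n. \<rho> n \<in> \<int>" and "\<exists>m y c e. small_sum \<rho> U m y c e"
    using ex by (simp_all add: exceptional_def sc)
  then obtain m y c e where ss: "small_sum \<rho> U m y c e" by (elim exE)
  have m: "m > 0" "e > 0"
    and y: "\<And>i x. i < m \<Longrightarrow> \<bar>y i x\<bar> \<le> rho x powr - e" "\<And>i x. i < m \<Longrightarrow> rho x * y i x \<in> \<int>"
    and c1: "\<And>i n. i < m \<Longrightarrow> cmod (c i n) \<ge> 1" and cb: "\<And>i. i < m \<Longrightarrow> \<exists>s. \<forall>n. cmod (c i n) \<le> \<rho> n powr s"
    and small: "\<And>s. eventually (\<lambda>x. cmod (\<Sum>i<m. c i (fst x) * exp (2 * pi * \<i> * y i x)) \<le> rho x powr s) UU"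
    using ss by (simp_all add: small_sum_def rho UU del: split_paired_All)
  have fib: "\<exists>n T. finite T \<and> card T = d \<and> (\<forall>t\<in>T. A (n, t)) \<and> inj_on (\<lambda>t. y i (n, t) - y j (n, t)) T"
    if "i < m" "j < m" "i \<noteq> j" "eventually A UU" for i j A d
    using ss that unfolding small_sum_def UU by blast
  interpret arith_valued nrm fst_hyp int_hyp rho_hyp
    by (rule arith_valued_hyp) (simp add: rho rho_int)
  define Y where "Y = (\<lambda>i. abs_hyp (\<lambda>x. of_real (y i x)))"
  define E where "E = (\<lambda>i. abs_hyp (\<lambda>x. exp (2 * pi * \<i> * y i x)))"
  define C where "C = (\<lambda>i. abs_hyp (\<lambda>x. c i (fst x)))"
  define w where "w = abs_hyp (\<lambda>_. 2 * pi * \<i>)"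
  have bdy: "bd (\<lambda>x. of_real (y i x)) (- e)" if "i < m" for i
    unfolding bd_def using y(1)[OF that] by simp
  have my: "moderate (\<lambda>x. of_real (y i x))" if "i < m" for i using bdy[OF that] unfolding moderate_def by blast
  have nE: "cmod (exp (2 * pi * \<i> * y i x)) = 1" for i x by (simp add: norm_exp_eq_Re)
  have mE: "moderate (\<lambda>x. exp (2 * pi * \<i> * y i x))" for i
    unfolding moderate_def bd_def nE by (rule exI[of _ 0]) (use rho_pos(1) in \<open>simp add: less_imp_neq[symmetric]\<close>)
  have mC: "moderate (\<lambda>x. c i (fst x))" if "i < m" for i
    using cb[OF that] unfolding moderate_def bd_def rho by (auto intro: always_eventually)
  have "(\<Sum>i<m. C i * E i) \<noteq> 0"
  proof (rule exponential_sums_independent)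
    show "0 < exp (- e)" "exp (- e) < 1" using m by simp_all
    show "nrm (Y i) \<le> exp (- e)" if "i < m" for i unfolding Y_def by (rule nrm_le[OF my bdy]) (rule that)+
    show "rho_hyp * Y i \<in> int_hyp" if "i < m" for i
    proof -
      have "of_real (rho x) * of_real (y i x) \<in> (\<int> :: complex set)" for x
        using y(2)[OF that, of x] by (auto elim!: Ints_cases simp flip: of_real_mult)
      then have "abs_hyp (\<lambda>x. of_real (rho x) * of_real (y i x)) \<in> int_hyp"
        using my[OF that] moderate_rho by (intro int_hypI moderate_mult)
      then show ?thesis using my[OF that] moderate_rho by (simp add: rho_hyp_def Y_def abs_hyp_mult)
    qed
    show "transc fst_hyp (Y i - Y j)" if ij: "i < m" "j < m" "i \<noteq> j" for i j
    proof -
      have "Y i - Y j = abs_hyp (\<lambda>x. of_real (y i x - y j x))"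
        using my ij by (simp add: Y_def abs_hyp_diff)
      moreover have "transc fst_hyp (abs_hyp (\<lambda>x. of_real (y i x - y j x)))"
      proof (rule transc_hyp)
        show "moderate (\<lambda>x. of_real (y i x - y j x))" using moderate_diff[OF my[OF ij(1)] my[OF ij(2)]] by simp
        show "rho x * (y i x - y j x) \<in> \<int>" for x
          using y(2)[OF ij(1), of x] y(2)[OF ij(2), of x] by (simp add: right_diff_distrib)
      qed (rule fib[OF ij])
      ultimately show ?thesis by simp
    qed
    have "abs_hyp (\<lambda>x. 2 * pi * \<i>) \<in> fst_hyp"
      using fst_hypI[of "\<lambda>_. 2 * pi * \<i>"] by (simp add: moderate_const)
    then show "w \<in> fst_hyp" by (simp add: w_def)
    have "cmod (2 * pi * \<i>) \<ge> 1" using pi_gt3 by (simp add: norm_mult)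
    then show "nrm w = 1" unfolding w_def by (intro nrm_const) auto
    show "nrm (E i - expsum w (Y i) k) \<le> exp (- e) ^ k" if i: "i < m" for i k
    proof -
      have mwy: "moderate (\<lambda>x. 2 * pi * \<i> * y i x)"
        using moderate_mult[OF moderate_const[of "2 * pi * \<i>"] my[OF i]] .
      have summand: "moderate (\<lambda>x. (2 * pi * \<i> * y i x) ^ j / fact j) \<and>
        (w * Y i) ^ j / fact j = abs_hyp (\<lambda>x. (2 * pi * \<i> * y i x) ^ j / fact j)" for j
      proof
        show "moderate (\<lambda>x. (2 * pi * \<i> * y i x) ^ j / fact j)"
          using moderate_mult[OF moderate_power[OF mwy, of j] moderate_const[of "inverse (fact j)"]]
          by (simp only: divide_inverse)
        have "w * Y i = abs_hyp (\<lambda>x. 2 * pi * \<i> * y i x)"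
          using my[OF i] by (simp add: w_def Y_def abs_hyp_mult moderate_const)
        then have "(w * Y i) ^ j = abs_hyp (\<lambda>x. (2 * pi * \<i> * y i x) ^ j)"
          by (simp only: abs_hyp_power[OF mwy])
        then show "(w * Y i) ^ j / fact j = abs_hyp (\<lambda>x. (2 * pi * \<i> * y i x) ^ j / fact j)"
          using abs_hyp_divide_of_nat[OF moderate_power[OF mwy, of j], of "fact j"] by simp
      qed
      define S where "S = (\<lambda>x. \<Sum>j<k. (2 * pi * \<i> * y i x) ^ j / fact j)"
      have mS: "moderate S" unfolding S_def using summand by (intro moderate_sum) blast
      have "expsum w (Y i) k = (\<Sum>j<k. abs_hyp (\<lambda>x. (2 * pi * \<i> * y i x) ^ j / fact j))"
        unfolding expsum_def using summand by (intro sum.cong) blast+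
      also have "\<dots> = abs_hyp S" unfolding S_def using summand by (intro abs_hyp_sum) blast
      finally have eq: "E i - expsum w (Y i) k = abs_hyp (\<lambda>x. exp (2 * pi * \<i> * y i x) - S x)"
        using mE mS by (simp add: E_def abs_hyp_diff)
      have "nrm (abs_hyp (\<lambda>x. exp (2 * pi * \<i> * y i x) - S x)) \<le> exp (- e * real k)"
      proof (rule nrm_leI)
        show "moderate (\<lambda>x. exp (2 * pi * \<i> * y i x) - S x)" using mE mS by (rule moderate_diff)
        fix s assume s: "- e * real k < s"
        \<comment> \<open>Constant for the remainder of the exponential series when
          \<open>cmod z \<le> 2 * pi\<close>; the spare positive power \<open>s + e * real k\<close>
          of the scale absorbs it.\<close>
        define D where "D = exp (2 * pi) * (2 * pi) ^ k + 1"
        have "eventually (\<lambda>x. D \<le> rho x powr (s + e * real k)) UU" using s by (intro const_le_rho) auto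
        then show "bd (\<lambda>x. exp (2 * pi * \<i> * y i x) - S x) s" unfolding bd_def
        proof eventually_elim
          case (elim x)
          define z where "z = 2 * pi * \<i> * y i x"
          have nz: "cmod z = 2 * pi * \<bar>y i x\<bar>" by (simp add: z_def norm_mult)
          have y1: "\<bar>y i x\<bar> \<le> 1"
          proof -
            have "rho x powr - e \<le> 1" using rho_pos[of x] m by (simp add: powr_minus inverse_le_1_iff ge_one_powr_ge_zero)
            then show ?thesis using y(1)[OF i, of x] by linarith
          qed
          have "cmod (exp z - (\<Sum>j<k. z ^ j / fact j)) \<le> exp (2 * pi) * (2 * pi) ^ k * \<bar>y i x\<bar> ^ k"
          proof (cases k)
            case 0
            have "exp (2 * pi) \<ge> 1" by simp
            then show ?thesis using nE[of i x] 0 unfolding z_def by simp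
          next
            case (Suc k')
            have "cmod (exp z - (\<Sum>j\<le>k'. z ^ j / fact j)) \<le> exp (cmod z) * cmod z ^ Suc k' / fact k'"
              by (rule Taylor_exp_field)
            also have "\<dots> \<le> exp (cmod z) * cmod z ^ Suc k' / 1"
              by (intro divide_left_mono) (auto simp: fact_ge_1)
            also have "\<dots> \<le> exp (2 * pi) * cmod z ^ Suc k'"
              unfolding div_by_1 by (intro mult_right_mono) (use y1 in \<open>auto simp: nz\<close>)
            also have "\<dots> = exp (2 * pi) * (2 * pi) ^ Suc k' * \<bar>y i x\<bar> ^ Suc k'"
              by (simp only: nz power_mult_distrib mult_ac)
            finally show ?thesis by (simp only: Suc lessThan_Suc_atMost)
          qed
          also have "\<dots> \<le> D * \<bar>y i x\<bar> ^ k" unfolding D_def by (intro mult_right_mono) auto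
          also have "\<dots> \<le> rho x powr (s + e * real k) * (rho x powr - e) ^ k"
            using elim y(1)[OF i, of x] by (intro mult_mono power_mono) auto
          also have "(rho x powr - e) ^ k = rho x powr (- e * real k)"
            using rho_pos[of x] by (simp add: powr_power mult.commute)
          also have "rho x powr (s + e * real k) * rho x powr (- e * real k) = rho x powr s"
            by (simp flip: powr_add)
          finally show ?case by (simp only: z_def S_def)
        qed
      qed
      then show ?thesis unfolding eq by (simp add: exp_of_nat_mult[symmetric] mult.commute)
    qed
    show "C i \<in> fst_hyp" if "i < m" for i unfolding C_def by (rule fst_hypI[OF mC[OF that]])
    show "0 < m" by (rule m)
    have "nrm (C 0) \<ge> 1" unfolding C_def using c1 m mC by (intro nrm_ge_1) auto
    then show "C 0 \<noteq> 0" by (auto simp: nrm_zero)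
  qed
  moreover have "(\<Sum>i<m. C i * E i) = 0"
  proof -
    have "(\<Sum>i<m. C i * E i) = (\<Sum>i<m. abs_hyp (\<lambda>x. c i (fst x) * exp (2 * pi * \<i> * y i x)))"
      unfolding C_def E_def using mC mE by (intro sum.cong) (simp_all add: abs_hyp_mult)
    also have "\<dots> = abs_hyp (\<lambda>x. \<Sum>i<m. c i (fst x) * exp (2 * pi * \<i> * y i x))"
      using mC mE by (intro abs_hyp_sum moderate_mult) auto
    also have "\<dots> = 0"
    proof (subst abs_hyp_eq_0_iff)
      show "moderate (\<lambda>x. \<Sum>i<m. c i (fst x) * exp (2 * pi * \<i> * y i x))"
        using mC mE by (intro moderate_sum moderate_mult) auto
      show "negl (\<lambda>x. \<Sum>i<m. c i (fst x) * exp (2 * pi * \<i> * y i x))"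
        unfolding negl_def bd_def using small by blast
    qed
    finally show ?thesis .
  qed
  ultimately show False by simp
qed

section \<open>Small sums of roots of unity\<close>

text \<open>By averaging, one of at most \<open>(2 * P) ^ m\<close> cubes of side
  \<open>1 / P\<close> contains its share of \<open>S\<close>; here \<open>2 * P\<close> bounds the
  number \<open>\<lfloor>P\<rfloor> + 1\<close> of intervals per coordinate.\<close>

lemma box_pigeonhole:
  fixes x :: "nat \<Rightarrow> 'a \<Rightarrow> real"
  assumes S: "finite S" and x: "\<And>i t. 0 \<le> x i t \<and> x i t < 1" and P: "P \<ge> 1"
  shows "\<exists>S'\<subseteq>S. real (card S) \<le> real (card S') * (2 * P) ^ m \<and>
    (\<forall>t\<in>S'. \<forall>t'\<in>S'. \<forall>i<m. \<bar>x i t - x i t'\<bar> \<le> 1 / P)"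
proof -
  define T where "T = PiE {..<m} (\<lambda>_. {..nat \<lfloor>P\<rfloor>})"
  define \<phi> where "\<phi> = (\<lambda>t. restrict (\<lambda>i. nat \<lfloor>x i t * P\<rfloor>) {..<m})"
  have T: "finite T" "T \<noteq> {}" unfolding T_def by (auto intro: finite_PiE simp: PiE_eq_empty_iff)
  have "real (card T) = (real (nat \<lfloor>P\<rfloor>) + 1) ^ m" unfolding T_def by (subst card_PiE) (auto simp: add.commute)
  also have "\<dots> \<le> (2 * P) ^ m" using P by (intro power_mono) linarith+
  finally have cT: "real (card T) \<le> (2 * P) ^ m" .
  have "\<phi> ` S \<subseteq> T"
  proof
    fix v assume "v \<in> \<phi> ` S"
    then obtain t where v: "v = \<phi> t" by blast
    have "x i t * P \<le> P" for i using x[of i t] P by (simp add: mult_left_le_one_le)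
    then have "\<lfloor>x i t * P\<rfloor> \<le> \<lfloor>P\<rfloor>" for i by (rule floor_mono)
    then show "v \<in> T" by (auto simp: v T_def \<phi>_def intro!: nat_mono)
  qed
  from sum.group[OF S T(1) this, of "\<lambda>_. 1 :: real"]
  have cS: "(\<Sum>v\<in>T. real (card {t \<in> S. \<phi> t = v})) = real (card S)" by simp
  have "\<exists>v\<in>T. real (card S) \<le> real (card {t \<in> S. \<phi> t = v}) * (2 * P) ^ m"
  proof (rule ccontr)
    assume "\<not> ?thesis"
    then have less: "real (card {t \<in> S. \<phi> t = v}) * (2 * P) ^ m < real (card S)" if "v \<in> T" for v
      using that by (auto simp: not_le)
    have "real (card S) * (2 * P) ^ m = (\<Sum>v\<in>T. real (card {t \<in> S. \<phi> t = v}) * (2 * P) ^ m)"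
      by (simp add: cS flip: sum_distrib_right)
    also have "\<dots> < (\<Sum>v\<in>T. real (card S))" by (rule sum_strict_mono[OF T less])
    also have "\<dots> = real (card S) * real (card T)" by simp
    also have "\<dots> \<le> real (card S) * (2 * P) ^ m" using cT by (intro mult_left_mono) auto
    finally show False by simp
  qed
  then obtain v where v: "v \<in> T" "real (card S) \<le> real (card {t \<in> S. \<phi> t = v}) * (2 * P) ^ m" by blast
  show ?thesis
  proof (intro exI[of _ "{t \<in> S. \<phi> t = v}"] conjI ballI allI impI v(2))
    fix t t' i assume t: "t \<in> {t \<in> S. \<phi> t = v}" "t' \<in> {t \<in> S. \<phi> t = v}" "i < m"
    then have "\<phi> t i = \<phi> t' i" by simp
    then have "nat \<lfloor>x i t * P\<rfloor> = nat \<lfloor>x i t' * P\<rfloor>" using t(3) by (simp add: \<phi>_def)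
    moreover have "x i t * P \<ge> 0" "x i t' * P \<ge> 0" using x P by simp_all
    ultimately have "\<bar>x i t * P - x i t' * P\<bar> \<le> 1" by linarith
    then have "\<bar>(x i t - x i t') * P\<bar> \<le> 1" by (simp add: left_diff_distrib)
    moreover have "\<bar>P\<bar> = P" using P by simp
    ultimately have "\<bar>x i t - x i t'\<bar> * P \<le> 1" by (simp only: abs_mult)
    then show "\<bar>x i t - x i t'\<bar> \<le> 1 / P" using P by (simp add: pos_le_divide_eq)
  qed blast
qed

lemma exp_frac: "exp (2 * pi * \<i> * of_real (frac r)) = exp (2 * pi * \<i> * of_real r)"
proof -
  have "2 * pi * \<i> * of_real r = 2 * pi * \<i> * of_real (frac r) + of_int \<lfloor>r\<rfloor> * (2 * pi * \<i>)"
    by (simp add: frac_def algebra_simps)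
  moreover have "exp (of_int \<lfloor>r\<rfloor> * (2 * pi * \<i>)) = 1"
    using exp_integer_2pi[of "of_int \<lfloor>r\<rfloor>"] by (simp add: mult_ac)
  ultimately show ?thesis by (simp add: exp_add)
qed

text \<open>Turns a sequence of counterexamples into an exceptional configuration. Distinctness of
  the \<open>b N i\<close> and primality of \<open>p N\<close> make the differences
  \<open>y i - y j\<close> injective in \<open>t\<close>.\<close>

lemma no_small_sums:
  fixes p :: "nat \<Rightarrow> nat" and b k :: "nat \<Rightarrow> nat \<Rightarrow> nat" and S :: "nat \<Rightarrow> nat set"
  assumes p: "\<And>N. prime (p N)" and m: "m > 0" and b: "\<And>N i. i < m \<Longrightarrow> b N i < p N" "\<And>N. inj_on (b N) {..<m}"
    and k: "\<And>N i. i < m \<Longrightarrow> 1 \<le> k N i \<and> k N i \<le> M"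
    and S: "\<And>N. S N \<subseteq> {0..<p N}" "\<And>N. real N * real (p N) powr \<epsilon> < real (card (S N))" and \<epsilon>: "\<epsilon> > 0"
    and small: "\<And>N t. t \<in> S N \<Longrightarrow>
      cmod (\<Sum>i<m. of_nat (k N i) * exp (2 * pi * \<i> * of_real (real (b N i) * real t / real (p N)))) \<le> real (p N) powr - real N"
  shows False
proof -
  \<comment> \<open>\<open>m\<close> coordinates cut at \<open>p powr (- e)\<close> give about
    \<open>p powr \<epsilon>\<close> boxes, which the assumed size of \<open>S N\<close>
    outweighs.\<close>
  define e where "e = \<epsilon> / real m"
  have e: "e > 0" using \<epsilon> m by (simp add: e_def)
  have p2: "p N \<ge> 2" for N using p[of N] by (rule prime_ge_2_nat)
  then have p1: "real (p N) \<ge> 2" "real (p N) > 0" "real (p N) \<ge> 1" for N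
    by (simp_all add: order_trans[OF _ p2] le_trans[OF _ p2] less_le_trans[OF _ p2])
  have fS: "finite (S N)" for N using S(1) by (rule finite_subset) simp
  \<comment> \<open>\<open>S N\<close> has at most \<open>p N\<close> elements, so the primes tend
    to infinity.\<close>
  have pN: "real N \<le> real (p N)" for N
  proof -
    have "real N * 1 \<le> real N * real (p N) powr \<epsilon>"
      using p1(3) \<epsilon> by (intro mult_left_mono ge_one_powr_ge_zero) auto
    also have "\<dots> \<le> real (card (S N))" using S(2)[of N] by simp
    also have "card (S N) \<le> card {0..<p N}" using S(1) by (intro card_mono) auto
    finally show ?thesis by simp
  qed
  define x where "x = (\<lambda>N i t. frac (real (b N i) * real t / real (p N)))"
  define Q where "Q = (\<lambda>N S'. S' \<subseteq> S N \<and> real (card (S N)) \<le> real (card S') * (2 * real (p N) powr e) ^ m \<and>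
    (\<forall>t\<in>S'. \<forall>t'\<in>S'. \<forall>i<m. \<bar>x N i t - x N i t'\<bar> \<le> 1 / real (p N) powr e))"
  define S' where "S' = (\<lambda>N. SOME A. Q N A)"
  have QS: "Q N (S' N)" for N
  proof -
    have "\<exists>A. Q N A" unfolding Q_def
      by (rule box_pigeonhole[OF fS]) (use p1(3) e in \<open>auto simp: x_def frac_lt_1 intro: ge_one_powr_ge_zero\<close>)
    then show ?thesis unfolding S'_def by (rule someI_ex)
  qed
  have S': "S' N \<subseteq> S N" "real (card (S N)) \<le> real (card (S' N)) * (2 * real (p N) powr e) ^ m"
    "\<And>t t' i. t \<in> S' N \<Longrightarrow> t' \<in> S' N \<Longrightarrow> i < m \<Longrightarrow> \<bar>x N i t - x N i t'\<bar> \<le> 1 / real (p N) powr e" for N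
    using QS[of N] unfolding Q_def by blast+
  have fS': "finite (S' N)" for N using S'(1) fS by (rule finite_subset)
  have cS': "real N < real (card (S' N)) * 2 ^ m" for N
  proof -
    have "(real (p N) powr e) ^ m = real (p N) powr \<epsilon>" using p1(2)[of N] m by (simp add: powr_power e_def)
    then have "real N * real (p N) powr \<epsilon> < (real (card (S' N)) * 2 ^ m) * real (p N) powr \<epsilon>"
      using less_le_trans[OF S(2)[of N] S'(2)[of N]] by (simp add: power_mult_distrib)
    then show ?thesis using p1(2)[of N] by (simp add: mult_less_cancel_right)
  qed
  define t0 where "t0 = (\<lambda>N. SOME t. t \<in> S' N)"
  have t0: "t0 N \<in> S' N" for N
  proof -
    have "S' N \<noteq> {}" using cS'[of N] by auto
    then show ?thesis unfolding t0_def by (simp add: some_in_eq)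
  qed
  \<comment> \<open>The default 0 outside the chosen box is needed because \<open>small_sum\<close>
    imposes its bounds on \<open>y\<close> at every point.\<close>
  define y where "y = (\<lambda>i z. if snd z \<in> S' (fst z) then x (fst z) i (snd z) - x (fst z) i (t0 (fst z)) else 0)"
  \<comment> \<open>The phase at the base point moves into the coefficient, which therefore depends
    on \<open>N\<close> alone.\<close>
  define c where "c = (\<lambda>i N. of_nat (k N i) * exp (2 * pi * \<i> * of_real (x N i (t0 N))))"
  define \<rho> where "\<rho> = (\<lambda>N. real (p N))"

  \<comment> \<open>The predicates that fail at only boundedly many points of \<open>S' N\<close>,
    for all large \<open>N\<close>. A finer ultrafilter cannot contain a predicate with bounded
    fibres, which is the fibre condition of \<open>small_sum\<close>.\<close>
  define small_set where "small_set = (\<lambda>P. \<exists>d N0. \<forall>N\<ge>N0. card {t \<in> S' N. \<not> P (N, t)} \<le> (d::nat))"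
  define F where "F = Abs_filter small_set"
  have "is_filter small_set"
  proof
    show "small_set (\<lambda>_. True)" by (simp add: small_set_def)
    show "small_set (\<lambda>z. P z \<and> R z)" if PR: "small_set P" "small_set R" for P R
    proof -
      obtain d N0 d' N0' where d: "\<And>N. N \<ge> N0 \<Longrightarrow> card {t \<in> S' N. \<not> P (N, t)} \<le> d"
        "\<And>N. N \<ge> N0' \<Longrightarrow> card {t \<in> S' N. \<not> R (N, t)} \<le> d'" using PR unfolding small_set_def by blast
      have "card {t \<in> S' N. \<not> (P (N, t) \<and> R (N, t))} \<le> d + d'" if N: "N \<ge> max N0 N0'" for N
      proof -
        have "{t \<in> S' N. \<not> (P (N, t) \<and> R (N, t))} = {t \<in> S' N. \<not> P (N, t)} \<union> {t \<in> S' N. \<not> R (N, t)}" by auto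
        then have "card {t \<in> S' N. \<not> (P (N, t) \<and> R (N, t))} \<le> card {t \<in> S' N. \<not> P (N, t)} + card {t \<in> S' N. \<not> R (N, t)}"
          by (simp add: card_Un_le)
        then show ?thesis using d(1)[of N] d(2)[of N] N by simp
      qed
      then show ?thesis unfolding small_set_def by blast
    qed
    show "small_set R" if PR: "\<forall>z. P z \<longrightarrow> R z" "small_set P" for P R
    proof -
      obtain d N0 where d: "\<And>N. N \<ge> N0 \<Longrightarrow> card {t \<in> S' N. \<not> P (N, t)} \<le> d"
        using PR(2) unfolding small_set_def by blast
      have "card {t \<in> S' N. \<not> R (N, t)} \<le> card {t \<in> S' N. \<not> P (N, t)}" for N
        using PR(1) fS' by (intro card_mono) auto
      then have "\<And>N. N \<ge> N0 \<Longrightarrow> card {t \<in> S' N. \<not> R (N, t)} \<le> d" using d by (meson order_trans)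
      then show ?thesis unfolding small_set_def by blast
    qed
  qed
  then have F: "eventually P F \<longleftrightarrow> small_set P" for P unfolding F_def by (rule eventually_Abs_filter)
  have "F \<noteq> bot" unfolding trivial_limit_def F
  proof
    assume "small_set (\<lambda>_. False)"
    then obtain d N0 where d: "\<And>N. N \<ge> N0 \<Longrightarrow> card (S' N) \<le> d" unfolding small_set_def by auto
    have "real (max N0 (d * 2 ^ m)) < real (card (S' (max N0 (d * 2 ^ m)))) * 2 ^ m" by (rule cS')
    also have "\<dots> \<le> real d * 2 ^ m" using d[of "max N0 (d * 2 ^ m)"] by (intro mult_right_mono) auto
    also have "\<dots> = real (d * 2 ^ m)" by simp
    finally show False unfolding of_nat_less_iff by simp
  qed
  then obtain U where U: "U \<le> F" "ultra U" using ultra_exists by blast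
  have evU: "eventually P U" if "small_set P" for P using that U(1) F unfolding le_filter_def by blast
  have ev_S': "eventually (\<lambda>z. snd z \<in> S' (fst z)) U"
    by (rule evU) (auto simp: small_set_def intro!: exI[of _ "0::nat"])
  have ev_ge: "eventually (\<lambda>z. fst z \<ge> N0) U" for N0
    by (rule evU, unfold small_set_def, rule exI[of _ 0], rule exI[of _ N0]) auto

  have "filterlim (\<lambda>z. \<rho> (fst z)) at_top U" unfolding filterlim_at_top
  proof
    fix Z :: real
    obtain N0 :: nat where N0: "Z \<le> real N0" using real_arch_simple by blast
    show "eventually (\<lambda>z. Z \<le> \<rho> (fst z)) U" using ev_ge[of N0]
    proof eventually_elim
      case (elim z)
      then have "real N0 \<le> real (fst z)" by simp
      then show ?case unfolding \<rho>_def using N0 pN[of "fst z"] by linarith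
    qed
  qed
  then have "admissible (\<rho>, U)" using U(2) p1(1) by (simp add: admissible_def \<rho>_def)
  then have "\<not> exceptional (\<rho>, U)" by (rule not_exceptional)
  moreover have "small_sum \<rho> U m y c e" unfolding small_sum_def
  proof (intro conjI allI impI)
    show "m > 0" "e > 0" by fact+
  next
    fix i z assume i: "i < m"
    have "\<bar>y i z\<bar> \<le> 1 / real (p (fst z)) powr e"
      using S'(3)[OF _ t0 i, of "snd z" "fst z"] by (simp add: y_def)
    then show "\<bar>y i z\<bar> \<le> \<rho> (fst z) powr - e" by (simp add: \<rho>_def powr_minus_divide)
    have px: "real (p N) * x N i t \<in> \<int>" for N t
    proof -
      have "real (p N) * x N i t = of_int (int (b N i) * int t - int (p N) * \<lfloor>real (b N i) * real t / real (p N)\<rfloor>)"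
        using p1(2)[of N] by (simp add: x_def frac_def right_diff_distrib)
      then show ?thesis by (metis Ints_of_int)
    qed
    then show "\<rho> (fst z) * y i z \<in> \<int>" unfolding y_def \<rho>_def by (simp add: right_diff_distrib)
  next
    fix i n assume i: "i < m"
    show "1 \<le> cmod (c i n)" using k[OF i, of n] by (simp add: c_def norm_mult norm_exp_eq_Re)
  next
    fix i assume i: "i < m"
    have "cmod (c i n) \<le> \<rho> n powr real M" for n
    proof -
      have "cmod (c i n) \<le> real M" using k[OF i, of n] by (simp add: c_def norm_mult norm_exp_eq_Re)
      also have "\<dots> \<le> 2 ^ M" using of_nat_less_two_power[of M, where 'a = real] by simp
      also have "\<dots> \<le> \<rho> n ^ M" using p1(1)[of n] by (intro power_mono) (auto simp: \<rho>_def)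
      also have "\<dots> = \<rho> n powr real M" using p1(2)[of n] by (simp add: powr_realpow \<rho>_def)
      finally show ?thesis .
    qed
    then show "\<exists>s. \<forall>n. cmod (c i n) \<le> \<rho> n powr s" by blast
  next
    fix i j A and d :: nat
    assume ij: "i < m" "j < m" "i \<noteq> j" and A: "eventually A U"
    have inj: "inj_on (\<lambda>t. y i (N, t) - y j (N, t)) (S' N)" for N
    proof (rule inj_onI)
      fix t t' assume t: "t \<in> S' N" "t' \<in> S' N" and "y i (N, t) - y j (N, t) = y i (N, t') - y j (N, t')"
      then have "x N i t - x N j t = x N i t' - x N j t'" by (simp add: y_def)
      \<comment> \<open>Collects the integer parts removed by \<open>frac\<close>; then
        \<open>(b N i - b N j) * (t - t')\<close> equals \<open>p N * q\<close>, and primality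
        decides.\<close>
      define q where "q = \<lfloor>real (b N i) * real t / real (p N)\<rfloor> - \<lfloor>real (b N j) * real t / real (p N)\<rfloor>
        - \<lfloor>real (b N i) * real t' / real (p N)\<rfloor> + \<lfloor>real (b N j) * real t' / real (p N)\<rfloor>"
      have "real (b N i) * real t / real (p N) - real (b N j) * real t / real (p N)
        - real (b N i) * real t' / real (p N) + real (b N j) * real t' / real (p N) = of_int q"
        using \<open>x N i t - x N j t = x N i t' - x N j t'\<close> by (simp add: x_def frac_def q_def)
      moreover have "(real (b N i) - real (b N j)) * (real t - real t') = real (p N) *
        (real (b N i) * real t / real (p N) - real (b N j) * real t / real (p N)
        - real (b N i) * real t' / real (p N) + real (b N j) * real t' / real (p N))"
        using p1(2)[of N] by (simp add: distrib_left right_diff_distrib left_diff_distrib)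
      ultimately have "(real (b N i) - real (b N j)) * (real t - real t') = real (p N) * of_int q" by simp
      then have "real_of_int ((int (b N i) - int (b N j)) * (int t - int t')) = real_of_int (int (p N) * q)" by simp
      then have "(int (b N i) - int (b N j)) * (int t - int t') = int (p N) * q" unfolding of_int_eq_iff .
      then have "int (p N) dvd (int (b N i) - int (b N j)) * (int t - int t')" by simp
      then have dvd: "int (p N) dvd int (b N i) - int (b N j) \<or> int (p N) dvd int t - int t'"
        using p[of N] by (simp add: prime_dvd_mult_iff)
      have zero: "u = v" if "int (p N) dvd int u - int v" "u < p N" "v < p N" for u v
      proof -
        have "\<bar>int u - int v\<bar> < int (p N)" using that by linarith
        then have "int u - int v = 0" using that(1) zdvd_not_zless[of "\<bar>int u - int v\<bar>" "int (p N)"] by auto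
        then show ?thesis by simp
      qed
      have "b N i \<noteq> b N j" using b(2)[of N] ij by (auto simp: inj_on_def)
      then have "int (p N) dvd int t - int t'" using dvd zero b(1)[OF ij(1), of N] b(1)[OF ij(2), of N] by blast
      moreover have "t < p N" "t' < p N" using t S'(1)[of N] S(1)[of N] by auto
      ultimately show "t = t'" by (rule zero)
    qed
    \<comment> \<open>Bounded fibres of \<open>A\<close> would put its negation into the
      filter.\<close>
    have "\<exists>N. card {t \<in> S' N. A (N, t)} \<ge> d"
    proof (rule ccontr)
      assume "\<not> ?thesis"
      then have "\<forall>N\<ge>0. card {t \<in> S' N. \<not> \<not> A (N, t)} \<le> d" by (auto simp: not_le intro: less_imp_le)
      then have "small_set (\<lambda>z. \<not> A z)" unfolding small_set_def by blast
      from eventually_conj[OF evU[OF this] A] have "eventually (\<lambda>_. False) U" by (rule eventually_mono) blast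
      then show False using U(2) by (simp add: ultra_def trivial_limit_def)
    qed
    then obtain N where "card {t \<in> S' N. A (N, t)} \<ge> d" by blast
    then obtain T where T: "T \<subseteq> {t \<in> S' N. A (N, t)}" "card T = d" "finite T" by (rule obtain_subset_with_card_n)
    have "inj_on (\<lambda>t. y i (N, t) - y j (N, t)) T" using inj by (rule inj_on_subset) (use T in blast)
    then show "\<exists>n T. finite T \<and> card T = d \<and> (\<forall>t\<in>T. A (n, t)) \<and> inj_on (\<lambda>t. y i (n, t) - y j (n, t)) T"
      using T by blast
  next
    fix s :: real
    show "eventually (\<lambda>z. cmod (\<Sum>i<m. c i (fst z) * exp (2 * pi * \<i> * y i z)) \<le> \<rho> (fst z) powr s) U"
      using ev_S' ev_ge[of "nat \<lceil>- s\<rceil>"]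
    proof eventually_elim
      case (elim z)
      define N t where "N = fst z" and "t = snd z"
      have t: "t \<in> S' N" using elim by (simp add: N_def t_def)
      have "c i N * exp (2 * pi * \<i> * y i z) = of_nat (k N i) * exp (2 * pi * \<i> * of_real (real (b N i) * real t / real (p N)))" for i
      proof -
        have "c i N * exp (2 * pi * \<i> * y i z) = of_nat (k N i) * exp (2 * pi * \<i> * of_real (x N i t))"
          using t by (simp add: c_def y_def N_def t_def algebra_simps flip: exp_add)
        then show ?thesis by (simp only: x_def exp_frac)
      qed
      then have "cmod (\<Sum>i<m. c i N * exp (2 * pi * \<i> * y i z)) \<le> real (p N) powr - real N"
        using small[of t N] t S'(1)[of N] by auto
      also have "\<dots> \<le> real (p N) powr s"
        using p1(3)[of N] elim by (intro powr_mono) (auto simp: N_def nat_le_iff, linarith)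
      finally show ?case by (simp add: N_def \<rho>_def)
    qed
  qed
  ultimately show False by (auto simp: exceptional_def \<rho>_def)
qed

text \<open>Equal roots are merged into one term with a multiplicity, so that the frequencies
  \<open>b\<close> become distinct. Index 0 stands for the summand 1; the multiplicities are
  positive, so no coefficient cancels.\<close>

lemma root_sum_grouping:
  assumes p: "p > 0" and \<zeta>: "\<And>i. i \<in> {1..n} \<Longrightarrow> \<zeta> i \<in> roots_unity p"
  shows "\<exists>m b k. 0 < m \<and> m \<le> n + 1 \<and> (\<forall>i<m. b i < p \<and> 1 \<le> k i \<and> k i \<le> n + 1) \<and> inj_on b {..<m} \<and>
    (\<forall>t. 1 + (\<Sum>i=1..n. \<zeta> i ^ t) = (\<Sum>i<m. of_nat (k i) * exp (2 * pi * \<i> * of_real (real (b i) * real t / real p))))"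
proof -
  have "\<exists>a<p. \<zeta> i = exp (2 * pi * \<i> * a / p)" if "i \<in> {1..n}" for i
    using \<zeta>[OF that] complex_roots_unity[of p] p unfolding roots_unity_def by auto
  then obtain a where a: "\<And>i. i \<in> {1..n} \<Longrightarrow> a i < p \<and> \<zeta> i = exp (2 * pi * \<i> * a i / p)" by metis
  define a' where "a' = (\<lambda>i. if i = 0 then 0 else a i)"
  define e where "e = (\<lambda>t j. exp (2 * pi * \<i> * of_real (real j * real t / real p)))"
  define B where "B = a' ` {0..n}"
  define k where "k = (\<lambda>v. card {j \<in> {0..n}. a' j = v})"
  have fB: "finite B" "B \<noteq> {}" by (auto simp: B_def)
  obtain h where h: "bij_betw h {..<card B} B" using ex_bij_betw_nat_finite[OF fB(1)] by (auto simp: atLeast0LessThan)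
  have hB: "h i \<in> B" if "i < card B" for i using h that by (auto simp: bij_betw_def)
  show ?thesis
  proof (rule exI[of _ "card B"], rule exI[of _ h], rule exI[of _ "\<lambda>i. k (h i)"], intro conjI allI impI)
    show "0 < card B" using fB by (simp add: card_gt_0_iff)
    show "card B \<le> n + 1" unfolding B_def using card_image_le[of "{0..n}" a'] by simp
    show "inj_on h {..<card B}" using h by (simp add: bij_betw_def)
    fix i assume i: "i < card B"
    obtain j where j: "j \<in> {0..n}" "h i = a' j" using hB[OF i] by (auto simp: B_def)
    show "h i < p" using j p a[of j] by (auto simp: a'_def)
    have "{j \<in> {0..n}. a' j = h i} \<noteq> {}" using j by auto
    then show "1 \<le> k (h i)" unfolding k_def by (simp add: Suc_le_eq card_gt_0_iff)
    have "card {j \<in> {0..n}. a' j = h i} \<le> card {0..n}" by (intro card_mono) auto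
    then show "k (h i) \<le> n + 1" by (simp add: k_def)
  next
    fix t
    have pw: "\<zeta> i ^ t = e t (a' i)" if "i \<in> {1..n}" for i
    proof -
      have "\<zeta> i ^ t = exp (of_nat t * (2 * pi * \<i> * a i / p))" using a[OF that] by (simp only: exp_of_nat_mult)
      also have "of_nat t * (2 * pi * \<i> * a i / p) = 2 * pi * \<i> * of_real (real (a i) * real t / real p)" by simp
      finally show ?thesis using that by (simp add: e_def a'_def)
    qed
    have "1 + (\<Sum>i=1..n. \<zeta> i ^ t) = e t (a' 0) + (\<Sum>i=1..n. e t (a' i))"
      using pw by (simp add: e_def a'_def)
    also have "\<dots> = (\<Sum>i\<in>{0..n}. e t (a' i))" by (simp add: sum.atLeast_Suc_atMost)
    also have "\<dots> = (\<Sum>v\<in>B. \<Sum>i\<in>{i \<in> {0..n}. a' i = v}. e t (a' i))"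
      unfolding B_def by (rule sum.image_gen) simp
    also have "\<dots> = (\<Sum>v\<in>B. of_nat (k v) * e t v)" by (intro sum.cong refl) (simp add: k_def)
    also have "\<dots> = (\<Sum>i<card B. of_nat (k (h i)) * e t (h i))" by (rule sum.reindex_bij_betw[OF h, symmetric])
    finally show "1 + (\<Sum>i=1..n. \<zeta> i ^ t) = (\<Sum>i<card B. of_nat (k (h i)) * exp (2 * pi * \<i> * of_real (real (h i) * real t / real p)))"
      by (simp only: e_def)
  qed
qed

theorem theorem1p3:
  fixes n :: nat
  assumes "n \<ge> 1"
  shows "\<forall>\<epsilon>::real. \<epsilon> > 0 \<longrightarrow>
    (\<exists>c l :: real. c \<ge> 1 \<and> l \<ge> 1 \<and>
      (\<forall>(p::nat) (\<zeta> :: nat \<Rightarrow> complex).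
        prime p \<longrightarrow> (\<forall>i\<in>{1..n}. \<zeta> i \<in> roots_unity p) \<longrightarrow>
        1 + (\<Sum>i=1..n. \<zeta> i) \<noteq> 0 \<longrightarrow>
        real (card {t \<in> {0..<p}. norm (1 + (\<Sum>i=1..n. \<zeta> i ^ t)) < inverse c * real p powr (- l)})
          \<le> c * real p powr \<epsilon>))"
proof (intro allI impI, rule ccontr)
  fix \<epsilon> :: real
  assume \<epsilon>: "\<epsilon> > 0" and neg: "\<not> (\<exists>c l :: real. c \<ge> 1 \<and> l \<ge> 1 \<and>
      (\<forall>(p::nat) (\<zeta> :: nat \<Rightarrow> complex).
        prime p \<longrightarrow> (\<forall>i\<in>{1..n}. \<zeta> i \<in> roots_unity p) \<longrightarrow>
        1 + (\<Sum>i=1..n. \<zeta> i) \<noteq> 0 \<longrightarrow>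
        real (card {t \<in> {0..<p}. norm (1 + (\<Sum>i=1..n. \<zeta> i ^ t)) < inverse c * real p powr (- l)})
          \<le> c * real p powr \<epsilon>))"
  \<comment> \<open>All data of a counterexample at level \<open>N\<close> in one tuple, so that a
    single choice covers them.\<close>
  define D where "D = (\<lambda>N z. case z of (p, m, b, k, S) \<Rightarrow> prime p \<and> 0 < m \<and> m \<le> n + 1 \<and>
    (\<forall>i<m. b i < p \<and> 1 \<le> k i \<and> k i \<le> n + 1) \<and> inj_on b {..<m} \<and>
    S \<subseteq> {0..<p} \<and> real N * real p powr \<epsilon> < real (card S) \<and>
    (\<forall>t\<in>S. cmod (\<Sum>i<m. of_nat (k i) * exp (2 * pi * \<i> * of_real (real (b i) * real t / real p))) \<le> real p powr - real N))"
  have "\<exists>z. D N z" for N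
  proof -
    \<comment> \<open>One constant in both roles \<open>c\<close> and \<open>l\<close>: as
      \<open>N\<close> grows, the sums fall below every power of \<open>p\<close> and the
      cardinalities exceed every multiple of \<open>p powr \<epsilon>\<close>.\<close>
    define C where "C = real N + 2"
    have C: "C \<ge> 1" by (simp add: C_def)
    have "\<not> (\<forall>(p::nat) (\<zeta> :: nat \<Rightarrow> complex).
        prime p \<longrightarrow> (\<forall>i\<in>{1..n}. \<zeta> i \<in> roots_unity p) \<longrightarrow>
        1 + (\<Sum>i=1..n. \<zeta> i) \<noteq> 0 \<longrightarrow>
        real (card {t \<in> {0..<p}. norm (1 + (\<Sum>i=1..n. \<zeta> i ^ t)) < inverse C * real p powr (- C)})
          \<le> C * real p powr \<epsilon>)"
      using neg C by (elim contrapos_nn) (intro exI[of _ C] conjI)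
    then obtain p \<zeta> where p: "prime p" and \<zeta>: "\<And>i. i \<in> {1..n} \<Longrightarrow> \<zeta> i \<in> roots_unity p" and
      big: "C * real p powr \<epsilon> < real (card {t \<in> {0..<p}. norm (1 + (\<Sum>i=1..n. \<zeta> i ^ t)) < inverse C * real p powr (- C)})"
      unfolding not_all not_imp not_le by (elim exE conjE) (rule that[rotated -1], assumption+, erule (1) bspec)
    have p1: "real p \<ge> 1" "p > 0" using prime_ge_1_nat[OF p] by auto
    have ex: "\<exists>m b k. 0 < m \<and> m \<le> n + 1 \<and> (\<forall>i<m. b i < p \<and> 1 \<le> k i \<and> k i \<le> n + 1) \<and> inj_on b {..<m} \<and>
      (\<forall>t. 1 + (\<Sum>i=1..n. \<zeta> i ^ t) = (\<Sum>i<m. of_nat (k i) * exp (2 * pi * \<i> * of_real (real (b i) * real t / real p))))"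
      by (rule root_sum_grouping[OF p1(2) \<zeta>])
    obtain m b k where mbk: "0 < m \<and> m \<le> n + 1 \<and> (\<forall>i<m. b i < p \<and> 1 \<le> k i \<and> k i \<le> n + 1) \<and> inj_on b {..<m} \<and>
      (\<forall>t. 1 + (\<Sum>i=1..n. \<zeta> i ^ t) = (\<Sum>i<m. of_nat (k i) * exp (2 * pi * \<i> * of_real (real (b i) * real t / real p))))"
      using ex by (elim exE)
    then have sum_eq: "1 + (\<Sum>i=1..n. \<zeta> i ^ t) = (\<Sum>i<m. of_nat (k i) * exp (2 * pi * \<i> * of_real (real (b i) * real t / real p)))" for t
      by simp
    define S where "S = {t \<in> {0..<p}. norm (1 + (\<Sum>i=1..n. \<zeta> i ^ t)) < inverse C * real p powr (- C)}"
    have "real N * real p powr \<epsilon> \<le> C * real p powr \<epsilon>" by (intro mult_right_mono) (auto simp: C_def)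
    then have cS: "real N * real p powr \<epsilon> < real (card S)" using big by (simp add: S_def)
    have small: "cmod (1 + (\<Sum>i=1..n. \<zeta> i ^ t)) \<le> real p powr - real N" if "t \<in> S" for t
    proof -
      have "inverse C * real p powr (- C) \<le> 1 * real p powr - real N"
        using p1 C by (intro mult_mono powr_mono) (auto simp: C_def inverse_le_1_iff)
      then show ?thesis using that by (simp add: S_def)
    qed
    then have "D N (p, m, b, k, S)" unfolding D_def split
    proof (intro conjI ballI)
      show "prime p" "0 < m" "m \<le> n + 1" "\<forall>i<m. b i < p \<and> 1 \<le> k i \<and> k i \<le> n + 1" "inj_on b {..<m}"
        using p mbk by simp_all
      show "S \<subseteq> {0..<p}" by (auto simp: S_def)
      show "real N * real p powr \<epsilon> < real (card S)" by (rule cS)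
      show "cmod (\<Sum>i<m. of_nat (k i) * exp (2 * pi * \<i> * of_real (real (b i) * real t / real p))) \<le> real p powr - real N"
        if "t \<in> S" for t using small[OF that] by (simp only: sum_eq)
    qed
    then show ?thesis by (rule exI)
  qed
  then obtain z where z: "\<And>N. D N (z N)" by metis
  \<comment> \<open>The number of distinct terms may vary with \<open>N\<close> but is at most
    \<open>n + 1\<close>, so it is constant along a subsequence, on which the level
    \<open>g N\<close> is at least \<open>N\<close>.\<close>
  define mm where "mm = (\<lambda>N. fst (snd (z N)))"
  have "mm N \<le> n + 1" for N using z[of N] by (auto simp: D_def mm_def split: prod.splits)
  then have "finite (range mm)" by (intro finite_subset[of "range mm" "{..n + 1}"]) auto
  then obtain N0 where "infinite {N. mm N = mm N0}" using pigeonhole_infinite[of UNIV mm] by auto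
  then have "\<exists>M\<ge>N. mm M = mm N0" for N unfolding infinite_nat_iff_unbounded_le by blast
  then obtain g where g: "\<And>N. g N \<ge> N \<and> mm (g N) = mm N0" by metis
  define p b k S where "p = (\<lambda>N. fst (z (g N)))" and "b = (\<lambda>N. fst (snd (snd (z (g N)))))"
    and "k = (\<lambda>N. fst (snd (snd (snd (z (g N))))))" and "S = (\<lambda>N. snd (snd (snd (snd (z (g N))))))"
  have "z (g N) = (p N, mm N0, b N, k N, S N)" for N
    using g[of N] by (simp add: p_def b_def k_def S_def mm_def prod_eq_iff)
  then have DN: "D (g N) (p N, mm N0, b N, k N, S N)" for N using z[of "g N"] by simp
  have p1: "real (p N) \<ge> 1" for N using DN[of N] prime_ge_1_nat[of "p N"] by (auto simp: D_def)
  show False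
  proof (rule no_small_sums[where p = p and m = "mm N0" and b = b and k = k and S = S and M = "n + 1" and \<epsilon> = \<epsilon>])
    fix N
    have "real N * real (p N) powr \<epsilon> \<le> real (g N) * real (p N) powr \<epsilon>" using g[of N] by (intro mult_right_mono) auto
    also have "\<dots> < real (card (S N))" using DN[of N] by (simp add: D_def)
    finally show "real N * real (p N) powr \<epsilon> < real (card (S N))" .
    fix t assume t: "t \<in> S N"
    have "real (p N) powr - real (g N) \<le> real (p N) powr - real N" using p1 g[of N] by (intro powr_mono) auto
    moreover have "cmod (\<Sum>i<mm N0. of_nat (k N i) * exp (2 * pi * \<i> * of_real (real (b N i) * real t / real (p N)))) \<le> real (p N) powr - real (g N)"
      using DN[of N] t unfolding D_def split by blast
    ultimately show "cmod (\<Sum>i<mm N0. of_nat (k N i) * exp (2 * pi * \<i> * of_real (real (b N i) * real t / real (p N)))) \<le> real (p N) powr - real N"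
      by linarith
  next
    show "0 < \<epsilon>" by fact
    show "0 < mm N0" using DN[of 0] unfolding D_def split by blast
  next
    fix N show "prime (p N)" "inj_on (b N) {..<mm N0}" "S N \<subseteq> {0..<p N}"
      using DN[of N] unfolding D_def split by blast+
    fix i assume "i < mm N0"
    then show "b N i < p N" "1 \<le> k N i \<and> k N i \<le> n + 1" using DN[of N] unfolding D_def split by blast+
  qed
qed

end
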